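(* Let $(M,h)$ be a Hermitian manifold of complex dimension $n$ with background Riemannian metric $g=\mathrm{Re}\,h$. Let $D$ be the metric connection on $TM$ induced by the Chern connection under the bundle isomorphism $u\mapsto u_o=\frac12(u-\sqrt{-1}Ju)$ from $TM$ to $T^{1,0}M$. Then the scalar curvature $s_D$ of the induced metric connection $D$ equals four times the second Chern scalar curvature $s_D^{(2)}$: $$s_D=4\,s_D^{(2)} .$$
   Context: Greek indices run from $1$ to $n$, and repeated indices are summed. In local holomorphic coordinates $h=h_{\alpha\bar\beta}\,dz^\alpha d\bar z^\beta$, and $g=\mathrm{Re}\,h$, so that $g(u,v)=\mathrm{Re}(h_{\alpha\bar\beta}\xi^\alpha\bar\eta^\beta)$ for $u_o=\xi^\alpha\frac{\partial}{\partial z^\alpha},\ v_o=\eta^\alpha\frac{\partial}{\partial z^\alpha}$. $J$ is the complex structure and $(h^{\bar\beta\alpha})$ denotes the inverse matrix of $(h_{\alpha\bar\beta})$. The Chern connection is the unique connection on $T^{1,0}M$ compatible with $h$ and the holomorphic structure; its curvature components are $$\mathfrak R_{\alpha\bar\beta\gamma\bar\delta}=-\frac{\partial^2h_{\alpha\bar\beta}}{\partial z^\gamma\partial\bar z^\delta}+\frac{\partial h_{\alpha\bar\lambda}}{\partial z^\gamma}h^{\bar\lambda\kappa}\frac{\partial h_{\kappa\bar\beta}}{\partial\bar z^\delta}.$$ The second Chern scalar curvature is $s_D^{(2)}=h^{\bar\beta\alpha}\mathfrak R^{(3)}_{\alpha\bar\beta}$, where $\mathfrak R^{(3)}_{\alpha\bar\beta}=h^{\bar\delta\gamma}\mathfrak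 R_{\gamma\bar\beta\alpha\bar\delta}$. The induced metric connection, still denoted $D$, is the connection on the real tangent bundle $TM$ obtained by transporting the Chern connection through $u\mapsto u_o$, i.e. $(D_vu)_o=D_v(u_o)$ for real vector fields $u,v$. Its curvature is $(D^2u)(v,w)=D_vD_wu-D_wD_vu-D_{[v,w]}u$. Its scalar curvature is $$s_D=\sum_{i,j=1}^{2n}g\big((D^2e_j)(e_i,e_j),e_i\big),$$ where $\{e_i\}_{i=1}^{2n}$ is any $g$-orthonormal frame. *)

theory Defs
  imports "HOL-Analysis.Analysis"
begin

section \<open>Smooth and holomorphic functions on open subsets of complex n-space\<close>

text \<open>\<^term>\<open>frechet_derivative\<close> is the real derivative: \<open>complex^'n\<close> is used as a real vector
  space of dimension 2n, and \<open>axis \<alpha> 1\<close>, \<open>axis \<alpha> \<i>\<close> are its directions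
  \<open>x\<^sup>\<alpha>\<close>, \<open>y\<^sup>\<alpha>\<close> for \<open>z\<^sup>\<alpha> = x\<^sup>\<alpha> + \<i> y\<^sup>\<alpha>\<close>.  The two notions below are meant for open \<open>S\<close>.\<close>

primrec Ck_on :: "nat \<Rightarrow> 'a::euclidean_space set \<Rightarrow> ('a \<Rightarrow> 'b::real_normed_vector) \<Rightarrow> bool" where
  "Ck_on 0 S f \<longleftrightarrow> continuous_on S f"
| "Ck_on (Suc k) S f \<longleftrightarrow> (\<forall>x\<in>S. f differentiable (at x)) \<and>
     (\<forall>v. Ck_on k S (\<lambda>x. frechet_derivative f (at x) v))"

definition smooth_on :: "'a::euclidean_space set \<Rightarrow> ('a \<Rightarrow> 'b::real_normed_vector) \<Rightarrow> bool" where
  "smooth_on S f \<longleftrightarrow> (\<forall>k. Ck_on k S f)"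

text \<open>Holomorphic in several variables: smooth and satisfying the Cauchy-Riemann equations,
  that is, with complex-linear derivative.\<close>

definition holo_on :: "(complex^'n::finite) set \<Rightarrow> (complex^'n \<Rightarrow> complex) \<Rightarrow> bool" where
  "holo_on S f \<longleftrightarrow> smooth_on S f \<and>
     (\<forall>x\<in>S. \<forall>v. frechet_derivative f (at x) (\<i> *s v) = \<i> * frechet_derivative f (at x) v)"

definition wirt :: "'n::finite \<Rightarrow> (complex^'n \<Rightarrow> complex) \<Rightarrow> complex^'n \<Rightarrow> complex" where
  "wirt \<alpha> f x = (frechet_derivative f (at x) (axis \<alpha> 1)
                    - \<i> * frechet_derivative f (at x) (axis \<alpha> \<i>)) / 2"

definition wirt_bar :: "'n::finite \<Rightarrow> (complex^'n \<Rightarrow> complex) \<Rightarrow> complex^'n \<Rightarrow> complex" where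
  "wirt_bar \<alpha> f x = (frechet_derivative f (at x) (axis \<alpha> 1)
                        + \<i> * frechet_derivative f (at x) (axis \<alpha> \<i>)) / 2"


section \<open>Complex manifolds\<close>

text \<open>The manifold is the whole (Hausdorff, second countable) type \<open>'m\<close>; a chart is a domain
  together with a coordinate map, whose values outside the domain are irrelevant.\<close>

type_synonym ('m, 'n) chart = "'m set \<times> ('m \<Rightarrow> complex^'n)"

definition chart_inv :: "('m, 'n) chart \<Rightarrow> complex^'n \<Rightarrow> 'm" where
  "chart_inv c = inv_into (fst c) (snd c)"

definition is_chart :: "('m::topological_space, 'n::finite) chart \<Rightarrow> bool" where
  "is_chart c \<longleftrightarrow> open (fst c) \<and> open (snd c ` fst c) \<and>
     homeomorphism (fst c) (snd c ` fst c) (snd c) (chart_inv c)"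

definition complex_manifold ::
    "('m::{t2_space,second_countable_topology}, 'n::finite) chart set \<Rightarrow> bool" where
  "complex_manifold A \<longleftrightarrow>
     (\<forall>c\<in>A. is_chart c) \<and> (\<forall>p. \<exists>c\<in>A. p \<in> fst c) \<and>
     (\<forall>c\<in>A. \<forall>c'\<in>A. \<forall>\<alpha>.
        holo_on (snd c ` (fst c \<inter> fst c')) (\<lambda>x. snd c' (chart_inv c x) $ \<alpha>))"

definition smooth_fun ::
    "('m::topological_space, 'n::finite) chart set \<Rightarrow> 'm set \<Rightarrow> ('m \<Rightarrow> complex) \<Rightarrow> bool" where
  "smooth_fun A U f \<longleftrightarrow> (\<forall>c\<in>A. smooth_on (snd c ` (fst c \<inter> U)) (f \<circ> chart_inv c))"

definition holo_fun ::
    "('m::topological_space, 'n::finite) chart set \<Rightarrow> 'm set \<Rightarrow> ('m \<Rightarrow> complex) \<Rightarrow> bool" where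
  "holo_fun A U f \<longleftrightarrow> (\<forall>c\<in>A. holo_on (snd c ` (fst c \<inter> U)) (f \<circ> chart_inv c))"

definition smooth_near ::
    "('m::topological_space, 'n::finite) chart set \<Rightarrow> 'm \<Rightarrow> ('m \<Rightarrow> complex) \<Rightarrow> bool" where
  "smooth_near A p f \<longleftrightarrow> (\<exists>U. open U \<and> p \<in> U \<and> smooth_fun A U f)"


section \<open>Tangent vectors, complex structure, vector fields\<close>

text \<open>A complexified tangent vector at \<open>p\<close> is a first-order operator on complex functions that
  are smooth near \<open>p\<close>.  Since HOL functions are total, it is given the value 0 on all other
  functions; this makes equality of tangent vectors equality of operators.\<close>

type_synonym 'm tvec = "('m \<Rightarrow> complex) \<Rightarrow> complex"

definition dx :: "('m::topological_space, 'n::finite) chart set \<Rightarrow> ('m, 'n) chart \<Rightarrow> 'n \<Rightarrow> 'm \<Rightarrow> 'm tvec" where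
  "dx A c \<alpha> p = (\<lambda>f. if smooth_near A p f
     then frechet_derivative (f \<circ> chart_inv c) (at (snd c p)) (axis \<alpha> 1) else 0)"

definition dy :: "('m::topological_space, 'n::finite) chart set \<Rightarrow> ('m, 'n) chart \<Rightarrow> 'n \<Rightarrow> 'm \<Rightarrow> 'm tvec" where
  "dy A c \<alpha> p = (\<lambda>f. if smooth_near A p f
     then frechet_derivative (f \<circ> chart_inv c) (at (snd c p)) (axis \<alpha> \<i>) else 0)"

definition dz :: "('m::topological_space, 'n::finite) chart set \<Rightarrow> ('m, 'n) chart \<Rightarrow> 'n \<Rightarrow> 'm \<Rightarrow> 'm tvec" where
  "dz A c \<alpha> p = (\<lambda>f. (dx A c \<alpha> p f - \<i> * dy A c \<alpha> p f) / 2)"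

definition rtangent :: "('m::topological_space, 'n::finite) chart set \<Rightarrow> 'm \<Rightarrow> 'm tvec set" where
  "rtangent A p = {X. \<exists>c\<in>A. p \<in> fst c \<and> (\<exists>a b :: real^'n. X =
     (\<lambda>f. \<Sum>\<alpha>\<in>UNIV. of_real (a $ \<alpha>) * dx A c \<alpha> p f + of_real (b $ \<alpha>) * dy A c \<alpha> p f))}"

definition ctangent :: "('m::topological_space, 'n::finite) chart set \<Rightarrow> 'm \<Rightarrow> 'm tvec set" where
  "ctangent A p = {X. \<exists>c\<in>A. p \<in> fst c \<and> (\<exists>a b :: complex^'n. X =
     (\<lambda>f. \<Sum>\<alpha>\<in>UNIV. a $ \<alpha> * dx A c \<alpha> p f + b $ \<alpha> * dy A c \<alpha> p f))}"

text \<open>\<open>J\<close> (extended complex-linearly) maps \<open>\<partial>/\<partial>x\<^sup>\<alpha>\<close> to \<open>\<partial>/\<partial>y\<^sup>\<alpha>\<close> and \<open>\<partial>/\<partial>y\<^sup>\<alpha>\<close> to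
  \<open>- \<partial>/\<partial>x\<^sup>\<alpha>\<close>; the components of \<open>X\<close> are \<open>X(x\<^sup>\<alpha>)\<close> and \<open>X(y\<^sup>\<alpha>)\<close>.  Because transition maps are
  holomorphic, the result does not depend on the chart around \<open>p\<close> that is picked.\<close>

definition chart_at :: "('m, 'n) chart set \<Rightarrow> 'm \<Rightarrow> ('m, 'n) chart" where
  "chart_at A p = (SOME c. c \<in> A \<and> p \<in> fst c)"

definition J :: "('m::topological_space, 'n::finite) chart set \<Rightarrow> 'm \<Rightarrow> 'm tvec \<Rightarrow> 'm tvec" where
  "J A p X = (let c = chart_at A p in
     (\<lambda>f. \<Sum>\<alpha>\<in>UNIV. X (\<lambda>q. of_real (Re (snd c q $ \<alpha>))) * dy A c \<alpha> p f
                   - X (\<lambda>q. of_real (Im (snd c q $ \<alpha>))) * dx A c \<alpha> p f))"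

definition T10 :: "('m::topological_space, 'n::finite) chart set \<Rightarrow> 'm \<Rightarrow> 'm tvec set" where
  "T10 A p = {Z \<in> ctangent A p. J A p Z = (\<lambda>f. \<i> * Z f)}"

definition T01 :: "('m::topological_space, 'n::finite) chart set \<Rightarrow> 'm \<Rightarrow> 'm tvec set" where
  "T01 A p = {Z \<in> ctangent A p. J A p Z = (\<lambda>f. - \<i> * Z f)}"

text \<open>The isomorphism \<open>u \<mapsto> u\<^sub>o\<close> from the real tangent space onto \<open>T10\<close>.\<close>

definition o_map :: "('m::topological_space, 'n::finite) chart set \<Rightarrow> 'm \<Rightarrow> 'm tvec \<Rightarrow> 'm tvec" where
  "o_map A p u = (\<lambda>f. (u f - \<i> * J A p u f) / 2)"

definition smooth_field ::
    "('m::topological_space, 'n::finite) chart set \<Rightarrow> 'm set \<Rightarrow> ('m \<Rightarrow> 'm tvec) \<Rightarrow> bool" where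
  "smooth_field A U X \<longleftrightarrow>
     (\<forall>V f. open V \<and> V \<subseteq> U \<and> smooth_fun A V f \<longrightarrow> smooth_fun A V (\<lambda>q. X q f))"

definition real_field ::
    "('m::topological_space, 'n::finite) chart set \<Rightarrow> 'm set \<Rightarrow> ('m \<Rightarrow> 'm tvec) \<Rightarrow> bool" where
  "real_field A U u \<longleftrightarrow> (\<forall>q\<in>U. u q \<in> rtangent A q) \<and> smooth_field A U u"

definition complex_field ::
    "('m::topological_space, 'n::finite) chart set \<Rightarrow> 'm set \<Rightarrow> ('m \<Rightarrow> 'm tvec) \<Rightarrow> bool" where
  "complex_field A U X \<longleftrightarrow> (\<forall>q\<in>U. X q \<in> ctangent A q) \<and> smooth_field A U X"

definition section10 ::
    "('m::topological_space, 'n::finite) chart set \<Rightarrow> 'm set \<Rightarrow> ('m \<Rightarrow> 'm tvec) \<Rightarrow> bool" where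
  "section10 A U s \<longleftrightarrow> (\<forall>q\<in>U. s q \<in> T10 A q) \<and> smooth_field A U s"

text \<open>Taking the coordinate functions \<open>z\<^sup>\<alpha>\<close> for \<open>f\<close> shows that this is equivalent to holomorphy of
  the components of \<open>s\<close> with respect to \<open>\<partial>/\<partial>z\<^sup>\<alpha>\<close>.\<close>

definition holo_section10 ::
    "('m::topological_space, 'n::finite) chart set \<Rightarrow> 'm set \<Rightarrow> ('m \<Rightarrow> 'm tvec) \<Rightarrow> bool" where
  "holo_section10 A U s \<longleftrightarrow> section10 A U s \<and>
     (\<forall>V f. open V \<and> V \<subseteq> U \<and> holo_fun A V f \<longrightarrow> holo_fun A V (\<lambda>q. s q f))"

definition lie_bracket :: "('m::topological_space, 'n::finite) chart set \<Rightarrow>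
    ('m \<Rightarrow> 'm tvec) \<Rightarrow> ('m \<Rightarrow> 'm tvec) \<Rightarrow> 'm \<Rightarrow> 'm tvec" where
  "lie_bracket A v w p = (\<lambda>f. if smooth_near A p f
     then v p (\<lambda>q. w q f) - w p (\<lambda>q. v q f) else 0)"


section \<open>Hermitian metrics\<close>

text \<open>\<open>h p\<close> is complex-linear in its first and conjugate-linear in its second argument; its values
  on vectors outside \<open>T10 A p\<close> are irrelevant.\<close>

definition hermitian_metric ::
    "('m::topological_space, 'n::finite) chart set \<Rightarrow> ('m \<Rightarrow> 'm tvec \<Rightarrow> 'm tvec \<Rightarrow> complex) \<Rightarrow> bool" where
  "hermitian_metric A h \<longleftrightarrow>
     (\<forall>p. \<forall>Z\<in>T10 A p. \<forall>Z'\<in>T10 A p. \<forall>W\<in>T10 A p.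
        h p (\<lambda>f. Z f + Z' f) W = h p Z W + h p Z' W) \<and>
     (\<forall>p a. \<forall>Z\<in>T10 A p. \<forall>W\<in>T10 A p. h p (\<lambda>f. a * Z f) W = a * h p Z W) \<and>
     (\<forall>p. \<forall>Z\<in>T10 A p. \<forall>W\<in>T10 A p. h p W Z = cnj (h p Z W)) \<and>
     (\<forall>p. \<forall>Z\<in>T10 A p. Z \<noteq> (\<lambda>f. 0) \<longrightarrow> 0 < Re (h p Z Z)) \<and>
     (\<forall>U s t. open U \<and> section10 A U s \<and> section10 A U t \<longrightarrow>
        smooth_fun A U (\<lambda>q. h q (s q) (t q)))"

definition riem :: "('m::topological_space, 'n::finite) chart set \<Rightarrow>
    ('m \<Rightarrow> 'm tvec \<Rightarrow> 'm tvec \<Rightarrow> complex) \<Rightarrow> 'm \<Rightarrow> 'm tvec \<Rightarrow> 'm tvec \<Rightarrow> real" where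
  "riem A h p u v = Re (h p (o_map A p u) (o_map A p v))"

definition orthonormal_frame :: "('m::topological_space, 'n::finite) chart set \<Rightarrow>
    ('m \<Rightarrow> 'm tvec \<Rightarrow> 'm tvec \<Rightarrow> complex) \<Rightarrow> 'm set \<Rightarrow> (nat \<Rightarrow> 'm \<Rightarrow> 'm tvec) \<Rightarrow> bool" where
  "orthonormal_frame A h U e \<longleftrightarrow>
     (\<forall>i\<in>{1..2 * CARD('n)}. real_field A U (e i)) \<and>
     (\<forall>q\<in>U. \<forall>i\<in>{1..2 * CARD('n)}. \<forall>j\<in>{1..2 * CARD('n)}.
        riem A h q (e i q) (e j q) = (if i = j then 1 else 0))"


section \<open>The Chern connection and its curvature\<close>

text \<open>\<open>D p Z s\<close> is the covariant derivative at \<open>p\<close> of a section \<open>s\<close> of the (1,0) bundle defined near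
  \<open>p\<close>, in the direction of a complexified tangent vector \<open>Z\<close> at \<open>p\<close>.  Dependence on the germ of
  \<open>s\<close> at \<open>p\<close> alone is a consequence of the Leibniz rule, with the indicator function of a
  neighbourhood of \<open>p\<close> for \<open>f\<close>.\<close>

type_synonym 'm conn = "'m \<Rightarrow> 'm tvec \<Rightarrow> ('m \<Rightarrow> 'm tvec) \<Rightarrow> 'm tvec"

definition connection10 :: "('m::topological_space, 'n::finite) chart set \<Rightarrow> 'm conn \<Rightarrow> bool" where
  "connection10 A D \<longleftrightarrow>
     (\<forall>U p s. open U \<and> p \<in> U \<and> section10 A U s \<longrightarrow>
        (\<forall>Z\<in>ctangent A p. D p Z s \<in> T10 A p) \<and>
        (\<forall>Z\<in>ctangent A p. \<forall>W\<in>ctangent A p. \<forall>a b.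
           D p (\<lambda>f. a * Z f + b * W f) s = (\<lambda>f. a * D p Z s f + b * D p W s f)) \<and>
        (\<forall>Z\<in>ctangent A p. \<forall>t. section10 A U t \<longrightarrow>
           D p Z (\<lambda>q f. s q f + t q f) = (\<lambda>f. D p Z s f + D p Z t f)) \<and>
        (\<forall>Z\<in>ctangent A p. \<forall>k. smooth_fun A U k \<longrightarrow>
           D p Z (\<lambda>q f. k q * s q f) = (\<lambda>f. Z k * s p f + k p * D p Z s f))) \<and>
     (\<forall>U X s. open U \<and> complex_field A U X \<and> section10 A U s \<longrightarrow>
        section10 A U (\<lambda>q. D q (X q) s))"

definition chern_connection :: "('m::topological_space, 'n::finite) chart set \<Rightarrow>
    ('m \<Rightarrow> 'm tvec \<Rightarrow> 'm tvec \<Rightarrow> complex) \<Rightarrow> 'm conn \<Rightarrow> bool" where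
  "chern_connection A h D \<longleftrightarrow> connection10 A D \<and>
     (\<forall>U p s t. open U \<and> p \<in> U \<and> section10 A U s \<and> section10 A U t \<longrightarrow>
        (\<forall>v\<in>rtangent A p. v (\<lambda>q. h q (s q) (t q)) =
           h p (D p v s) (t p) + h p (s p) (D p v t))) \<and>
     (\<forall>U p s. open U \<and> p \<in> U \<and> holo_section10 A U s \<longrightarrow>
        (\<forall>Z\<in>T01 A p. D p Z s = (\<lambda>f. 0)))"

text \<open>The connection on the real tangent bundle with \<open>(D\<^sub>v u)\<^sub>o = D\<^sub>v (u\<^sub>o)\<close>.\<close>

definition induced :: "('m::topological_space, 'n::finite) chart set \<Rightarrow> 'm conn \<Rightarrow> 'm conn" where
  "induced A D p v u = inv_into (rtangent A p) (o_map A p) (D p v (\<lambda>q. o_map A q (u q)))"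

text \<open>\<open>curv A D u v w p\<close> is \<open>(D\<^sup>2 u)(v, w)\<close> at \<open>p\<close>, for \<open>D\<close> a connection on the real tangent bundle.\<close>

definition curv :: "('m::topological_space, 'n::finite) chart set \<Rightarrow> 'm conn \<Rightarrow>
    ('m \<Rightarrow> 'm tvec) \<Rightarrow> ('m \<Rightarrow> 'm tvec) \<Rightarrow> ('m \<Rightarrow> 'm tvec) \<Rightarrow> 'm \<Rightarrow> 'm tvec" where
  "curv A D u v w p = (\<lambda>f. D p (v p) (\<lambda>q. D q (w q) u) f
                         - D p (w p) (\<lambda>q. D q (v q) u) f
                         - D p (lie_bracket A v w p) u f)"

definition scalar_curv :: "('m::topological_space, 'n::finite) chart set \<Rightarrow>
    ('m \<Rightarrow> 'm tvec \<Rightarrow> 'm tvec \<Rightarrow> complex) \<Rightarrow> 'm conn \<Rightarrow> (nat \<Rightarrow> 'm \<Rightarrow> 'm tvec) \<Rightarrow> 'm \<Rightarrow> real" where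
  "scalar_curv A h D e p = (\<Sum>i=1..2 * CARD('n). \<Sum>j=1..2 * CARD('n).
     riem A h p (curv A D (e j) (e i) (e j) p) (e i p))"


section \<open>The second Chern scalar curvature\<close>

text \<open>In the coordinates of a chart \<open>c\<close>, at the coordinate point \<open>x\<close>.  Matrices have the unbarred
  index of \<open>h\<^sub>\<alpha>\<^sub>\<beta>\<close> first; the inverse matrix has the barred index first.\<close>

definition h_mat :: "('m::topological_space, 'n::finite) chart set \<Rightarrow>
    ('m \<Rightarrow> 'm tvec \<Rightarrow> 'm tvec \<Rightarrow> complex) \<Rightarrow> ('m, 'n) chart \<Rightarrow> complex^'n \<Rightarrow> complex^'n^'n" where
  "h_mat A h c x = (\<chi> \<alpha> \<beta>. let q = chart_inv c x in h q (dz A c \<alpha> q) (dz A c \<beta> q))"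

definition chern_R :: "('m::topological_space, 'n::finite) chart set \<Rightarrow>
    ('m \<Rightarrow> 'm tvec \<Rightarrow> 'm tvec \<Rightarrow> complex) \<Rightarrow> ('m, 'n) chart \<Rightarrow>
    'n \<Rightarrow> 'n \<Rightarrow> 'n \<Rightarrow> 'n \<Rightarrow> complex^'n \<Rightarrow> complex" where
  "chern_R A h c \<alpha> \<beta> \<gamma> \<delta> x =
     - wirt \<gamma> (wirt_bar \<delta> (\<lambda>y. h_mat A h c y $ \<alpha> $ \<beta>)) x
     + (\<Sum>l\<in>UNIV. \<Sum>k\<in>UNIV. wirt \<gamma> (\<lambda>y. h_mat A h c y $ \<alpha> $ l) x
          * matrix_inv (h_mat A h c x) $ l $ k
          * wirt_bar \<delta> (\<lambda>y. h_mat A h c y $ k $ \<beta>) x)"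

definition chern_R3 :: "('m::topological_space, 'n::finite) chart set \<Rightarrow>
    ('m \<Rightarrow> 'm tvec \<Rightarrow> 'm tvec \<Rightarrow> complex) \<Rightarrow> ('m, 'n) chart \<Rightarrow>
    'n \<Rightarrow> 'n \<Rightarrow> complex^'n \<Rightarrow> complex" where
  "chern_R3 A h c \<alpha> \<beta> x = (\<Sum>\<gamma>\<in>UNIV. \<Sum>\<delta>\<in>UNIV.
     matrix_inv (h_mat A h c x) $ \<delta> $ \<gamma> * chern_R A h c \<gamma> \<beta> \<alpha> \<delta> x)"

definition second_chern_scalar :: "('m::topological_space, 'n::finite) chart set \<Rightarrow>
    ('m \<Rightarrow> 'm tvec \<Rightarrow> 'm tvec \<Rightarrow> complex) \<Rightarrow> ('m, 'n) chart \<Rightarrow> 'm \<Rightarrow> complex" where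
  "second_chern_scalar A h c p = (\<Sum>\<alpha>\<in>UNIV. \<Sum>\<beta>\<in>UNIV.
     matrix_inv (h_mat A h c (snd c p)) $ \<beta> $ \<alpha> * chern_R3 A h c \<alpha> \<beta> (snd c p))"

end

theory Submission
  imports Defs
begin

text \<open>In a chart, \<open>D\<^sub>Z \<partial>\<^sub>\<alpha> = \<Sum> Z(z\<^sup>\<gamma>) \<Gamma>\<^sub>\<gamma>\<^sub>\<alpha>\<^sup>\<kappa> \<partial>\<^sub>\<kappa>\<close> because the frame is
  holomorphic, and metricity gives \<open>\<partial>\<^sub>\<gamma> h\<^sub>\<alpha>\<^sub>\<beta> = \<Sum> \<Gamma>\<^sub>\<gamma>\<^sub>\<alpha>\<^sup>\<kappa> h\<^sub>\<kappa>\<^sub>\<beta>\<close>, so that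
  \<open>chern_R\<close> is \<open>- \<Sum> (\<partial>\<^sub>\<delta>\<close>-bar \<open>\<Gamma>\<^sub>\<gamma>\<^sub>\<alpha>\<^sup>\<kappa>) h\<^sub>\<kappa>\<^sub>\<beta>\<close>.  If \<open>\<xi>\<^sub>i\<close> are the (1,0) components of a real orthonormal
  frame, completeness of the frame yields \<open>\<Sum>\<^sub>i \<xi>\<^sub>i\<^sup>\<alpha> \<xi>\<^sub>i\<^sup>\<beta> = 0\<close> and
  \<open>\<Sum>\<^sub>i \<xi>\<^sub>i\<^sup>\<alpha> cnj \<xi>\<^sub>i\<^sup>\<beta> = 2 h\<^sup>\<beta>\<^sup>\<alpha>\<close>.  In the double sum over the frame every (2,0) term of the curvature
  and one of its two (1,1) terms carry a factor \<open>\<Sum>\<^sub>j \<xi>\<^sub>j\<^sup>\<alpha> \<xi>\<^sub>j\<^sup>\<gamma>\<close> and drop out;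
  the other (1,1) term is contracted twice with \<open>2 h\<^sup>-\<^sup>1\<close>, whence the factor 4.  The real part in
  \<open>g = Re h\<close> is harmless because the second Chern scalar curvature is real, by Hermitian symmetry
  and the symmetry of second derivatives.\<close>

section \<open>Smooth functions\<close>

text \<open>The assumptions say less than the classical argument takes for granted. Tangent vectors
  are operators on total functions with default value 0, so additivity and the product rule are
  available only for germs known to be smooth. \<open>D\<close> is constrained only in tangent
  directions, so the Lie bracket must first be shown to be tangent. Metric compatibility is given in
  real directions only, so the holomorphic derivative of the metric has to be assembled from
  \<open>dx\<close> and \<open>dy\<close>. The induced connection contains an
  \<open>inv_into\<close>; all comparisons are made after \<open>o_map\<close>, through which
  \<open>riem\<close> sees vectors. The Christoffel symbols need not be symmetric. The bracket term
  cancels instead against derivatives of the components of the fields, and what remains is pointwise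
  in all three fields. The 2 in each contraction arises because 2n real orthonormal vectors sit in a
  complex space of dimension n. The frame also supplies invertibility of the metric matrix and the
  Hermitian symmetry of its inverse. Symmetry of second derivatives enters three times: for
  holomorphy of derivatives, for tangency of brackets, and for exchanging \<open>dz\<close> with
  \<open>dzb\<close>.\<close>

lemma Ck_on_cong:
  assumes "open S" "\<And>x. x \<in> S \<Longrightarrow> f x = g x" "Ck_on k S f"
  shows "Ck_on k S g"
  using assms(2,3)
proof (induction k arbitrary: f g)
  case 0
  then show ?case by (simp cong: continuous_on_cong)
next
  case (Suc k)
  have d: "(g has_derivative frechet_derivative f (at x)) (at x)" if "x \<in> S" for x
    using Suc.prems that \<open>open S\<close>
    by (metis Ck_on.simps(2) frechet_derivative_works has_derivative_transform_within_open)
  then have e: "frechet_derivative g (at x) = frechet_derivative f (at x)" if "x \<in> S" for x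
    using that frechet_derivative_at by fastforce
  show ?case
    using d e Suc.prems Suc.IH[of "\<lambda>x. frechet_derivative f (at x) v" "\<lambda>x. frechet_derivative g (at x) v" for v]
    by (auto simp: differentiable_def)
qed

text \<open>\<open>frechet_derivative\<close> is defined by choice. The closure proofs below exhibit
  an explicit derivative valid on the open set \<open>S\<close>, and \<open>Ck_on_cong\<close>
  transfers regularity from that formula to the chosen derivative.\<close>

lemma Ck_on_SucI:
  assumes "open S" "\<And>x. x \<in> S \<Longrightarrow> (f has_derivative f' x) (at x)" "\<And>v. Ck_on k S (\<lambda>x. f' x v)"
  shows "Ck_on (Suc k) S f"
proof -
  have "frechet_derivative f (at x) = f' x" if "x \<in> S" for x
    using assms(2)[OF that] frechet_derivative_at by metis
  then have "Ck_on k S (\<lambda>x. frechet_derivative f (at x) v)" for v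
    by (intro Ck_on_cong[OF assms(1) _ assms(3)[of v]]) simp
  then show ?thesis using assms(2) by (auto simp: differentiable_def)
qed

lemma Ck_on_SucD:
  assumes "Ck_on (Suc k) S f"
  shows "\<And>x. x \<in> S \<Longrightarrow> (f has_derivative frechet_derivative f (at x)) (at x)"
    and "\<And>v. Ck_on k S (\<lambda>x. frechet_derivative f (at x) v)"
  using assms by (auto simp: frechet_derivative_works)

lemma Ck_on_mono: "T \<subseteq> S \<Longrightarrow> Ck_on k S f \<Longrightarrow> Ck_on k T f"
  by (induction k arbitrary: f) (auto intro: continuous_on_subset)

text \<open>The product and chain rules put an undifferentiated factor next to a derivative, so the
  induction step needs that factor at the lower order as well.\<close>

lemma Ck_on_lower: "Ck_on (Suc k) S f \<Longrightarrow> Ck_on k S f"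
  by (induction k arbitrary: f)
    (auto intro!: continuous_at_imp_continuous_on differentiable_imp_continuous_within)

lemma Ck_on_const: "open S \<Longrightarrow> Ck_on k S (\<lambda>x. a)"
proof (induction k arbitrary: a)
  case (Suc k)
  then show ?case by (intro Ck_on_SucI[where f' = "\<lambda>_ _. 0"]) auto
qed auto

lemma Ck_on_bounded_linear:
  "open S \<Longrightarrow> bounded_linear L \<Longrightarrow> Ck_on k S f \<Longrightarrow> Ck_on k S (\<lambda>x. L (f x))"
proof (induction k arbitrary: f)
  case 0
  then show ?case by (simp add: bounded_linear.continuous_on)
next
  case (Suc k)
  show ?case
    by (rule Ck_on_SucI[where f' = "\<lambda>x v. L (frechet_derivative f (at x) v)"])
      (use Suc Ck_on_SucD[OF Suc.prems(3)] in \<open>auto intro: bounded_linear.has_derivative\<close>)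
qed

lemma Ck_on_add:
  "open S \<Longrightarrow> Ck_on k S f \<Longrightarrow> Ck_on k S g \<Longrightarrow> Ck_on k S (\<lambda>x. f x + g x)"
proof (induction k arbitrary: f g)
  case 0
  then show ?case by (simp add: continuous_on_add)
next
  case (Suc k)
  show ?case
    by (rule Ck_on_SucI[where f' = "\<lambda>x v. frechet_derivative f (at x) v + frechet_derivative g (at x) v"])
      (use Suc Ck_on_SucD[OF Suc.prems(2)] Ck_on_SucD[OF Suc.prems(3)] in \<open>auto intro!: has_derivative_add\<close>)
qed

lemma Ck_on_sum:
  "open S \<Longrightarrow> (\<And>i. i \<in> I \<Longrightarrow> Ck_on k S (f i)) \<Longrightarrow> Ck_on k S (\<lambda>x. \<Sum>i\<in>I. f i x)"
  by (induction I rule: infinite_finite_induct) (auto intro: Ck_on_const Ck_on_add)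

text \<open>Stated for any bounded bilinear map so that one induction serves both complex
  multiplication and the scalar products occurring in the chain rule.\<close>

lemma Ck_on_bilinear:
  assumes "bounded_bilinear B" "open S" "Ck_on k S f" "Ck_on k S g"
  shows "Ck_on k S (\<lambda>x. B (f x) (g x))"
  using assms(3,4)
proof (induction k arbitrary: f g)
  case 0
  then show ?case by (simp add: bounded_bilinear.continuous_on[OF assms(1)])
next
  case (Suc k)
  note f = Ck_on_SucD[OF Suc.prems(1)] and g = Ck_on_SucD[OF Suc.prems(2)]
  show ?case
    by (intro Ck_on_SucI[OF assms(2) bounded_bilinear.FDERIV[OF assms(1) f(1) g(1)]] Ck_on_add assms(2)
        Suc.IH f(2) g(2) Ck_on_lower[OF Suc.prems(1)] Ck_on_lower[OF Suc.prems(2)])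
qed

text \<open>In the chain rule the direction fed to the derivative of \<open>f\<close> varies with
  the point, whereas \<open>Ck_on\<close> controls derivatives in fixed directions only. Expanding
  the direction in \<open>Basis\<close> turns the derivative into a sum of products to which the
  induction hypothesis applies.\<close>

lemma Ck_on_compose:
  fixes f :: "'a::euclidean_space \<Rightarrow> 'b::real_normed_vector" and g :: "'c::euclidean_space \<Rightarrow> 'a"
  assumes "open S" "g ` S \<subseteq> T" "Ck_on k T f" "Ck_on k S g"
  shows "Ck_on k S (\<lambda>x. f (g x))"
  using assms(3,4)
proof (induction k arbitrary: f)
  case 0
  then show ?case using assms(2) by (auto intro: continuous_on_compose2)
next
  case (Suc k)
  note f = Ck_on_SucD[OF Suc.prems(1)] and g = Ck_on_SucD[OF Suc.prems(2)]
  have "frechet_derivative f (at (g x)) w =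
      (\<Sum>b\<in>Basis. (w \<bullet> b) *\<^sub>R frechet_derivative f (at (g x)) b)" if "x \<in> S" for x w
  proof -
    have "linear (frechet_derivative f (at (g x)))"
      using f(1) that assms(2) has_derivative_linear by blast
    then show ?thesis
      by (subst euclidean_representation[of w, symmetric]) (simp only: linear_sum linear_scale o_def)
  qed
  then have D: "((\<lambda>x. f (g x)) has_derivative (\<lambda>v. \<Sum>b\<in>Basis. (frechet_derivative g (at x) v \<bullet> b) *\<^sub>R
       frechet_derivative f (at (g x)) b)) (at x)" if "x \<in> S" for x
    using diff_chain_at[OF g(1)[OF that] f(1)] that assms(2) by (auto simp: o_def)
  show ?case
    by (intro Ck_on_SucI[OF assms(1) D] Ck_on_sum Ck_on_bilinear[OF bounded_bilinear_scaleR]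
        Ck_on_bounded_linear[OF _ bounded_linear_inner_left] assms(1) g(2) Suc.IH f(2)
        Ck_on_lower[OF Suc.prems(2)])
qed

lemma Ck_on_vec:
  assumes "open S" "\<And>i. Ck_on k S (\<lambda>x. g x $ i)"
  shows "Ck_on k S (g :: 'a::euclidean_space \<Rightarrow> complex ^ 'n)"
proof -
  have l: "bounded_linear (axis i :: complex \<Rightarrow> complex ^ 'n)" for i
    by (intro linear_conv_bounded_linear[THEN iffD1] linearI) (auto simp: axis_def vec_eq_iff)
  have "g x = (\<Sum>i\<in>UNIV. axis i (g x $ i))" for x
    unfolding vec_eq_iff sum_component by (simp add: axis_def)
  then show ?thesis
    using Ck_on_sum[OF assms(1), of UNIV k "\<lambda>i x. axis i (g x $ i)"]
      Ck_on_bounded_linear[OF assms(1) l assms(2)] by simp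
qed

section \<open>Symmetry of second derivatives\<close>

text \<open>The mean value theorem is applied to \<open>t \<mapsto> F (x + t v + w) - F (x + t v)\<close> and then to
  \<open>t \<mapsto> \<partial>\<^sub>v F (x + a v + t w)\<close>.\<close>

lemma second_difference_mean_value:
  fixes F :: "'a::euclidean_space \<Rightarrow> real"
  assumes "Ck_on 2 S F"
    and "\<And>a b. 0 \<le> a \<Longrightarrow> a \<le> 1 \<Longrightarrow> 0 \<le> b \<Longrightarrow> b \<le> 1 \<Longrightarrow> x + a *\<^sub>R v + b *\<^sub>R w \<in> S"
  obtains a b where "0 \<le> a" "a \<le> 1" "0 \<le> b" "b \<le> 1"
    "F (x + v + w) - F (x + v) - F (x + w) + F x =
       frechet_derivative (\<lambda>y. frechet_derivative F (at y) v) (at (x + a *\<^sub>R v + b *\<^sub>R w)) w"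
proof -
  have 2: "Ck_on (Suc 1) S F" "Ck_on (Suc 0) S (\<lambda>y. frechet_derivative F (at y) v)"
    using assms(1) by (auto simp: numeral_2_eq_2 simp del: Ck_on.simps intro: Ck_on_SucD(2))
  note F = Ck_on_SucD(1)[OF 2(1)] and F' = Ck_on_SucD(1)[OF 2(2)]
  \<comment> \<open>The explicit coefficients 1 and 0 of \<open>w\<close> present both points in the
    form for which the second assumption guarantees membership in \<open>S\<close>.\<close>
  define \<phi> where "\<phi> t = F (x + t *\<^sub>R v + 1 *\<^sub>R w) - F (x + t *\<^sub>R v + 0 *\<^sub>R w)" for t
  have line: "((\<lambda>t. G (p + t *\<^sub>R d)) has_real_derivative G' d) (at t)"
    if "(G has_derivative G') (at (p + t *\<^sub>R d))" for G :: "'a \<Rightarrow> real" and G' p d t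
  proof -
    have "((\<lambda>t. p + t *\<^sub>R d) has_derivative (\<lambda>s. s *\<^sub>R d)) (at t)"
      by (auto intro!: derivative_eq_intros)
    then have "((\<lambda>t. G (p + t *\<^sub>R d)) has_derivative (\<lambda>s. G' (s *\<^sub>R d))) (at t)"
      by (rule has_derivative_compose[where f = "\<lambda>t. p + t *\<^sub>R d" and x = t and g = G and g' = G']) (fact that)
    moreover have "(\<lambda>s. G' (s *\<^sub>R d)) = (*) (G' d)"
      using has_derivative_linear[OF that] by (auto simp: linear_scale)
    ultimately show ?thesis by (simp add: has_field_derivative_def)
  qed
  have "(\<phi> has_real_derivative frechet_derivative F (at (x + t *\<^sub>R v + 1 *\<^sub>R w)) v
      - frechet_derivative F (at (x + t *\<^sub>R v + 0 *\<^sub>R w)) v) (at t)" if "0 \<le> t" "t \<le> 1" for t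
    unfolding \<phi>_def
    using line[of F _ "x + w" t v] line[of F _ x t v] F assms(2)[OF that, of 0] assms(2)[OF that, of 1]
    by (intro DERIV_diff) (auto simp: algebra_simps)
  from MVT2[OF zero_less_one this] obtain a where a: "0 < a" "a < 1"
    "\<phi> 1 - \<phi> 0 = (1 - 0) * (frechet_derivative F (at (x + a *\<^sub>R v + 1 *\<^sub>R w)) v
      - frechet_derivative F (at (x + a *\<^sub>R v + 0 *\<^sub>R w)) v)"
    by blast
  define \<psi> where "\<psi> r = frechet_derivative F (at (x + a *\<^sub>R v + r *\<^sub>R w)) v" for r
  have "(\<psi> has_real_derivative frechet_derivative (\<lambda>y. frechet_derivative F (at y) v)
      (at (x + a *\<^sub>R v + r *\<^sub>R w)) w) (at r)" if "0 \<le> r" "r \<le> 1" for r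
    unfolding \<psi>_def
    using line[of "\<lambda>y. frechet_derivative F (at y) v" _ "x + a *\<^sub>R v" r w] F' assms(2)[of a r] a that by auto
  from MVT2[OF zero_less_one this] obtain b where b: "0 < b" "b < 1"
    "\<psi> 1 - \<psi> 0 = (1 - 0) * frechet_derivative
      (\<lambda>y. frechet_derivative F (at y) v) (at (x + a *\<^sub>R v + b *\<^sub>R w)) w"
    by blast
  show ?thesis
    using a b by (intro that[of a b]) (auto simp: \<phi>_def \<psi>_def algebra_simps)
qed

text \<open>Linearity is used once in the outer direction at \<open>x\<close> and once in the inner
  direction at all points of the open set. This extracts the factor \<open>s * s\<close> from the
  mean value formula for a parallelogram shrunk by \<open>s\<close>, where it can be
  cancelled.\<close>

lemma frechet_derivative_scaled_direction:
  assumes "open S" "x \<in> S" "Ck_on 2 S (F :: _ \<Rightarrow> 'b::real_normed_vector)"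
  shows "frechet_derivative (\<lambda>y. frechet_derivative F (at y) (s *\<^sub>R v)) (at x) (s *\<^sub>R w) =
    (s * s) *\<^sub>R frechet_derivative (\<lambda>y. frechet_derivative F (at y) v) (at x) w"
proof -
  have 2: "Ck_on (Suc 1) S F" "Ck_on (Suc 0) S (\<lambda>y. frechet_derivative F (at y) v)"
    using assms(3) by (auto simp: numeral_2_eq_2 simp del: Ck_on.simps intro: Ck_on_SucD(2))
  note F' = Ck_on_SucD(1)[OF 2(2) \<open>x \<in> S\<close>]
  have "frechet_derivative F (at y) (s *\<^sub>R v) = s *\<^sub>R frechet_derivative F (at y) v" if "y \<in> S" for y
    using has_derivative_linear[OF Ck_on_SucD(1)[OF 2(1) that]] by (simp add: linear_scale)
  then have "((\<lambda>y. frechet_derivative F (at y) (s *\<^sub>R v)) has_derivative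
      (\<lambda>w. s *\<^sub>R frechet_derivative (\<lambda>y. frechet_derivative F (at y) v) (at x) w)) (at x)"
    by (intro has_derivative_transform_within_open[OF has_derivative_scaleR_right[OF F'] assms(1,2)]) simp
  then show ?thesis
    using has_derivative_linear[OF F']
    by (simp add: linear_scale frechet_derivative_at[symmetric])
qed

text \<open>The second difference over a parallelogram does not see the order of its sides. The mean
  value formula in both orders yields points arbitrarily close to \<open>x\<close> at which the two
  mixed derivatives agree, and continuity carries this to \<open>x\<close>.\<close>

lemma second_derivative_symmetric_real:
  fixes F :: "'a::euclidean_space \<Rightarrow> real"
  assumes S: "open S" "x \<in> S" and F: "Ck_on 2 S F"
  shows "frechet_derivative (\<lambda>y. frechet_derivative F (at y) v) (at x) w =
    frechet_derivative (\<lambda>y. frechet_derivative F (at y) w) (at x) v"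
proof -
  define G where "G v w y = frechet_derivative (\<lambda>y. frechet_derivative F (at y) v) (at y) w" for v w y
  obtain r where r: "0 < r" "ball x r \<subseteq> S" using S openE by blast
  \<comment> \<open>The parallelogram with sides \<open>s\<close> times \<open>v\<close> and
    \<open>w\<close> lies within distance \<open>s * K\<close> of \<open>x\<close>; the summand 1
    makes the bound strict and \<open>K\<close> positive even for zero directions.\<close>
  define K where "K = norm v + norm w + 1"
  have "K > 0" unfolding K_def by (smt (verit) norm_ge_zero)
  have near: "dist (x + a *\<^sub>R (s *\<^sub>R v) + b *\<^sub>R (s *\<^sub>R w)) x < s * K"
    if "0 < s" "0 \<le> a" "a \<le> 1" "0 \<le> b" "b \<le> 1" for s a b
  proof -
    have "norm (a *\<^sub>R (s *\<^sub>R v) + b *\<^sub>R (s *\<^sub>R w)) \<le> a * (s * norm v) + b * (s * norm w)"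
      using that by (intro order.trans[OF norm_triangle_ineq]) simp
    also have "\<dots> \<le> 1 * (s * norm v) + 1 * (s * norm w)"
      using that by (intro add_mono mult_right_mono) auto
    also have "\<dots> < s * K" using that by (simp add: K_def algebra_simps)
    finally show ?thesis by (simp add: dist_norm add.assoc)
  qed
  have ex: "\<exists>y z. dist y x < s * K \<and> dist z x < s * K \<and> G v w y = G w v z" if s: "0 < s" "s * K \<le> r" for s
  proof -
    have in_S: "x + a *\<^sub>R (s *\<^sub>R v) + b *\<^sub>R (s *\<^sub>R w) \<in> S" "x + b *\<^sub>R (s *\<^sub>R w) + a *\<^sub>R (s *\<^sub>R v) \<in> S"
      if "0 \<le> a" "a \<le> 1" "0 \<le> b" "b \<le> 1" for a b
      using near[OF s(1) that] s(2) r(2) by (auto simp: dist_commute ac_simps subset_iff)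
    obtain a b where ab: "0 \<le> a" "a \<le> 1" "0 \<le> b" "b \<le> 1"
        "F (x + s *\<^sub>R v + s *\<^sub>R w) - F (x + s *\<^sub>R v) - F (x + s *\<^sub>R w) + F x
          = G (s *\<^sub>R v) (s *\<^sub>R w) (x + a *\<^sub>R (s *\<^sub>R v) + b *\<^sub>R (s *\<^sub>R w))"
      unfolding G_def
      by (rule second_difference_mean_value[OF F, of x "s *\<^sub>R v" "s *\<^sub>R w"]) (use in_S in blast)+
    obtain b' a' where ab': "0 \<le> b'" "b' \<le> 1" "0 \<le> a'" "a' \<le> 1"
        "F (x + s *\<^sub>R w + s *\<^sub>R v) - F (x + s *\<^sub>R w) - F (x + s *\<^sub>R v) + F x
          = G (s *\<^sub>R w) (s *\<^sub>R v) (x + b' *\<^sub>R (s *\<^sub>R w) + a' *\<^sub>R (s *\<^sub>R v))"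
      unfolding G_def
      by (rule second_difference_mean_value[OF F, of x "s *\<^sub>R w" "s *\<^sub>R v"]) (use in_S in blast)+
    define y z where "y = x + a *\<^sub>R (s *\<^sub>R v) + b *\<^sub>R (s *\<^sub>R w)" and "z = x + b' *\<^sub>R (s *\<^sub>R w) + a' *\<^sub>R (s *\<^sub>R v)"
    have "y \<in> S" "z \<in> S" unfolding y_def z_def using in_S ab ab' by auto
    have "(s * s) *\<^sub>R G v w y = (s * s) *\<^sub>R G w v z"
      using ab(5) ab'(5) frechet_derivative_scaled_direction[OF S(1) \<open>y \<in> S\<close> F]
        frechet_derivative_scaled_direction[OF S(1) \<open>z \<in> S\<close> F]
      unfolding y_def[symmetric] z_def[symmetric] by (simp add: G_def algebra_simps)
    moreover have "dist y x < s * K" "dist z x < s * K"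
      using near[OF s(1) ab(1-4)] near[OF s(1) ab'(3,4,1,2)] by (simp_all add: y_def z_def ac_simps)
    ultimately show ?thesis using s by auto
  qed
  have cont: "isCont (G v w) x" for v w
    using F S unfolding G_def by (simp add: numeral_2_eq_2 continuous_on_eq_continuous_at)
  have "dist (G v w x) (G w v x) < \<epsilon>" if "\<epsilon> > 0" for \<epsilon>
  proof -
    obtain d1 where d1: "d1 > 0" "\<And>y. dist y x < d1 \<Longrightarrow> dist (G v w y) (G v w x) < \<epsilon>/2"
      using cont[of v w] \<open>\<epsilon> > 0\<close> unfolding continuous_at_eps_delta by (meson half_gt_zero)
    obtain d2 where d2: "d2 > 0" "\<And>y. dist y x < d2 \<Longrightarrow> dist (G w v y) (G w v x) < \<epsilon>/2"
      using cont[of w v] \<open>\<epsilon> > 0\<close> unfolding continuous_at_eps_delta by (meson half_gt_zero)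
    \<comment> \<open>The scale puts the parallelogram into the ball inside \<open>S\<close> and
      into both continuity neighbourhoods at once.\<close>
    define s where "s = min r (min d1 d2) / K"
    have s: "0 < s" "s * K \<le> r" "s * K \<le> d1" "s * K \<le> d2"
      using \<open>K > 0\<close> r d1 d2 by (auto simp: s_def)
    obtain y z where "dist y x < s * K" "dist z x < s * K" "G v w y = G w v z"
      using ex[OF s(1,2)] by blast
    then show ?thesis
      using d1(2)[of y] d2(2)[of z] s by (smt (verit) dist_commute dist_triangle field_sum_of_halves)
  qed
  then have "G v w x = G w v x" by (metis dist_eq_0_iff less_irrefl zero_less_dist_iff)
  then show ?thesis by (simp add: G_def)
qed

lemma frechet_derivative_bounded_linear:
  assumes "bounded_linear L" "f differentiable (at x)"
  shows "frechet_derivative (\<lambda>y. L (f y)) (at x) v = L (frechet_derivative f (at x) v)"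
  using bounded_linear.has_derivative[OF assms(1) assms(2)[unfolded frechet_derivative_works]]
    frechet_derivative_at by metis

text \<open>The mean value theorem is tied to real values, so the real version is applied to the
  real and imaginary parts; bounded linear maps commute with both differentiations.\<close>

lemma second_derivative_symmetric:
  fixes F :: "'a::euclidean_space \<Rightarrow> complex"
  assumes S: "open S" "x \<in> S" and F: "Ck_on 2 S F"
  shows "frechet_derivative (\<lambda>y. frechet_derivative F (at y) v) (at x) w =
    frechet_derivative (\<lambda>y. frechet_derivative F (at y) w) (at x) v"
proof -
  have F2: "Ck_on (Suc (Suc 0)) S F"
    using F by (simp only: numeral_2_eq_2)
  have dF: "F differentiable (at y)" if "y \<in> S" for y
    using Ck_on_SucD(1)[OF F2 that] by (rule differentiableI)
  have ddF: "(\<lambda>y. frechet_derivative F (at y) v) differentiable (at x)" for v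
    using Ck_on_SucD(1)[OF Ck_on_SucD(2)[OF F2] S(2)] by (rule differentiableI)
  have *: "frechet_derivative (\<lambda>y. frechet_derivative (\<lambda>y. L (F y)) (at y) v) (at x) w =
      L (frechet_derivative (\<lambda>y. frechet_derivative F (at y) v) (at x) w)"
    if L: "bounded_linear L" for L :: "complex \<Rightarrow> real" and v w
  proof -
    have "(\<lambda>y. L (frechet_derivative F (at y) v)) differentiable (at x)"
      using ddF[of v] bounded_linear.has_derivative[OF L] unfolding differentiable_def by blast
    then have "frechet_derivative (\<lambda>y. L (frechet_derivative F (at y) v)) (at x) =
        frechet_derivative (\<lambda>y. frechet_derivative (\<lambda>y. L (F y)) (at y) v) (at x)"
      by (rule frechet_derivative_transform_within_open[OF _ S])
        (simp add: frechet_derivative_bounded_linear[OF L dF])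
    from fun_cong[OF this, of w] show ?thesis
      unfolding frechet_derivative_bounded_linear[OF L ddF] by (rule sym)
  qed
  have "L (frechet_derivative (\<lambda>y. frechet_derivative F (at y) v) (at x) w) =
      L (frechet_derivative (\<lambda>y. frechet_derivative F (at y) w) (at x) v)"
    if L: "bounded_linear L" for L :: "complex \<Rightarrow> real"
    using second_derivative_symmetric_real[OF S Ck_on_bounded_linear[OF S(1) L F]] *[OF L] by simp
  from this[OF bounded_linear_Re] this[OF bounded_linear_Im] show ?thesis
    by (simp add: complex_eq_iff)
qed

section \<open>Smooth and holomorphic functions on coordinate space\<close>

lemma smooth_on_cong:
  "open S \<Longrightarrow> (\<And>x. x \<in> S \<Longrightarrow> f x = g x) \<Longrightarrow> smooth_on S f \<Longrightarrow> smooth_on S g"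
  unfolding smooth_on_def by (metis Ck_on_cong)

lemma smooth_on_mono: "smooth_on S f \<Longrightarrow> T \<subseteq> S \<Longrightarrow> smooth_on T f"
  unfolding smooth_on_def using Ck_on_mono by blast

lemma smooth_on_const: "open S \<Longrightarrow> smooth_on S (\<lambda>x. a)"
  unfolding smooth_on_def by (simp add: Ck_on_const)

lemma smooth_on_bounded_linear: "open S \<Longrightarrow> bounded_linear L \<Longrightarrow> smooth_on S f \<Longrightarrow> smooth_on S (\<lambda>x. L (f x))"
  unfolding smooth_on_def by (simp add: Ck_on_bounded_linear)

lemma smooth_on_add: "open S \<Longrightarrow> smooth_on S f \<Longrightarrow> smooth_on S g \<Longrightarrow> smooth_on S (\<lambda>x. f x + g x)"
  unfolding smooth_on_def by (simp add: Ck_on_add)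

lemma smooth_on_mult:
  "open S \<Longrightarrow> smooth_on S f \<Longrightarrow> smooth_on S g \<Longrightarrow> smooth_on S (\<lambda>x. f x * g x :: complex)"
  unfolding smooth_on_def by (simp add: Ck_on_bilinear[OF bounded_bilinear_mult])

lemma smooth_on_compose:
  fixes f :: "'a::euclidean_space \<Rightarrow> 'b::real_normed_vector" and g :: "'c::euclidean_space \<Rightarrow> 'a"
  shows "open S \<Longrightarrow> g ` S \<subseteq> T \<Longrightarrow> smooth_on T f \<Longrightarrow> smooth_on S g \<Longrightarrow> smooth_on S (\<lambda>x. f (g x))"
  unfolding smooth_on_def by (simp add: Ck_on_compose)

lemma smooth_on_vec:
  "open S \<Longrightarrow> (\<And>i. smooth_on S (\<lambda>x. g x $ i)) \<Longrightarrow> smooth_on S (g :: 'a::euclidean_space \<Rightarrow> complex ^ 'n)"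
  unfolding smooth_on_def by (simp add: Ck_on_vec)

lemma smooth_on_differentiable: "smooth_on S f \<Longrightarrow> x \<in> S \<Longrightarrow> f differentiable (at x)"
  unfolding smooth_on_def by (metis Ck_on.simps(2))

lemma smooth_on_derivative: "smooth_on S f \<Longrightarrow> smooth_on S (\<lambda>x. frechet_derivative f (at x) v)"
  unfolding smooth_on_def by (metis Ck_on.simps(2))

lemma smooth_on_derivative_commute:
  fixes f :: "'a::euclidean_space \<Rightarrow> complex"
  shows "open S \<Longrightarrow> smooth_on S f \<Longrightarrow> x \<in> S \<Longrightarrow>
    frechet_derivative (\<lambda>y. frechet_derivative f (at y) v) (at x) w =
    frechet_derivative (\<lambda>y. frechet_derivative f (at y) w) (at x) v"
  unfolding smooth_on_def by (simp add: second_derivative_symmetric)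

lemma frechet_derivative_vec_nth:
  assumes "g differentiable (at x)"
  shows "frechet_derivative (\<lambda>x. g x $ i) (at x) v = frechet_derivative g (at x) v $ i"
  by (rule frechet_derivative_bounded_linear[OF bounded_linear_vec_nth assms])

lemma smooth_on_vec_nth:
  "open S \<Longrightarrow> smooth_on S g \<Longrightarrow> smooth_on S (\<lambda>x. (g x :: complex ^ 'n) $ i)"
  by (rule smooth_on_bounded_linear[OF _ bounded_linear_vec_nth])

lemma holo_on_cong:
  assumes "open S" "\<And>x. x \<in> S \<Longrightarrow> f x = g x" "holo_on S f"
  shows "holo_on S g"
proof -
  have "frechet_derivative f (at x) = frechet_derivative g (at x)" if "x \<in> S" for x
    using assms frechet_derivative_transform_within_open[OF _ assms(1) that, of f g] smooth_on_differentiable[of S f x] that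
    by (auto simp: holo_on_def)
  then show ?thesis
    using assms smooth_on_cong[OF assms(1), of f g] by (auto simp: holo_on_def)
qed

text \<open>Swapping the two derivatives moves the factor \<i> from the outer direction to the inner
  one, where the Cauchy-Riemann equations of \<open>f\<close> pull it out; a second swap restores
  the order.\<close>

lemma holo_on_derivative:
  assumes S: "open S" and f: "holo_on S f"
  shows "holo_on S (\<lambda>x. frechet_derivative f (at x) v)"
proof -
  have sm: "smooth_on S f" and cr: "\<And>x v. x \<in> S \<Longrightarrow>
      frechet_derivative f (at x) (\<i> *s v) = \<i> * frechet_derivative f (at x) v"
    using f by (auto simp: holo_on_def)
  have "frechet_derivative (\<lambda>y. frechet_derivative f (at y) v) (at x) (\<i> *s w) =
      \<i> * frechet_derivative (\<lambda>y. frechet_derivative f (at y) v) (at x) w" if x: "x \<in> S" for x w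
  proof -
    have "frechet_derivative (\<lambda>y. frechet_derivative f (at y) v) (at x) (\<i> *s w) =
        frechet_derivative (\<lambda>y. frechet_derivative f (at y) (\<i> *s w)) (at x) v"
      using smooth_on_derivative_commute[OF S sm x] .
    also have "\<dots> = frechet_derivative (\<lambda>y. \<i> * frechet_derivative f (at y) w) (at x) v"
      using cr smooth_on_differentiable[OF smooth_on_derivative[OF sm] x]
      by (intro fun_cong[OF frechet_derivative_transform_within_open[OF _ S x]]) auto
    also have "\<dots> = \<i> * frechet_derivative (\<lambda>y. frechet_derivative f (at y) w) (at x) v"
      by (rule frechet_derivative_bounded_linear[OF bounded_linear_mult_right
            smooth_on_differentiable[OF smooth_on_derivative[OF sm] x]])
    also have "\<dots> = \<i> * frechet_derivative (\<lambda>y. frechet_derivative f (at y) v) (at x) w"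
      using smooth_on_derivative_commute[OF S sm x] by simp
    finally show ?thesis .
  qed
  then show ?thesis using smooth_on_derivative[OF sm] by (simp add: holo_on_def)
qed

lemma frechet_derivative_compose_apply:
  assumes "g differentiable (at x)" "f differentiable (at (g x))"
  shows "frechet_derivative (\<lambda>x. f (g x)) (at x) v = frechet_derivative f (at (g x)) (frechet_derivative g (at x) v)"
  using frechet_derivative_compose[OF assms] by (simp add: o_def)

lemma holo_on_compose:
  assumes S: "open S" "g ` S \<subseteq> T" and f: "holo_on T f" and g: "\<And>i. holo_on S (\<lambda>x. g x $ i)"
  shows "holo_on S (\<lambda>x. f (g x))"
proof -
  have sg: "smooth_on S g" and sf: "smooth_on T f"
    using f g by (auto simp: holo_on_def intro: smooth_on_vec[OF S(1)])
  have "frechet_derivative g (at x) (\<i> *s v) = \<i> *s frechet_derivative g (at x) v" if "x \<in> S" for x v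
  proof -
    have "frechet_derivative g (at x) (\<i> *s v) $ i = (\<i> *s frechet_derivative g (at x) v) $ i" for i
      using g[of i] that by (simp add: holo_on_def frechet_derivative_vec_nth[symmetric] smooth_on_differentiable[OF sg that])
    then show ?thesis by (simp add: vec_eq_iff)
  qed
  then show ?thesis
    using smooth_on_compose[OF S sf sg] f S(2) smooth_on_differentiable[OF sg] smooth_on_differentiable[OF sf]
    by (auto simp: holo_on_def frechet_derivative_compose_apply image_subset_iff)
qed

section \<open>Functions on a complex manifold\<close>

definition coord :: "('m, 'n::finite) chart \<Rightarrow> 'n \<Rightarrow> 'm \<Rightarrow> complex" where
  "coord c \<alpha> q = snd c q $ \<alpha>"

lemma chart_inv_chart:
  assumes "is_chart c"
  shows "q \<in> fst c \<Longrightarrow> chart_inv c (snd c q) = q"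
  using assms unfolding is_chart_def homeomorphism_def by blast

lemma open_chart_image:
  assumes "is_chart c" "open V"
  shows "open (snd c ` (fst c \<inter> V))"
proof -
  have c: "open (snd c ` fst c)" "continuous_on (snd c ` fst c) (chart_inv c)"
    using assms(1) by (auto simp: is_chart_def homeomorphism_def)
  have "snd c ` (fst c \<inter> V) = snd c ` fst c \<inter> chart_inv c -` V"
    using chart_inv_chart[OF assms(1)] by (auto simp: image_iff)
  then show ?thesis using continuous_open_preimage[OF c(2,1) assms(2)] by simp
qed

locale manifold =
  fixes A :: "('m::{t2_space,second_countable_topology}, 'n::finite) chart set"
  assumes manifold: "complex_manifold A"
begin

lemma is_chart: "c \<in> A \<Longrightarrow> is_chart c"
  using manifold by (simp add: complex_manifold_def)

lemma open_chart: "c \<in> A \<Longrightarrow> open (fst c)"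
  using is_chart by (simp add: is_chart_def)

lemma chart_inv [simp]: "c \<in> A \<Longrightarrow> q \<in> fst c \<Longrightarrow> chart_inv c (snd c q) = q"
  using chart_inv_chart is_chart by blast

lemma open_image: "c \<in> A \<Longrightarrow> open V \<Longrightarrow> open (snd c ` (fst c \<inter> V))"
  using open_chart_image is_chart by blast

lemma transition_holo:
  "c \<in> A \<Longrightarrow> c' \<in> A \<Longrightarrow> holo_on (snd c ` (fst c \<inter> fst c')) (\<lambda>x. snd c' (chart_inv c x) $ \<alpha>)"
  using manifold by (simp add: complex_manifold_def)

lemma transition_smooth:
  "c \<in> A \<Longrightarrow> c' \<in> A \<Longrightarrow> smooth_on (snd c ` (fst c \<inter> fst c')) (\<lambda>x. snd c' (chart_inv c x))"
  using transition_holo[of c c'] by (intro smooth_on_vec open_image open_chart) (auto simp: holo_on_def)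

text \<open>Smoothness is defined by testing in every chart of \<open>A\<close>; composing with the
  transition maps reduces the test to a single chart containing \<open>V\<close>.\<close>

lemma smooth_funI:
  assumes c: "c \<in> A" "open V" "V \<subseteq> fst c" and f: "smooth_on (snd c ` V) (\<lambda>x. f (chart_inv c x))"
  shows "smooth_fun A V f"
  unfolding smooth_fun_def
proof
  fix c' assume c': "c' \<in> A"
  let ?S = "snd c' ` (fst c' \<inter> V)"
  have "smooth_on ?S (\<lambda>x. f (chart_inv c (snd c (chart_inv c' x))))"
    by (rule smooth_on_compose[OF _ _ f smooth_on_mono[OF transition_smooth[OF c' c(1)]]])
      (use c c' open_image in auto)
  then show "smooth_on ?S (f \<circ> chart_inv c')"
    by (rule smooth_on_cong[OF open_image[OF c' c(2)], rotated]) (use c c' in auto)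
qed

lemma smooth_funD:
  "smooth_fun A V f \<Longrightarrow> c \<in> A \<Longrightarrow> V \<subseteq> fst c \<Longrightarrow> smooth_on (snd c ` V) (\<lambda>x. f (chart_inv c x))"
  unfolding smooth_fun_def o_def by (metis inf.absorb2)

lemma holo_funI:
  assumes c: "c \<in> A" "open V" "V \<subseteq> fst c" and f: "holo_on (snd c ` V) (\<lambda>x. f (chart_inv c x))"
  shows "holo_fun A V f"
  unfolding holo_fun_def
proof
  fix c' assume c': "c' \<in> A"
  let ?S = "snd c' ` (fst c' \<inter> V)"
  have "smooth_on ?S (\<lambda>x. snd c (chart_inv c' x) $ i)" for i
    using transition_holo[OF c' c(1), of i] c by (auto simp: holo_on_def elim!: smooth_on_mono)
  then have "holo_on ?S (\<lambda>x. snd c (chart_inv c' x) $ i)" for i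
    using transition_holo[OF c' c(1), of i] c by (auto simp: holo_on_def)
  then have "holo_on ?S (\<lambda>x. f (chart_inv c (snd c (chart_inv c' x))))"
    by (intro holo_on_compose[OF _ _ f]) (use c c' open_image in auto)
  then show "holo_on ?S (f \<circ> chart_inv c')"
    by (rule holo_on_cong[OF open_image[OF c' c(2)], rotated]) (use c c' in auto)
qed

lemma holo_funD:
  "holo_fun A V f \<Longrightarrow> c \<in> A \<Longrightarrow> V \<subseteq> fst c \<Longrightarrow> holo_on (snd c ` V) (\<lambda>x. f (chart_inv c x))"
  unfolding holo_fun_def o_def by (metis inf.absorb2)

lemma smooth_fun_mono: "smooth_fun A V f \<Longrightarrow> W \<subseteq> V \<Longrightarrow> smooth_fun A W f"
  unfolding smooth_fun_def by (meson Int_mono image_mono order_refl smooth_on_mono)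

lemma smooth_fun_cong:
  assumes "open V" "\<And>q. q \<in> V \<Longrightarrow> f q = g q" "smooth_fun A V f"
  shows "smooth_fun A V g"
  unfolding smooth_fun_def
proof
  fix c assume c: "c \<in> A"
  have "smooth_on (snd c ` (fst c \<inter> V)) (f \<circ> chart_inv c)"
    using assms(3) c by (simp add: smooth_fun_def)
  then show "smooth_on (snd c ` (fst c \<inter> V)) (g \<circ> chart_inv c)"
    by (rule smooth_on_cong[OF open_image[OF c assms(1)], rotated]) (use assms(2) c in auto)
qed

lemma smooth_fun_const: "open V \<Longrightarrow> smooth_fun A V (\<lambda>q. a)"
  by (auto simp: smooth_fun_def o_def intro: smooth_on_const open_image)

lemma smooth_fun_add: "open V \<Longrightarrow> smooth_fun A V f \<Longrightarrow> smooth_fun A V g \<Longrightarrow> smooth_fun A V (\<lambda>q. f q + g q)"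
  by (auto simp: smooth_fun_def o_def intro: smooth_on_add open_image)

lemma smooth_fun_mult: "open V \<Longrightarrow> smooth_fun A V f \<Longrightarrow> smooth_fun A V g \<Longrightarrow> smooth_fun A V (\<lambda>q. f q * g q)"
  by (auto simp: smooth_fun_def o_def intro: smooth_on_mult open_image)

lemma smooth_fun_bounded_linear:
  "open V \<Longrightarrow> bounded_linear L \<Longrightarrow> smooth_fun A V f \<Longrightarrow> smooth_fun A V (\<lambda>q. L (f q))"
  by (auto simp: smooth_fun_def o_def intro: smooth_on_bounded_linear open_image)

lemma smooth_fun_sum:
  "open V \<Longrightarrow> (\<And>i. i \<in> I \<Longrightarrow> smooth_fun A V (f i)) \<Longrightarrow> smooth_fun A V (\<lambda>q. \<Sum>i\<in>I. f i q)"
  by (induction I rule: infinite_finite_induct) (auto intro: smooth_fun_const smooth_fun_add)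

lemma smooth_fun_coord:
  assumes c: "c \<in> A"
  shows "smooth_fun A (fst c) (coord c \<alpha>)"
  unfolding smooth_fun_def coord_def comp_def
  using smooth_on_vec_nth[OF open_image[OF _ open_chart[OF c]] transition_smooth[OF _ c]] by blast

lemma smooth_nearI: "open V \<Longrightarrow> p \<in> V \<Longrightarrow> smooth_fun A V f \<Longrightarrow> smooth_near A p f"
  by (auto simp: smooth_near_def)

lemma smooth_nearE:
  assumes "smooth_near A p f" "open W" "p \<in> W"
  obtains V where "open V" "p \<in> V" "V \<subseteq> W" "smooth_fun A V f"
  using assms smooth_fun_mono unfolding smooth_near_def
  by (metis Int_iff inf_le1 inf_le2 open_Int)

lemma smooth_nearE2:
  assumes "smooth_near A p f" "smooth_near A p g" "open W" "p \<in> W"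
  obtains V where "open V" "p \<in> V" "V \<subseteq> W" "smooth_fun A V f" "smooth_fun A V g"
proof -
  obtain V where V: "open V" "p \<in> V" "V \<subseteq> W" "smooth_fun A V f" using smooth_nearE[OF assms(1,3,4)] .
  obtain V' where "open V'" "p \<in> V'" "V' \<subseteq> V" "smooth_fun A V' g" using smooth_nearE[OF assms(2) V(1,2)] .
  then show ?thesis using V that[of V'] smooth_fun_mono by blast
qed

text \<open>Tangent operators branch on \<open>smooth_near\<close>. For their value to depend on the
  germ alone, this case distinction has to depend on the germ alone.\<close>

lemma smooth_near_cong:
  assumes "open W" "p \<in> W" "\<And>q. q \<in> W \<Longrightarrow> f q = g q"
  shows "smooth_near A p f \<longleftrightarrow> smooth_near A p g"
proof -
  have "smooth_near A p g" if near: "smooth_near A p f" and eq: "\<And>q. q \<in> W \<Longrightarrow> f q = g q" for f g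
  proof -
    obtain V where V: "open V" "p \<in> V" "V \<subseteq> W" "smooth_fun A V f"
      using smooth_nearE[OF near assms(1,2)] .
    show ?thesis by (rule smooth_nearI[OF V(1,2) smooth_fun_cong[OF V(1) _ V(4)]]) (use eq V(3) in blast)
  qed
  then show ?thesis using assms(3) by (metis (no_types, lifting))
qed

lemma smooth_near_const: "smooth_near A p (\<lambda>q. a)"
  using smooth_fun_const open_UNIV by (auto simp: smooth_near_def)

lemma smooth_near_add:
  assumes "smooth_near A p f" "smooth_near A p g"
  shows "smooth_near A p (\<lambda>q. f q + g q)"
proof -
  obtain V where "open V" "p \<in> V" "smooth_fun A V f" "smooth_fun A V g"
    using smooth_nearE2[OF assms open_UNIV] by blast
  then show ?thesis using smooth_nearI smooth_fun_add by blast
qed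

lemma smooth_near_mult:
  assumes "smooth_near A p f" "smooth_near A p g"
  shows "smooth_near A p (\<lambda>q. f q * g q)"
proof -
  obtain V where "open V" "p \<in> V" "smooth_fun A V f" "smooth_fun A V g"
    using smooth_nearE2[OF assms open_UNIV] by blast
  then show ?thesis using smooth_nearI smooth_fun_mult by blast
qed

lemma smooth_near_bounded_linear:
  assumes "bounded_linear L" "smooth_near A p f"
  shows "smooth_near A p (\<lambda>q. L (f q))"
proof -
  obtain V where "open V" "p \<in> V" "smooth_fun A V f"
    using smooth_nearE[OF assms(2) open_UNIV] by blast
  then show ?thesis using smooth_nearI smooth_fun_bounded_linear[OF _ assms(1)] by blast
qed

lemma smooth_near_sum:
  "(\<And>i. i \<in> I \<Longrightarrow> smooth_near A p (f i)) \<Longrightarrow> smooth_near A p (\<lambda>q. \<Sum>i\<in>I. f i q)"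
  by (induction I rule: infinite_finite_induct) (auto intro: smooth_near_const smooth_near_add)

lemma smooth_near_coord: "c \<in> A \<Longrightarrow> p \<in> fst c \<Longrightarrow> smooth_near A p (coord c \<alpha>)"
  using smooth_fun_coord open_chart smooth_nearI by blast

lemma smooth_near_differentiable:
  assumes "smooth_near A p f" "c \<in> A" "p \<in> fst c"
  shows "(\<lambda>x. f (chart_inv c x)) differentiable (at (snd c p))"
proof -
  obtain V where V: "open V" "p \<in> V" "V \<subseteq> fst c" "smooth_fun A V f"
    using smooth_nearE[OF assms(1) open_chart[OF assms(2)] assms(3)] .
  then show ?thesis
    using smooth_on_differentiable[OF smooth_funD[OF V(4) assms(2) V(3)]] by blast
qed

end

section \<open>Tangent vectors\<close>

definition coordb :: "('m, 'n::finite) chart \<Rightarrow> 'n \<Rightarrow> 'm \<Rightarrow> complex" where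
  "coordb c \<alpha> q = cnj (coord c \<alpha> q)"

definition dzb :: "('m::topological_space, 'n::finite) chart set \<Rightarrow> ('m, 'n) chart \<Rightarrow> 'n \<Rightarrow> 'm \<Rightarrow> 'm tvec" where
  "dzb A c \<alpha> p = (\<lambda>f. (dx A c \<alpha> p f + \<i> * dy A c \<alpha> p f) / 2)"

text \<open>Extends \<open>dx\<close> and \<open>dy\<close> to arbitrary real directions, so that a
  change of chart acts on the direction only. The default 0 matches theirs, which makes the
  identities below equalities of operators.\<close>

definition dchart :: "('m::topological_space, 'n::finite) chart set \<Rightarrow> ('m, 'n) chart \<Rightarrow> complex ^ 'n \<Rightarrow> 'm \<Rightarrow> 'm tvec" where
  "dchart A c v p = (\<lambda>f. if smooth_near A p f
     then frechet_derivative (\<lambda>x. f (chart_inv c x)) (at (snd c p)) v else 0)"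

text \<open>Additivity and the product rule are restricted to germs smooth at \<open>p\<close>,
  because the default value 0 breaks both elsewhere. Locality is demanded for all functions, so that
  a function can be replaced by a local expression before its smoothness is discussed.\<close>

definition derivation :: "('m::topological_space, 'n::finite) chart set \<Rightarrow> 'm \<Rightarrow> 'm tvec \<Rightarrow> bool" where
  "derivation A p X \<longleftrightarrow>
     (\<forall>f g. smooth_near A p f \<longrightarrow> smooth_near A p g \<longrightarrow> X (\<lambda>q. f q + g q) = X f + X g) \<and>
     (\<forall>f g. smooth_near A p f \<longrightarrow> smooth_near A p g \<longrightarrow> X (\<lambda>q. f q * g q) = X f * g p + f p * X g) \<and>
     (\<forall>a. X (\<lambda>q. a) = 0) \<and>
     (\<forall>W f g. open W \<longrightarrow> p \<in> W \<longrightarrow> (\<forall>q\<in>W. f q = g q) \<longrightarrow> X f = X g)"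

lemma derivationI:
  assumes "\<And>f g. smooth_near A p f \<Longrightarrow> smooth_near A p g \<Longrightarrow> X (\<lambda>q. f q + g q) = X f + X g"
    and "\<And>f g. smooth_near A p f \<Longrightarrow> smooth_near A p g \<Longrightarrow> X (\<lambda>q. f q * g q) = X f * g p + f p * X g"
    and "\<And>a. X (\<lambda>q. a) = 0"
    and "\<And>W f g. open W \<Longrightarrow> p \<in> W \<Longrightarrow> \<forall>q\<in>W. f q = g q \<Longrightarrow> X f = X g"
  shows "derivation A p X"
  unfolding derivation_def
  by (intro conjI allI impI, erule (1) assms(1), erule (1) assms(2), rule assms(3), erule (2) assms(4))

lemma derivationD:
  assumes "derivation A p X"
  shows "smooth_near A p f \<Longrightarrow> smooth_near A p g \<Longrightarrow> X (\<lambda>q. f q + g q) = X f + X g"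
    and "smooth_near A p f \<Longrightarrow> smooth_near A p g \<Longrightarrow> X (\<lambda>q. f q * g q) = X f * g p + f p * X g"
    and "X (\<lambda>q. a) = 0"
    and "open W \<Longrightarrow> p \<in> W \<Longrightarrow> \<forall>q\<in>W. f q = g q \<Longrightarrow> X f = X g"
proof -
  note D = assms[unfolded derivation_def]
  show "smooth_near A p f \<Longrightarrow> smooth_near A p g \<Longrightarrow> X (\<lambda>q. f q + g q) = X f + X g"
    using D[THEN conjunct1, THEN spec, THEN spec, of f g] by simp
  show "smooth_near A p f \<Longrightarrow> smooth_near A p g \<Longrightarrow> X (\<lambda>q. f q * g q) = X f * g p + f p * X g"
    using D[THEN conjunct2, THEN conjunct1, THEN spec, THEN spec, of f g] by simp
  show "X (\<lambda>q. a) = 0"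
    using D[THEN conjunct2, THEN conjunct2, THEN conjunct1] by simp
  show "open W \<Longrightarrow> p \<in> W \<Longrightarrow> \<forall>q\<in>W. f q = g q \<Longrightarrow> X f = X g"
    using D[THEN conjunct2, THEN conjunct2, THEN conjunct2, THEN spec, THEN spec, THEN spec, of W f g]
    by argo
qed

lemma dx_eq_dchart: "dx A c \<alpha> p = dchart A c (axis \<alpha> 1) p"
  unfolding dx_def dchart_def o_def ..

lemma dy_eq_dchart: "dy A c \<alpha> p = dchart A c (axis \<alpha> \<i>) p"
  unfolding dy_def dchart_def o_def ..

lemma linear_complex_vec_expand:
  fixes L :: "complex ^ 'n::finite \<Rightarrow> complex"
  assumes "linear L"
  shows "L v = (\<Sum>\<alpha>\<in>UNIV. of_real (Re (v $ \<alpha>)) * L (axis \<alpha> 1) + of_real (Im (v $ \<alpha>)) * L (axis \<alpha> \<i>))"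
proof -
  have ax: "Re a *\<^sub>R axis \<alpha> 1 + Im a *\<^sub>R axis \<alpha> \<i> = axis \<alpha> a" for \<alpha> :: 'n and a
    by (auto simp: vec_eq_iff axis_def complex_eq_iff)
  have v: "v = (\<Sum>\<alpha>\<in>UNIV. axis \<alpha> (v $ \<alpha>))"
    unfolding vec_eq_iff sum_component by (simp add: axis_def)
  have "L v = L (\<Sum>\<alpha>\<in>UNIV. Re (v $ \<alpha>) *\<^sub>R axis \<alpha> 1 + Im (v $ \<alpha>) *\<^sub>R axis \<alpha> \<i>)"
    unfolding ax v[symmetric] ..
  then show ?thesis
    by (simp only: linear_sum[OF assms] linear_add[OF assms] linear_scale[OF assms]
        scaleR_conv_of_real[where 'a = complex] o_def)
qed

lemma sum_mult_if_delta:
  fixes a :: "'n::finite \<Rightarrow> complex"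
  shows "(\<Sum>\<alpha>\<in>UNIV. a \<alpha> * (if \<alpha> = \<beta> then 1 else 0)) = a \<beta>"
    and "(\<Sum>\<alpha>\<in>UNIV. a \<alpha> * (if \<beta> = \<alpha> then 1 else 0)) = a \<beta>"
    and "(\<Sum>\<alpha>\<in>UNIV. (if \<beta> = \<alpha> then 1 else 0) * a \<alpha>) = a \<beta>"
    and "(\<Sum>\<alpha>\<in>UNIV. (if \<alpha> = \<beta> then 1 else 0) * a \<alpha>) = a \<beta>"
  by (simp_all add: if_distrib[of "\<lambda>x. _ * x"] if_distrib[of "\<lambda>x. x * _"] cong: if_cong)

context manifold
begin

lemma dchart_expand:
  assumes "c \<in> A" "p \<in> fst c"
  shows "dchart A c v p f =
    (\<Sum>\<alpha>\<in>UNIV. of_real (Re (v $ \<alpha>)) * dx A c \<alpha> p f + of_real (Im (v $ \<alpha>)) * dy A c \<alpha> p f)"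
proof (cases "smooth_near A p f")
  case True
  then show ?thesis
    unfolding dx_eq_dchart dy_eq_dchart dchart_def
    using linear_complex_vec_expand[OF linear_frechet_derivative[OF smooth_near_differentiable[OF True assms]], of v] True
    by simp
next
  case False
  then show ?thesis by (simp add: dx_eq_dchart dy_eq_dchart dchart_def)
qed

lemma dchart_transition:
  assumes c: "c \<in> A" "p \<in> fst c" and c': "c' \<in> A" "p \<in> fst c'"
  shows "dchart A c' v p =
    dchart A c (frechet_derivative (\<lambda>x. snd c (chart_inv c' x)) (at (snd c' p)) v) p"
proof
  fix f
  show "dchart A c' v p f =
    dchart A c (frechet_derivative (\<lambda>x. snd c (chart_inv c' x)) (at (snd c' p)) v) p f"
  proof (cases "smooth_near A p f")
    case True
    let ?S = "snd c' ` (fst c' \<inter> fst c)"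
    have S: "open ?S" "snd c' p \<in> ?S"
      using open_image[OF c'(1) open_chart[OF c(1)]] c c' by auto
    have d: "(\<lambda>x. snd c (chart_inv c' x)) differentiable (at (snd c' p))"
      using smooth_on_differentiable[OF transition_smooth[OF c'(1) c(1)]] c c' by blast
    have d': "(\<lambda>x. f (chart_inv c x)) differentiable (at (snd c (chart_inv c' (snd c' p))))"
      using smooth_near_differentiable[OF True c] c c' by simp
    have "frechet_derivative (\<lambda>x. f (chart_inv c' x)) (at (snd c' p)) =
        frechet_derivative (\<lambda>x. f (chart_inv c (snd c (chart_inv c' x)))) (at (snd c' p))"
      by (rule frechet_derivative_transform_within_open[OF smooth_near_differentiable[OF True c'] S]) (use c c' in auto)
    then show ?thesis
      using frechet_derivative_compose_apply[OF d d', of v] True c' by (simp add: dchart_def)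
  qed (simp add: dchart_def)
qed

text \<open>\<open>ctangent\<close> leaves the chart existential. The Jacobian of the transition map
  re-expresses the coordinate vectors of any chart in the prescribed chart \<open>c\<close>.\<close>

lemma ctangent_iff:
  assumes c: "c \<in> A" "p \<in> fst c"
  shows "X \<in> ctangent A p \<longleftrightarrow> (\<exists>a b. X = (\<lambda>f. \<Sum>\<alpha>\<in>UNIV. a \<alpha> * dx A c \<alpha> p f + b \<alpha> * dy A c \<alpha> p f))"
proof
  assume "X \<in> ctangent A p"
  then obtain c' and a b :: "complex ^ 'n" where c': "c' \<in> A" "p \<in> fst c'"
    and X: "X = (\<lambda>f. \<Sum>\<gamma>\<in>UNIV. a $ \<gamma> * dx A c' \<gamma> p f + b $ \<gamma> * dy A c' \<gamma> p f)"
    unfolding ctangent_def by blast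
  define \<phi> where "\<phi> = frechet_derivative (\<lambda>x. snd c (chart_inv c' x)) (at (snd c' p))"
  have "X f = (\<Sum>\<alpha>\<in>UNIV.
      (\<Sum>\<gamma>\<in>UNIV. a $ \<gamma> * of_real (Re (\<phi> (axis \<gamma> 1) $ \<alpha>)) + b $ \<gamma> * of_real (Re (\<phi> (axis \<gamma> \<i>) $ \<alpha>))) * dx A c \<alpha> p f +
      (\<Sum>\<gamma>\<in>UNIV. a $ \<gamma> * of_real (Im (\<phi> (axis \<gamma> 1) $ \<alpha>)) + b $ \<gamma> * of_real (Im (\<phi> (axis \<gamma> \<i>) $ \<alpha>))) * dy A c \<alpha> p f)"
    for f
  proof -
    have "X f = (\<Sum>\<gamma>\<in>UNIV. \<Sum>\<alpha>\<in>UNIV.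
        a $ \<gamma> * (of_real (Re (\<phi> (axis \<gamma> 1) $ \<alpha>)) * dx A c \<alpha> p f + of_real (Im (\<phi> (axis \<gamma> 1) $ \<alpha>)) * dy A c \<alpha> p f) +
        b $ \<gamma> * (of_real (Re (\<phi> (axis \<gamma> \<i>) $ \<alpha>)) * dx A c \<alpha> p f + of_real (Im (\<phi> (axis \<gamma> \<i>) $ \<alpha>)) * dy A c \<alpha> p f))"
      unfolding X dx_eq_dchart[of A c'] dy_eq_dchart[of A c'] dchart_transition[OF c c'] dchart_expand[OF c]
        \<phi>_def[symmetric] sum_distrib_left sum.distrib[symmetric] ..
    also have "\<dots> = (\<Sum>\<alpha>\<in>UNIV. \<Sum>\<gamma>\<in>UNIV.
        (a $ \<gamma> * of_real (Re (\<phi> (axis \<gamma> 1) $ \<alpha>)) + b $ \<gamma> * of_real (Re (\<phi> (axis \<gamma> \<i>) $ \<alpha>))) * dx A c \<alpha> p f +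
        (a $ \<gamma> * of_real (Im (\<phi> (axis \<gamma> 1) $ \<alpha>)) + b $ \<gamma> * of_real (Im (\<phi> (axis \<gamma> \<i>) $ \<alpha>))) * dy A c \<alpha> p f)"
      by (subst sum.swap) (simp add: algebra_simps)
    finally show ?thesis unfolding sum_distrib_right sum.distrib[symmetric] .
  qed
  then show "\<exists>a b. X = (\<lambda>f. \<Sum>\<alpha>\<in>UNIV. a \<alpha> * dx A c \<alpha> p f + b \<alpha> * dy A c \<alpha> p f)"
    by (intro exI ext)
next
  assume "\<exists>a b. X = (\<lambda>f. \<Sum>\<alpha>\<in>UNIV. a \<alpha> * dx A c \<alpha> p f + b \<alpha> * dy A c \<alpha> p f)"
  then obtain a b where "X = (\<lambda>f. \<Sum>\<alpha>\<in>UNIV. (\<chi> i. a i) $ \<alpha> * dx A c \<alpha> p f + (\<chi> i. b i) $ \<alpha> * dy A c \<alpha> p f)"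
    by auto
  then show "X \<in> ctangent A p" using c unfolding ctangent_def by blast
qed

lemma ctangentI:
  assumes "c \<in> A" "p \<in> fst c" "\<And>f. X f = (\<Sum>\<alpha>\<in>UNIV. a \<alpha> * dx A c \<alpha> p f + b \<alpha> * dy A c \<alpha> p f)"
  shows "X \<in> ctangent A p"
  unfolding ctangent_iff[OF assms(1,2)]
  by (rule exI[of _ a], rule exI[of _ b], rule ext, rule assms(3))

lemma ctangent_chart:
  assumes "X \<in> ctangent A p"
  obtains c where "c \<in> A" "p \<in> fst c"
  using assms unfolding ctangent_def by blast

lemma ctangent_lincomb:
  assumes "X \<in> ctangent A p" "Y \<in> ctangent A p"
  shows "(\<lambda>f. a * X f + b * Y f) \<in> ctangent A p"
proof -
  obtain c where c: "c \<in> A" "p \<in> fst c" using ctangent_chart[OF assms(1)] .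
  obtain k l where X: "X = (\<lambda>f. \<Sum>\<alpha>\<in>UNIV. k \<alpha> * dx A c \<alpha> p f + l \<alpha> * dy A c \<alpha> p f)"
    using assms(1) ctangent_iff[OF c] by blast
  obtain k' l' where Y: "Y = (\<lambda>f. \<Sum>\<alpha>\<in>UNIV. k' \<alpha> * dx A c \<alpha> p f + l' \<alpha> * dy A c \<alpha> p f)"
    using assms(2) ctangent_iff[OF c] by blast
  show ?thesis
  proof (rule ctangentI[OF c])
    show "a * X f + b * Y f = (\<Sum>\<alpha>\<in>UNIV. (a * k \<alpha> + b * k' \<alpha>) * dx A c \<alpha> p f + (a * l \<alpha> + b * l' \<alpha>) * dy A c \<alpha> p f)" for f
      unfolding X Y sum_distrib_left sum.distrib[symmetric] by (simp add: algebra_simps)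
  qed
qed

lemma ctangent_zero: "c \<in> A \<Longrightarrow> p \<in> fst c \<Longrightarrow> (\<lambda>f. 0) \<in> ctangent A p"
  by (rule ctangentI[where a = "\<lambda>_. 0" and b = "\<lambda>_. 0"]) auto

lemma dchart_in_ctangent: "c \<in> A \<Longrightarrow> p \<in> fst c \<Longrightarrow> dchart A c v p \<in> ctangent A p"
  by (rule ctangentI[OF _ _ dchart_expand])

text \<open>Complexified tangent vectors are complex combinations of derivatives along real
  directions, so statements closed under combinations only have to be checked where
  \<open>frechet_derivative\<close> can be used directly.\<close>

lemma ctangent_induct:
  assumes X: "X \<in> ctangent A p" and c: "c \<in> A" "p \<in> fst c"
    and P: "P (\<lambda>f. 0)" "\<And>X Y a b. P X \<Longrightarrow> P Y \<Longrightarrow> P (\<lambda>f. a * X f + b * Y f)"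
      "\<And>v. P (dchart A c v p)"
  shows "P X"
proof -
  obtain a b where X: "X = (\<lambda>f. \<Sum>\<alpha>\<in>UNIV. a \<alpha> * dx A c \<alpha> p f + b \<alpha> * dy A c \<alpha> p f)"
    using X ctangent_iff[OF c] by blast
  have "P (\<lambda>f. \<Sum>\<alpha>\<in>F. a \<alpha> * dx A c \<alpha> p f + b \<alpha> * dy A c \<alpha> p f)" if "finite F" for F
    using that
  proof induction
    case (insert \<alpha> F)
    have "P (\<lambda>f. a \<alpha> * dx A c \<alpha> p f + b \<alpha> * dy A c \<alpha> p f)"
      unfolding dx_eq_dchart dy_eq_dchart by (intro P(2,3))
    from P(2)[OF this insert.IH, of 1 1] insert.hyps show ?case by simp
  qed (simp add: P(1))
  then show ?thesis by (simp add: X)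
qed

lemma ctangent_sum:
  assumes "c \<in> A" "p \<in> fst c" "\<And>i. i \<in> I \<Longrightarrow> X i \<in> ctangent A p"
  shows "(\<lambda>f. \<Sum>i\<in>I. a i * X i f) \<in> ctangent A p"
  using assms(3)
proof (induction I rule: infinite_finite_induct)
  case (insert i I)
  then show ?case
    using ctangent_lincomb[of "X i" p "\<lambda>f. \<Sum>i\<in>I. a i * X i f" "a i" 1] by simp
qed (simp_all add: ctangent_zero[OF assms(1,2)])

lemma dz_in_ctangent: "c \<in> A \<Longrightarrow> p \<in> fst c \<Longrightarrow> dz A c \<alpha> p \<in> ctangent A p"
  using ctangent_lincomb[OF dchart_in_ctangent dchart_in_ctangent, of c p c "1/2" "axis \<alpha> 1" "- \<i> / 2" "axis \<alpha> \<i>"]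
  by (simp add: dz_def dx_eq_dchart dy_eq_dchart diff_divide_distrib)

lemma dzb_in_ctangent: "c \<in> A \<Longrightarrow> p \<in> fst c \<Longrightarrow> dzb A c \<alpha> p \<in> ctangent A p"
  using ctangent_lincomb[OF dchart_in_ctangent dchart_in_ctangent, of c p c "1/2" "axis \<alpha> 1" "\<i> / 2" "axis \<alpha> \<i>"]
  by (simp add: dzb_def dx_eq_dchart dy_eq_dchart add_divide_distrib)

lemma derivation_dchart:
  assumes c: "c \<in> A" "p \<in> fst c"
  shows "derivation A p (dchart A c v p)"
proof -
  note diff = smooth_near_differentiable[OF _ c]
  have cong: "dchart A c v p f = dchart A c v p g" if W: "open W" "p \<in> W" and eq: "\<forall>q\<in>W. f q = g q" for W f g
  proof (cases "smooth_near A p f")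
    case True
    have "frechet_derivative (\<lambda>x. f (chart_inv c x)) (at (snd c p)) = frechet_derivative (\<lambda>x. g (chart_inv c x)) (at (snd c p))"
      by (rule frechet_derivative_transform_within_open[OF diff[OF True] open_image[OF c(1) W(1)]]) (use W c eq in auto)
    then show ?thesis using smooth_near_cong[OF W, of f g] eq by (simp add: dchart_def)
  next
    case False
    then show ?thesis using smooth_near_cong[OF W, of f g] eq by (simp add: dchart_def)
  qed
  have "dchart A c v p (\<lambda>q. f q + g q) = dchart A c v p f + dchart A c v p g"
    if fg: "smooth_near A p f" "smooth_near A p g" for f g
  proof -
    have "frechet_derivative (\<lambda>x. f (chart_inv c x) + g (chart_inv c x)) (at (snd c p)) =
      (\<lambda>v. frechet_derivative (\<lambda>x. f (chart_inv c x)) (at (snd c p)) v + frechet_derivative (\<lambda>x. g (chart_inv c x)) (at (snd c p)) v)"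
      using diff[OF fg(1)] diff[OF fg(2)]
      by (intro frechet_derivative_at[symmetric] has_derivative_add) (auto simp: frechet_derivative_works)
    then show ?thesis using fg smooth_near_add by (simp add: dchart_def)
  qed
  moreover have "dchart A c v p (\<lambda>q. f q * g q) = dchart A c v p f * g p + f p * dchart A c v p g"
    if fg: "smooth_near A p f" "smooth_near A p g" for f g
  proof -
    have "frechet_derivative (\<lambda>x. f (chart_inv c x) * g (chart_inv c x)) (at (snd c p)) =
      (\<lambda>v. f (chart_inv c (snd c p)) * frechet_derivative (\<lambda>x. g (chart_inv c x)) (at (snd c p)) v
         + frechet_derivative (\<lambda>x. f (chart_inv c x)) (at (snd c p)) v * g (chart_inv c (snd c p)))"
      using diff[OF fg(1)] diff[OF fg(2)]
      by (intro frechet_derivative_at[symmetric] has_derivative_mult) (auto simp: frechet_derivative_works)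
    then show ?thesis using fg smooth_near_mult c by (simp add: dchart_def)
  qed
  moreover have "dchart A c v p (\<lambda>q. a) = 0" for a
    by (simp add: dchart_def)
  ultimately show ?thesis using cong by (intro derivationI)
qed

lemma ctangent_derivation:
  assumes "X \<in> ctangent A p"
  shows "derivation A p X"
proof -
  obtain c where c: "c \<in> A" "p \<in> fst c" using ctangent_chart[OF assms] .
  show ?thesis
  proof (rule ctangent_induct[OF assms c])
    show "derivation A p (\<lambda>f. a * X f + b * Y f)" if "derivation A p X" "derivation A p Y" for X Y a b
    proof -
      note X = derivationD[OF that(1)] and Y = derivationD[OF that(2)]
      show ?thesis
      proof (rule derivationI)
        fix W and f g :: "'m \<Rightarrow> complex"
        assume W: "open W" "p \<in> W" "\<forall>q\<in>W. f q = g q"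
        show "a * X f + b * Y f = a * X g + b * Y g"
          unfolding X(4)[OF W] Y(4)[OF W] ..
      qed (simp_all add: X(1-3) Y(1-3) algebra_simps)
    qed
    show "derivation A p (\<lambda>f. 0)" by (rule derivationI) simp_all
  qed (rule derivation_dchart[OF c])
qed

lemma tangent_add:
  "X \<in> ctangent A p \<Longrightarrow> smooth_near A p f \<Longrightarrow> smooth_near A p g \<Longrightarrow> X (\<lambda>q. f q + g q) = X f + X g"
  using derivationD(1)[OF ctangent_derivation] .

lemma tangent_mult:
  "X \<in> ctangent A p \<Longrightarrow> smooth_near A p f \<Longrightarrow> smooth_near A p g \<Longrightarrow>
    X (\<lambda>q. f q * g q) = X f * g p + f p * X g"
  using derivationD(2)[OF ctangent_derivation] .

lemma tangent_const: "X \<in> ctangent A p \<Longrightarrow> X (\<lambda>q. a) = 0"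
  using derivationD(3)[OF ctangent_derivation] .

lemma tangent_cong:
  "X \<in> ctangent A p \<Longrightarrow> open W \<Longrightarrow> p \<in> W \<Longrightarrow> (\<And>q. q \<in> W \<Longrightarrow> f q = g q) \<Longrightarrow> X f = X g"
  by (rule derivationD(4)[OF ctangent_derivation]) auto

lemma tangent_scale: "X \<in> ctangent A p \<Longrightarrow> smooth_near A p f \<Longrightarrow> X (\<lambda>q. a * f q) = a * X f"
  using tangent_mult[OF _ smooth_near_const, of X p f a] tangent_const by simp

lemma tangent_sum:
  assumes "X \<in> ctangent A p" "\<And>i. i \<in> I \<Longrightarrow> smooth_near A p (f i)"
  shows "X (\<lambda>q. \<Sum>i\<in>I. f i q) = (\<Sum>i\<in>I. X (f i))"
  using assms(2)
  by (induction I rule: infinite_finite_induct)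
    (auto simp: tangent_const[OF assms(1)] tangent_add[OF assms(1)] smooth_near_sum)

lemma smooth_near_cnj: "smooth_near A p f \<Longrightarrow> smooth_near A p (\<lambda>q. cnj (f q))"
  by (rule smooth_near_bounded_linear[OF bounded_linear_cnj])

lemma smooth_near_cnj_iff: "smooth_near A p (\<lambda>q. cnj (f q)) \<longleftrightarrow> smooth_near A p f"
  using smooth_near_cnj[of p "\<lambda>q. cnj (f q)"] smooth_near_cnj[of p f] by auto

lemma smooth_near_coordb: "c \<in> A \<Longrightarrow> p \<in> fst c \<Longrightarrow> smooth_near A p (coordb c \<alpha>)"
  unfolding coordb_def[abs_def] by (intro smooth_near_cnj smooth_near_coord)

text \<open>The direction is real, so differentiation commutes with conjugation; for germs that are
  not smooth both sides are the default 0.\<close>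

lemma dchart_cnj:
  assumes "c \<in> A" "p \<in> fst c"
  shows "dchart A c v p (\<lambda>q. cnj (f q)) = cnj (dchart A c v p f)"
  using frechet_derivative_bounded_linear[OF bounded_linear_cnj smooth_near_differentiable[OF _ assms]]
  by (simp add: dchart_def smooth_near_cnj_iff)

lemma dchart_coord:
  assumes c: "c \<in> A" "p \<in> fst c"
  shows "dchart A c v p (coord c \<beta>) = v $ \<beta>"
proof -
  have "frechet_derivative (\<lambda>x. coord c \<beta> (chart_inv c x)) (at (snd c p)) =
      frechet_derivative (\<lambda>x. x $ \<beta>) (at (snd c p))"
    by (rule frechet_derivative_transform_within_open[OF smooth_near_differentiable[OF smooth_near_coord[OF c] c] open_image[OF c(1) open_UNIV]])
      (use c in \<open>auto simp: coord_def\<close>)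
  moreover have "frechet_derivative (\<lambda>x. x $ \<beta>) (at (snd c p)) = (\<lambda>x. x $ \<beta>)"
    by (rule frechet_derivative_at[symmetric]) (rule bounded_linear_imp_has_derivative[OF bounded_linear_vec_nth])
  ultimately show ?thesis using smooth_near_coord[OF c] by (simp add: dchart_def)
qed

lemma dchart_coordb: "c \<in> A \<Longrightarrow> p \<in> fst c \<Longrightarrow> dchart A c v p (coordb c \<beta>) = cnj (v $ \<beta>)"
  unfolding coordb_def[abs_def] by (simp add: dchart_cnj dchart_coord)

lemma dz_dzb_coord:
  assumes "c \<in> A" "p \<in> fst c"
  shows "dz A c \<alpha> p (coord c \<beta>) = (if \<alpha> = \<beta> then 1 else 0)"
    and "dz A c \<alpha> p (coordb c \<beta>) = 0"
    and "dzb A c \<alpha> p (coord c \<beta>) = 0"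
    and "dzb A c \<alpha> p (coordb c \<beta>) = (if \<alpha> = \<beta> then 1 else 0)"
  using assms by (auto simp: dz_def dzb_def dx_eq_dchart dy_eq_dchart dchart_coord dchart_coordb axis_def)

lemma dz_cnj: "c \<in> A \<Longrightarrow> p \<in> fst c \<Longrightarrow> dz A c \<alpha> p (\<lambda>q. cnj (f q)) = cnj (dzb A c \<alpha> p f)"
  by (simp add: dz_def dzb_def dx_eq_dchart dy_eq_dchart dchart_cnj)

lemma dzb_cnj: "c \<in> A \<Longrightarrow> p \<in> fst c \<Longrightarrow> dzb A c \<alpha> p (\<lambda>q. cnj (f q)) = cnj (dz A c \<alpha> p f)"
  by (simp add: dz_def dzb_def dx_eq_dchart dy_eq_dchart dchart_cnj)

text \<open>The operators \<open>dz\<close>, \<open>dzb\<close> are dual to \<open>coord\<close>,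
  \<open>coordb\<close>. Along a real direction with component \<open>k\<close> this is Re k dx + Im
  k dy = k dz + cnj k dzb, and linearity does the rest.\<close>

lemma tangent_expand:
  assumes X: "X \<in> ctangent A p" and c: "c \<in> A" "p \<in> fst c"
  shows "X f = (\<Sum>\<alpha>\<in>UNIV. X (coord c \<alpha>) * dz A c \<alpha> p f + X (coordb c \<alpha>) * dzb A c \<alpha> p f)"
proof (rule ctangent_induct[OF X c])
  fix v
  have "of_real (Re k) * x + of_real (Im k) * y = k * ((x - \<i> * y) / 2) + cnj k * ((x + \<i> * y) / 2)" for k x y :: complex
    by (simp add: complex_eq_iff field_simps)
  then show "dchart A c v p f = (\<Sum>\<alpha>\<in>UNIV. dchart A c v p (coord c \<alpha>) * dz A c \<alpha> p f + dchart A c v p (coordb c \<alpha>) * dzb A c \<alpha> p f)"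
    unfolding dchart_coord[OF c] dchart_coordb[OF c] dchart_expand[OF c, of v f] dz_def dzb_def by simp
next
  fix X Y :: "'m tvec" and a b
  assume "X f = (\<Sum>\<alpha>\<in>UNIV. X (coord c \<alpha>) * dz A c \<alpha> p f + X (coordb c \<alpha>) * dzb A c \<alpha> p f)"
    "Y f = (\<Sum>\<alpha>\<in>UNIV. Y (coord c \<alpha>) * dz A c \<alpha> p f + Y (coordb c \<alpha>) * dzb A c \<alpha> p f)"
  then have "a * X f + b * Y f = a * (\<Sum>\<alpha>\<in>UNIV. X (coord c \<alpha>) * dz A c \<alpha> p f + X (coordb c \<alpha>) * dzb A c \<alpha> p f)
      + b * (\<Sum>\<alpha>\<in>UNIV. Y (coord c \<alpha>) * dz A c \<alpha> p f + Y (coordb c \<alpha>) * dzb A c \<alpha> p f)" by simp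
  also have "\<dots> = (\<Sum>\<alpha>\<in>UNIV. (a * X (coord c \<alpha>) + b * Y (coord c \<alpha>)) * dz A c \<alpha> p f
      + (a * X (coordb c \<alpha>) + b * Y (coordb c \<alpha>)) * dzb A c \<alpha> p f)"
    unfolding sum_distrib_left sum.distrib[symmetric] by (simp add: algebra_simps)
  finally show "a * X f + b * Y f = (\<Sum>\<alpha>\<in>UNIV. (a * X (coord c \<alpha>) + b * Y (coord c \<alpha>)) * dz A c \<alpha> p f
      + (a * X (coordb c \<alpha>) + b * Y (coordb c \<alpha>)) * dzb A c \<alpha> p f)" .
qed simp

text \<open>Multiplying the direction \<open>axis \<alpha> 1\<close> by \<i> gives
  \<open>axis \<alpha> \<i>\<close>, so complex-linearity of the derivative makes the two halves of
  \<open>dzb\<close> cancel.\<close>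

lemma dzb_holo:
  assumes c: "c \<in> A" "p \<in> fst c" and V: "open V" "p \<in> V" and f: "holo_fun A V f"
  shows "dzb A c \<alpha> p f = 0"
proof -
  have "smooth_fun A V f" using f by (auto simp: holo_fun_def smooth_fun_def holo_on_def)
  then have "smooth_near A p f" using V smooth_nearI by blast
  moreover have "axis \<alpha> \<i> = \<i> *s axis \<alpha> 1" by (auto simp: vec_eq_iff axis_def)
  moreover have "frechet_derivative (\<lambda>x. f (chart_inv c x)) (at (snd c p)) (\<i> *s axis \<alpha> 1) =
      \<i> * frechet_derivative (\<lambda>x. f (chart_inv c x)) (at (snd c p)) (axis \<alpha> 1)"
    using f c V by (auto simp: holo_fun_def holo_on_def o_def)
  ultimately show ?thesis
    by (simp add: dzb_def dx_eq_dchart dy_eq_dchart dchart_def)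
qed

lemma holo_fun_coord: "c \<in> A \<Longrightarrow> holo_fun A (fst c) (coord c \<alpha>)"
  using transition_holo[of _ c \<alpha>] by (auto simp: holo_fun_def coord_def o_def)

text \<open>Holomorphy of the transition maps acts here across two charts; this is what makes the
  type of a tangent vector independent of the chart.\<close>

lemma dzb_coord: "c \<in> A \<Longrightarrow> p \<in> fst c \<Longrightarrow> c' \<in> A \<Longrightarrow> p \<in> fst c' \<Longrightarrow> dzb A c' \<alpha> p (coord c \<beta>) = 0"
  using dzb_holo holo_fun_coord open_chart by blast

lemma dz_coordb: "c \<in> A \<Longrightarrow> p \<in> fst c \<Longrightarrow> c' \<in> A \<Longrightarrow> p \<in> fst c' \<Longrightarrow> dz A c' \<alpha> p (coordb c \<beta>) = 0"
  unfolding coordb_def[abs_def] by (simp add: dz_cnj dzb_coord)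


section \<open>The complex structure and the (1,0) tangent space\<close>

lemma chart_at: "chart_at A p \<in> A" "p \<in> fst (chart_at A p)"
proof -
  have "\<exists>c. c \<in> A \<and> p \<in> fst c" using manifold unfolding complex_manifold_def by blast
  from someI_ex[OF this] show "chart_at A p \<in> A" "p \<in> fst (chart_at A p)"
    by (auto simp: chart_at_def)
qed

lemma tangent_Re_Im_coord:
  assumes X: "X \<in> ctangent A p" and c: "c \<in> A" "p \<in> fst c"
  shows "X (\<lambda>q. of_real (Re (snd c q $ \<alpha>))) = (X (coord c \<alpha>) + X (coordb c \<alpha>)) / 2"
    and "X (\<lambda>q. of_real (Im (snd c q $ \<alpha>))) = - \<i> * (X (coord c \<alpha>) - X (coordb c \<alpha>)) / 2"
proof -
  note near = smooth_near_coord[OF c, of \<alpha>] smooth_near_coordb[OF c, of \<alpha>]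
  have lin: "X (\<lambda>q. a * coord c \<alpha> q + b * coordb c \<alpha> q) = a * X (coord c \<alpha>) + b * X (coordb c \<alpha>)" for a b
    using near smooth_near_mult[OF smooth_near_const] by (simp add: tangent_add[OF X] tangent_scale[OF X])
  have "(\<lambda>q. of_real (Re (snd c q $ \<alpha>))) = (\<lambda>q. (1/2) * coord c \<alpha> q + (1/2) * coordb c \<alpha> q)"
    by (auto simp: fun_eq_iff coord_def coordb_def complex_eq_iff)
  then show "X (\<lambda>q. of_real (Re (snd c q $ \<alpha>))) = (X (coord c \<alpha>) + X (coordb c \<alpha>)) / 2"
    by (simp only: lin) (simp add: field_simps)
  have "(\<lambda>q. of_real (Im (snd c q $ \<alpha>))) = (\<lambda>q. (- \<i>/2) * coord c \<alpha> q + (\<i>/2) * coordb c \<alpha> q)"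
    by (auto simp: fun_eq_iff coord_def coordb_def complex_eq_iff)
  then show "X (\<lambda>q. of_real (Im (snd c q $ \<alpha>))) = - \<i> * (X (coord c \<alpha>) - X (coordb c \<alpha>)) / 2"
    by (simp only: lin) (simp add: field_simps)
qed

lemma J_expand_chart_at:
  assumes X: "X \<in> ctangent A p" and c: "c = chart_at A p"
  shows "J A p X f = (\<Sum>\<alpha>\<in>UNIV. \<i> * X (coord c \<alpha>) * dz A c \<alpha> p f - \<i> * X (coordb c \<alpha>) * dzb A c \<alpha> p f)"
proof -
  have c': "c \<in> A" "p \<in> fst c" using chart_at c by auto
  have "(a + b) / 2 * y - (- \<i> * (a - b) / 2) * x = \<i> * a * ((x - \<i> * y) / 2) - \<i> * b * ((x + \<i> * y) / 2)"
    for a b x y :: complex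
    by (simp add: field_simps)
  then show ?thesis
    unfolding J_def Let_def c[symmetric] tangent_Re_Im_coord[OF X c'] dz_def dzb_def by simp
qed

text \<open>\<open>J\<close> is defined through one picked chart \<open>k\<close>. Since the
  coordinates of \<open>c\<close> are holomorphic in \<open>k\<close>, \<open>J\<close> multiplies
  the components on \<open>coord c\<close> by \<i> and those on \<open>coordb c\<close> by -\<i>;
  expanding the tangent vector \<open>J A p X\<close> in \<open>c\<close> then removes
  \<open>k\<close>.\<close>

lemma J_expand:
  assumes X: "X \<in> ctangent A p" and c: "c \<in> A" "p \<in> fst c"
  shows "J A p X f = (\<Sum>\<alpha>\<in>UNIV. \<i> * X (coord c \<alpha>) * dz A c \<alpha> p f - \<i> * X (coordb c \<alpha>) * dzb A c \<alpha> p f)"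
proof -
  define k where "k = chart_at A p"
  have k: "k \<in> A" "p \<in> fst k" using chart_at k_def by auto
  note J = J_expand_chart_at[OF X k_def]
  have "J A p X = (\<lambda>f. 1 * (\<Sum>\<alpha>\<in>UNIV. (\<i> * X (coord k \<alpha>)) * dz A k \<alpha> p f) + 1 * (\<Sum>\<alpha>\<in>UNIV. (- \<i> * X (coordb k \<alpha>)) * dzb A k \<alpha> p f))"
    unfolding J by (simp add: sum_subtractf sum_negf)
  also have "\<dots> \<in> ctangent A p"
    by (intro ctangent_lincomb ctangent_sum[OF k] dz_in_ctangent[OF k] dzb_in_ctangent[OF k])
  finally have JX: "J A p X \<in> ctangent A p" .
  have "J A p X (coord c \<alpha>) = \<i> * X (coord c \<alpha>)" "J A p X (coordb c \<alpha>) = - \<i> * X (coordb c \<alpha>)" for \<alpha>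
    unfolding J tangent_expand[OF X k, of "coord c \<alpha>"] tangent_expand[OF X k, of "coordb c \<alpha>"]
    using dzb_coord[OF c k] dz_coordb[OF c k] by (simp_all add: sum_distrib_left sum_negf mult.assoc)
  then show ?thesis
    using tangent_expand[OF JX c, of f] by simp
qed

text \<open>On \<open>coordb\<close> the operator \<open>J\<close> always acts as -\<i>, while
  membership in \<open>T10\<close> asks for \<i>, so these components must vanish.\<close>

lemma T10_iff:
  assumes c: "c \<in> A" "p \<in> fst c"
  shows "Z \<in> T10 A p \<longleftrightarrow> Z \<in> ctangent A p \<and> (\<forall>\<alpha>. Z (coordb c \<alpha>) = 0)"
proof (intro iffI conjI allI)
  fix \<beta> assume Z: "Z \<in> T10 A p"
  then have Zc: "Z \<in> ctangent A p" and "J A p Z (coordb c \<beta>) = \<i> * Z (coordb c \<beta>)"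
    by (simp_all add: T10_def)
  moreover have "J A p Z (coordb c \<beta>) = - \<i> * Z (coordb c \<beta>)"
    unfolding J_expand[OF Zc c] dz_dzb_coord[OF c] by (simp add: sum_negf sum_mult_if_delta)
  ultimately show "Z (coordb c \<beta>) = 0" by simp
next
  assume Z: "Z \<in> ctangent A p \<and> (\<forall>\<alpha>. Z (coordb c \<alpha>) = 0)"
  then have "J A p Z f = \<i> * Z f" for f
    using tangent_expand[of Z p c f] J_expand[of Z p c f] c by (simp add: sum_distrib_left mult.assoc)
  then show "Z \<in> T10 A p" using Z by (auto simp: T10_def)
qed (auto simp: T10_def)

lemma T10_expand:
  assumes c: "c \<in> A" "p \<in> fst c" and "Z \<in> T10 A p"
  shows "Z f = (\<Sum>\<alpha>\<in>UNIV. Z (coord c \<alpha>) * dz A c \<alpha> p f)"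
  using assms(3) tangent_expand[OF _ c, of Z f] unfolding T10_iff[OF c] by simp

lemma T10_ctangent: "Z \<in> T10 A p \<Longrightarrow> Z \<in> ctangent A p"
  by (simp add: T10_def)

lemma T10_sum:
  assumes "\<And>i. i \<in> I \<Longrightarrow> Z i \<in> T10 A p"
  shows "(\<lambda>f. \<Sum>i\<in>I. a i * Z i f) \<in> T10 A p"
  using assms ctangent_sum[OF chart_at, of I Z p a] unfolding T10_iff[OF chart_at] by simp

lemma dz_T10: "c \<in> A \<Longrightarrow> p \<in> fst c \<Longrightarrow> dz A c \<alpha> p \<in> T10 A p"
  by (simp add: T10_iff dz_in_ctangent dz_dzb_coord)

lemma dzb_T01: "c \<in> A \<Longrightarrow> p \<in> fst c \<Longrightarrow> dzb A c \<alpha> p \<in> T01 A p"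
proof -
  assume c: "c \<in> A" "p \<in> fst c"
  have "J A p (dzb A c \<alpha> p) f = - \<i> * dzb A c \<alpha> p f" for f
    unfolding J_expand[OF dzb_in_ctangent[OF c] c] dz_dzb_coord[OF c] mult.commute[of \<i>] mult.assoc
    by (simp add: sum_negf sum_mult_if_delta)
  then show ?thesis by (auto simp: T01_def dzb_in_ctangent[OF c])
qed

lemma rtangent_cnj:
  assumes "X \<in> rtangent A p"
  shows "X (\<lambda>q. cnj (f q)) = cnj (X f)"
  using assms unfolding rtangent_def dx_eq_dchart dy_eq_dchart by (auto simp: dchart_cnj)

lemma rtangent_ctangent:
  assumes "X \<in> rtangent A p"
  shows "X \<in> ctangent A p"
proof -
  obtain c and a b :: "real ^ 'n" where c: "c \<in> A" "p \<in> fst c"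
    and X: "X = (\<lambda>f. \<Sum>\<alpha>\<in>UNIV. of_real (a $ \<alpha>) * dx A c \<alpha> p f + of_real (b $ \<alpha>) * dy A c \<alpha> p f)"
    using assms unfolding rtangent_def by blast
  show ?thesis unfolding X by (rule ctangentI[OF c refl])
qed

lemma rtangentI:
  assumes X: "X \<in> ctangent A p" and c: "c \<in> A" "p \<in> fst c"
    and r: "\<And>\<alpha>. X (coordb c \<alpha>) = cnj (X (coord c \<alpha>))"
  shows "X \<in> rtangent A p"
proof -
  have "k * ((x - \<i> * y) / 2) + cnj k * ((x + \<i> * y) / 2) = of_real (Re k) * x + of_real (Im k) * y" for k x y :: complex
    by (simp add: complex_eq_iff field_simps)
  then have "X f = (\<Sum>\<alpha>\<in>UNIV. of_real ((\<chi> \<alpha>. Re (X (coord c \<alpha>))) $ \<alpha>) * dx A c \<alpha> p f + of_real ((\<chi> \<alpha>. Im (X (coord c \<alpha>))) $ \<alpha>) * dy A c \<alpha> p f)" for f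
    unfolding tangent_expand[OF X c, of f] r dz_def dzb_def by simp
  then have "X = (\<lambda>f. \<Sum>\<alpha>\<in>UNIV. of_real ((\<chi> \<alpha>. Re (X (coord c \<alpha>))) $ \<alpha>) * dx A c \<alpha> p f + of_real ((\<chi> \<alpha>. Im (X (coord c \<alpha>))) $ \<alpha>) * dy A c \<alpha> p f)"
    by (rule ext)
  then show ?thesis using c unfolding rtangent_def by blast
qed

lemma rtangent_coordb: "X \<in> rtangent A p \<Longrightarrow> X (coordb c \<alpha>) = cnj (X (coord c \<alpha>))"
  unfolding coordb_def[abs_def] by (rule rtangent_cnj)

text \<open>Subtracting \<i> times \<open>J\<close> doubles the \<open>dz\<close> part and cancels
  the \<open>dzb\<close> part.\<close>

lemma o_map_expand:
  assumes X: "X \<in> ctangent A p" and c: "c \<in> A" "p \<in> fst c"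
  shows "o_map A p X f = (\<Sum>\<alpha>\<in>UNIV. X (coord c \<alpha>) * dz A c \<alpha> p f)"
proof -
  have "X f - \<i> * J A p X f = (\<Sum>\<alpha>\<in>UNIV. 2 * (X (coord c \<alpha>) * dz A c \<alpha> p f))"
    unfolding tangent_expand[OF X c, of f] J_expand[OF X c] sum_distrib_left sum_subtractf[symmetric]
    by (simp add: algebra_simps)
  then show ?thesis unfolding o_map_def by (simp add: sum_distrib_left[symmetric])
qed

text \<open>Surjectivity of \<open>o_map\<close> from real tangent vectors onto \<open>T10\<close>,
  which makes the \<open>inv_into\<close> in \<open>induced\<close> meaningful: applying
  \<open>o_map\<close> to an induced derivative returns the Chern derivative.\<close>

lemma o_map_inv:
  assumes Z: "Z \<in> T10 A p"
  shows "inv_into (rtangent A p) (o_map A p) Z \<in> rtangent A p"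
    and "o_map A p (inv_into (rtangent A p) (o_map A p) Z) = Z"
proof -
  let ?c = "chart_at A p"
  \<comment> \<open>The real preimage of \<open>Z\<close> is \<open>Z\<close> plus its conjugate;
    the factors 1 give it the shape of \<open>ctangent_lincomb\<close>.\<close>
  define X where "X = (\<lambda>f. 1 * (\<Sum>\<alpha>\<in>UNIV. Z (coord ?c \<alpha>) * dz A ?c \<alpha> p f) + 1 * (\<Sum>\<alpha>\<in>UNIV. cnj (Z (coord ?c \<alpha>)) * dzb A ?c \<alpha> p f))"
  have X: "X \<in> ctangent A p"
    unfolding X_def
    by (intro ctangent_lincomb ctangent_sum[OF chart_at] dz_in_ctangent[OF chart_at] dzb_in_ctangent[OF chart_at])
  have Xc: "X (coord ?c \<alpha>) = Z (coord ?c \<alpha>)" for \<alpha>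
    unfolding X_def dz_dzb_coord[OF chart_at] by (simp add: sum_mult_if_delta)
  have "X (coordb ?c \<alpha>) = cnj (X (coord ?c \<alpha>))" for \<alpha>
    unfolding Xc unfolding X_def dz_dzb_coord[OF chart_at] by (simp add: sum_mult_if_delta)
  then have "X \<in> rtangent A p" by (rule rtangentI[OF X chart_at])
  moreover have "o_map A p X f = Z f" for f
    unfolding o_map_expand[OF X chart_at] Xc T10_expand[OF chart_at Z, of f] ..
  ultimately have "Z \<in> o_map A p ` rtangent A p" by (intro image_eqI[of _ _ X]) auto
  then show "inv_into (rtangent A p) (o_map A p) Z \<in> rtangent A p"
    "o_map A p (inv_into (rtangent A p) (o_map A p) Z) = Z"
    by (rule inv_into_into, rule f_inv_into_f)
qed

text \<open>The formula for \<open>J\<close> is linear in the operator, so \<open>o_map\<close>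
  passes through the three terms of \<open>curv\<close> whatever these operators are.\<close>

lemma o_map_diff: "o_map A p (\<lambda>f. X f - Y f - Z f) = (\<lambda>f. o_map A p X f - o_map A p Y f - o_map A p Z f)"
  unfolding o_map_def J_def Let_def
  by (simp add: sum_subtractf sum.distrib algebra_simps diff_divide_distrib add_divide_distrib)

section \<open>Vector fields\<close>

lemma smooth_field_mono: "smooth_field A U X \<Longrightarrow> W \<subseteq> U \<Longrightarrow> smooth_field A W X"
  unfolding smooth_field_def by blast

lemma section10_mono: "section10 A U X \<Longrightarrow> W \<subseteq> U \<Longrightarrow> section10 A W X"
  unfolding section10_def using smooth_field_mono by blast

lemma smooth_fun_dchart:
  assumes c: "c \<in> A" and V: "open V" "V \<subseteq> fst c" and f: "smooth_fun A V f"
  shows "smooth_fun A V (\<lambda>q. dchart A c v q f)"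
proof (rule smooth_funI[OF c V])
  have "open (snd c ` V)" using open_image[OF c V(1)] V(2) by (simp add: inf.absorb2)
  moreover have "smooth_on (snd c ` V) (\<lambda>x. frechet_derivative (\<lambda>y. f (chart_inv c y)) (at x) v)"
    by (rule smooth_on_derivative[OF smooth_funD[OF f c V(2)]])
  ultimately show "smooth_on (snd c ` V) (\<lambda>x. dchart A c v (chart_inv c x) f)"
    using V c smooth_nearI[OF V(1) _ f]
    by (elim smooth_on_cong[rotated 2]) (auto simp: dchart_def subset_iff)
qed

lemma dchart_commute:
  assumes c: "c \<in> A" and V: "open V" "V \<subseteq> fst c" "p \<in> V" and f: "smooth_fun A V f"
  shows "dchart A c v p (\<lambda>q. dchart A c w q f) = dchart A c w p (\<lambda>q. dchart A c v q f)"
proof -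
  have S: "open (snd c ` V)" "snd c p \<in> snd c ` V"
    using open_image[OF c V(1)] V by (simp_all add: inf.absorb2)
  have p: "p \<in> fst c" using V by auto
  have near: "smooth_near A p (\<lambda>q. dchart A c w q f)" for w
    using smooth_nearI[OF V(1,3) smooth_fun_dchart[OF c V(1,2) f]] .
  have "dchart A c v p (\<lambda>q. dchart A c w q f) =
      frechet_derivative (\<lambda>x. frechet_derivative (\<lambda>y. f (chart_inv c y)) (at x) w) (at (snd c p)) v" for v w
  proof -
    have "frechet_derivative (\<lambda>x. dchart A c w (chart_inv c x) f) (at (snd c p)) =
       frechet_derivative (\<lambda>x. frechet_derivative (\<lambda>y. f (chart_inv c y)) (at x) w) (at (snd c p))"
      by (rule frechet_derivative_transform_within_open[OF smooth_near_differentiable[OF near c p] S])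
        (use V c smooth_nearI[OF V(1) _ f] in \<open>auto simp: dchart_def subset_iff\<close>)
    then show ?thesis using near by (simp add: dchart_def[of A c v])
  qed
  then show ?thesis
    using smooth_on_derivative_commute[OF S(1) smooth_funD[OF f c V(2)] S(2)] by simp
qed

lemma smooth_fun_scale: "open V \<Longrightarrow> smooth_fun A V f \<Longrightarrow> smooth_fun A V (\<lambda>q. a * f q)"
  by (rule smooth_fun_mult[OF _ smooth_fun_const])

lemma dz_eq_dchart: "dz A c \<alpha> q f = (1/2) * dchart A c (axis \<alpha> 1) q f + (- \<i>/2) * dchart A c (axis \<alpha> \<i>) q f"
  by (simp add: dz_def dx_eq_dchart dy_eq_dchart field_simps)

lemma dzb_eq_dchart: "dzb A c \<alpha> q f = (1/2) * dchart A c (axis \<alpha> 1) q f + (\<i>/2) * dchart A c (axis \<alpha> \<i>) q f"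
  by (simp add: dzb_def dx_eq_dchart dy_eq_dchart field_simps)

lemma smooth_fun_dz:
  assumes "c \<in> A" "open V" "V \<subseteq> fst c" "smooth_fun A V f"
  shows "smooth_fun A V (\<lambda>q. dz A c \<alpha> q f)"
  unfolding dz_eq_dchart by (intro smooth_fun_add smooth_fun_scale smooth_fun_dchart assms)

lemma smooth_fun_dzb:
  assumes "c \<in> A" "open V" "V \<subseteq> fst c" "smooth_fun A V f"
  shows "smooth_fun A V (\<lambda>q. dzb A c \<alpha> q f)"
  unfolding dzb_eq_dchart by (intro smooth_fun_add smooth_fun_scale smooth_fun_dchart assms)

text \<open>Both operators are combinations of \<open>dchart\<close> with constant coefficients, so
  \<open>dchart_commute\<close> applies term by term.\<close>

lemma dz_dzb_commute:
  assumes c: "c \<in> A" and V: "open V" "V \<subseteq> fst c" "p \<in> V" and f: "smooth_fun A V f"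
  shows "dz A c \<gamma> p (\<lambda>q. dzb A c \<delta> q f) = dzb A c \<delta> p (\<lambda>q. dz A c \<gamma> q f)"
proof -
  have p: "p \<in> fst c" using V by auto
  note X = dchart_in_ctangent[OF c p]
  have near: "smooth_near A p (\<lambda>q. dchart A c w q f)" for w
    using smooth_nearI[OF V(1,3) smooth_fun_dchart[OF c V(1,2) f]] .
  have lin: "dchart A c v p (\<lambda>q. a * dchart A c w q f + b * dchart A c w' q f) =
      a * dchart A c v p (\<lambda>q. dchart A c w q f) + b * dchart A c v p (\<lambda>q. dchart A c w' q f)" for v w w' a b
    using near smooth_near_mult[OF smooth_near_const] by (simp add: tangent_add[OF X] tangent_scale[OF X])
  note comm = dchart_commute[OF c V f]
  show ?thesis
    unfolding dz_eq_dchart dzb_eq_dchart lin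
      comm[of "axis \<gamma> 1"] comm[of "axis \<gamma> \<i>" "axis \<delta> 1"] comm[of "axis \<gamma> \<i>" "axis \<delta> \<i>"]
    by (simp add: field_simps)
qed

lemma section10_dz: "c \<in> A \<Longrightarrow> section10 A (fst c) (dz A c \<alpha>)"
  unfolding section10_def smooth_field_def using dz_T10 smooth_fun_dz by blast

lemma holo_section10_dz:
  assumes c: "c \<in> A"
  shows "holo_section10 A (fst c) (dz A c \<alpha>)"
  unfolding holo_section10_def
proof (intro conjI section10_dz c allI impI)
  fix V f assume "open V \<and> V \<subseteq> fst c \<and> holo_fun A V f"
  then have V: "open V" "V \<subseteq> fst c" and f: "holo_fun A V f" by auto
  have sm: "smooth_fun A V f" using f by (auto simp: holo_fun_def smooth_fun_def holo_on_def)
  \<comment> \<open>On holomorphic functions \<open>dzb\<close> vanishes, so \<open>dz\<close>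
    reduces to the derivative along the single real direction \<open>axis \<alpha> 1\<close>, to
    which \<open>holo_on_derivative\<close> applies.\<close>
  have eq: "dz A c \<alpha> q f = frechet_derivative (\<lambda>y. f (chart_inv c y)) (at (snd c q)) (axis \<alpha> 1)" if q: "q \<in> V" for q
  proof -
    have "dz A c \<alpha> q f = dchart A c (axis \<alpha> 1) q f"
      using dzb_holo[OF c _ V(1) q f] V q by (auto simp: dz_def dzb_def dx_eq_dchart add_eq_0_iff field_simps)
    then show ?thesis using smooth_nearI[OF V(1) q sm] by (simp add: dchart_def)
  qed
  have S: "open (snd c ` V)" using open_image[OF c V(1)] V by (simp add: inf.absorb2)
  show "holo_fun A V (\<lambda>q. dz A c \<alpha> q f)"
  proof (rule holo_funI[OF c V])
    show "holo_on (snd c ` V) (\<lambda>x. dz A c \<alpha> (chart_inv c x) f)"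
      by (rule holo_on_cong[OF S _ holo_on_derivative[OF S holo_funD[OF f c V(2)], of "axis \<alpha> 1"]])
        (use V eq c in \<open>auto simp: subset_iff\<close>)
  qed
qed

lemma section10_sum:
  assumes U: "open U" and s: "\<And>i. i \<in> I \<Longrightarrow> section10 A U (s i)" and k: "\<And>i. i \<in> I \<Longrightarrow> smooth_fun A U (k i)"
  shows "section10 A U (\<lambda>q f. \<Sum>i\<in>I. k i q * s i q f)"
  unfolding section10_def smooth_field_def
proof (intro conjI ballI allI impI)
  show "(\<lambda>f. \<Sum>i\<in>I. k i q * s i q f) \<in> T10 A q" if "q \<in> U" for q
    using s that by (intro T10_sum) (auto simp: section10_def)
  show "smooth_fun A V (\<lambda>q. \<Sum>i\<in>I. k i q * s i q f)" if "open V \<and> V \<subseteq> U \<and> smooth_fun A V f" for V f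
    using s smooth_fun_mono[OF k, of _ V] that
    by (intro smooth_fun_sum smooth_fun_mult) (auto simp: section10_def smooth_field_def)
qed

text \<open>\<open>D\<close> is linear only in directions from \<open>ctangent\<close>, so the
  bracket in \<open>curv\<close> must be shown to lie there. The second-order terms of
  \<open>v w\<close> and \<open>w v\<close> agree by symmetry and cancel, leaving a first-order
  operator.\<close>

lemma lie_bracket_ctangent:
  assumes W: "open W" "p \<in> W" and c: "c \<in> A" "p \<in> fst c"
    and v: "\<And>q. q \<in> W \<Longrightarrow> v q \<in> ctangent A q" "smooth_field A W v"
    and w: "\<And>q. q \<in> W \<Longrightarrow> w q \<in> ctangent A q" "smooth_field A W w"
  shows "lie_bracket A v w p \<in> ctangent A p"
proof -
  \<comment> \<open>These are the 2n real coordinates, indexed by \<open>Basis\<close> so that real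
    and imaginary parts are treated uniformly, and made complex-valued so that tangent vectors can
    act on them.\<close>
  define x where "x b q = complex_of_real (snd c q \<bullet> b)" for b q
  have sx: "smooth_fun A (fst c) (x b)" for b
    unfolding smooth_fun_def o_def x_def
    using transition_smooth[OF _ c(1)] open_image[OF _ open_chart[OF c(1)]]
    by (intro ballI smooth_on_bounded_linear[of _ "\<lambda>y. complex_of_real (y \<bullet> b)"] bounded_linear_compose[OF bounded_linear_of_real bounded_linear_inner_left]) auto
  have dchart_x: "dchart A c u q (x b) = of_real (u \<bullet> b)" if q: "q \<in> fst c" for u q b
  proof -
    have near: "smooth_near A q (x b)" using sx q open_chart[OF c(1)] smooth_nearI by blast
    have bl: "bounded_linear (\<lambda>y. complex_of_real (y \<bullet> b))"
      by (intro bounded_linear_compose[OF bounded_linear_of_real bounded_linear_inner_left])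
    have "frechet_derivative (\<lambda>y. x b (chart_inv c y)) (at (snd c q)) =
        frechet_derivative (\<lambda>y. complex_of_real (y \<bullet> b)) (at (snd c q))"
      by (rule frechet_derivative_transform_within_open[OF smooth_near_differentiable[OF near c(1) q] open_image[OF c(1) open_UNIV]])
        (use c q in \<open>auto simp: x_def\<close>)
    also have "\<dots> = (\<lambda>y. complex_of_real (y \<bullet> b))"
      by (rule frechet_derivative_at[symmetric]) (rule bounded_linear_imp_has_derivative[OF bl])
    finally show ?thesis using near by (simp add: dchart_def)
  qed
  have ex: "X f = (\<Sum>b\<in>Basis. X (x b) * dchart A c b q f)" if X: "X \<in> ctangent A q" and q: "q \<in> fst c" for X q f
  proof (rule ctangent_induct[OF X c(1) q])
    fix u
    show "dchart A c u q f = (\<Sum>b\<in>Basis. dchart A c u q (x b) * dchart A c b q f)"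
    proof (cases "smooth_near A q f")
      case True
      have l: "linear (frechet_derivative (\<lambda>y. f (chart_inv c y)) (at (snd c q)))"
        by (rule linear_frechet_derivative[OF smooth_near_differentiable[OF True c(1) q]])
      have "frechet_derivative (\<lambda>y. f (chart_inv c y)) (at (snd c q)) (\<Sum>b\<in>Basis. (u \<bullet> b) *\<^sub>R b) =
          (\<Sum>b\<in>Basis. of_real (u \<bullet> b) * frechet_derivative (\<lambda>y. f (chart_inv c y)) (at (snd c q)) b)"
        by (simp only: linear_sum[OF l] linear_scale[OF l] scaleR_conv_of_real[where 'a = complex] o_def)
      then show ?thesis unfolding dchart_x[OF q] using True by (simp add: dchart_def euclidean_representation)
    qed (simp add: dchart_def)
  next
    fix X Y :: "'m tvec" and a b
    assume X: "X f = (\<Sum>b\<in>Basis. X (x b) * dchart A c b q f)" and Y: "Y f = (\<Sum>b\<in>Basis. Y (x b) * dchart A c b q f)"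
    show "a * X f + b * Y f = (\<Sum>d\<in>Basis. (a * X (x d) + b * Y (x d)) * dchart A c d q f)"
      unfolding X Y sum_distrib_left sum.distrib[symmetric] by (simp add: algebra_simps)
  qed simp
  have "lie_bracket A v w p f = (\<Sum>b\<in>Basis. (v p (\<lambda>q. w q (x b)) - w p (\<lambda>q. v q (x b))) * dchart A c b p f)" for f
  proof (cases "smooth_near A p f")
    case True
    obtain V where V: "open V" "p \<in> V" "V \<subseteq> W \<inter> fst c" "smooth_fun A V f"
      using smooth_nearE[OF True, of "W \<inter> fst c"] W c open_chart[OF c(1)] by auto
    \<comment> \<open>Splits one composition into a first-order part and a second-order part; only
      the first distinguishes the two orders of composition.\<close>
    have *: "v p (\<lambda>q. w q f) = (\<Sum>b\<in>Basis. v p (\<lambda>q. w q (x b)) * dchart A c b p f) +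
        (\<Sum>b\<in>Basis. \<Sum>d\<in>Basis. w p (x b) * v p (x d) * dchart A c d p (\<lambda>q. dchart A c b q f))"
      if v: "\<And>q. q \<in> W \<Longrightarrow> v q \<in> ctangent A q"
        and w: "\<And>q. q \<in> W \<Longrightarrow> w q \<in> ctangent A q" "smooth_field A W w" for v w
    proof -
      have vp: "v p \<in> ctangent A p" using v W by blast
      have n1: "smooth_near A p (\<lambda>q. w q (x b))" for b
        using w(2) V smooth_fun_mono[OF sx, of V b] by (intro smooth_nearI[OF V(1,2)]) (auto simp: smooth_field_def)
      have n2: "smooth_near A p (\<lambda>q. dchart A c b q f)" for b
        using smooth_fun_dchart[OF c(1) V(1) _ V(4)] V by (intro smooth_nearI[OF V(1,2)]) auto
      have "v p (\<lambda>q. w q f) = v p (\<lambda>q. \<Sum>b\<in>Basis. w q (x b) * dchart A c b q f)"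
        by (rule tangent_cong[OF vp V(1,2)]) (use V(3) w(1) in \<open>blast intro: ex\<close>)
      also have "\<dots> = (\<Sum>b\<in>Basis. v p (\<lambda>q. w q (x b) * dchart A c b q f))"
        by (rule tangent_sum[OF vp smooth_near_mult[OF n1 n2]])
      also have "\<dots> = (\<Sum>b\<in>Basis. v p (\<lambda>q. w q (x b)) * dchart A c b p f + w p (x b) * v p (\<lambda>q. dchart A c b q f))"
        by (simp only: tangent_mult[OF vp n1 n2])
      also have "\<dots> = (\<Sum>b\<in>Basis. v p (\<lambda>q. w q (x b)) * dchart A c b p f +
          (\<Sum>d\<in>Basis. w p (x b) * v p (x d) * dchart A c d p (\<lambda>q. dchart A c b q f)))"
        unfolding ex[OF vp c(2), of "\<lambda>q. dchart A c _ q f"] by (simp add: sum_distrib_left mult.assoc)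
      finally show ?thesis by (simp only: sum.distrib)
    qed
    have "(\<Sum>b\<in>Basis. \<Sum>d\<in>Basis. w p (x b) * v p (x d) * dchart A c d p (\<lambda>q. dchart A c b q f)) =
        (\<Sum>b\<in>Basis. \<Sum>d\<in>Basis. v p (x b) * w p (x d) * dchart A c d p (\<lambda>q. dchart A c b q f))"
      by (subst sum.swap) (use V dchart_commute[OF c(1) V(1) _ V(2,4)] in \<open>simp add: mult.commute\<close>)
    then show ?thesis
      using True *[OF v(1) w] *[OF w(1) v] by (simp add: lie_bracket_def sum_subtractf left_diff_distrib)
  next
    case False
    then show ?thesis by (simp add: lie_bracket_def dchart_def)
  qed
  then have "lie_bracket A v w p = (\<lambda>f. \<Sum>b\<in>Basis. (v p (\<lambda>q. w q (x b)) - w p (\<lambda>q. v q (x b))) * dchart A c b p f)"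
    by (rule ext)
  then show ?thesis
    using ctangent_sum[OF c, of Basis "\<lambda>b. dchart A c b p" "\<lambda>b. v p (\<lambda>q. w q (x b)) - w p (\<lambda>q. v q (x b))"]
      dchart_in_ctangent[OF c] by simp
qed

end

section \<open>The Chern connection in a chart\<close>

locale chern = manifold A for A :: "('m::{t2_space,second_countable_topology}, 'n::finite) chart set" +
  fixes h :: "'m \<Rightarrow> 'm tvec \<Rightarrow> 'm tvec \<Rightarrow> complex" and D :: "'m conn"
  assumes metric: "hermitian_metric A h" and chern: "chern_connection A h D"
begin

lemma section10_cong:
  assumes U: "open U" and eq: "\<And>q. q \<in> U \<Longrightarrow> s q = t q" and s: "section10 A U s"
  shows "section10 A U t"
  unfolding section10_def smooth_field_def
proof (intro conjI ballI allI impI)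
  show "t q \<in> T10 A q" if "q \<in> U" for q
    using s eq[OF that] that unfolding section10_def by metis
  fix V f assume V: "open V \<and> V \<subseteq> U \<and> smooth_fun A V f"
  then have "smooth_fun A V (\<lambda>q. s q f)" using s unfolding section10_def smooth_field_def by blast
  then show "smooth_fun A V (\<lambda>q. t q f)"
    by (rule smooth_fun_cong[rotated 2]) (use V eq in auto)
qed

context
  fixes U p s
  assumes U: "open U" "p \<in> U" and s: "section10 A U s"
begin

lemma connection_at:
  "(\<forall>Z\<in>ctangent A p. D p Z s \<in> T10 A p) \<and>
   (\<forall>Z\<in>ctangent A p. \<forall>W\<in>ctangent A p. \<forall>a b.
      D p (\<lambda>f. a * Z f + b * W f) s = (\<lambda>f. a * D p Z s f + b * D p W s f)) \<and>
   (\<forall>Z\<in>ctangent A p. \<forall>t. section10 A U t \<longrightarrow>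
      D p Z (\<lambda>q f. s q f + t q f) = (\<lambda>f. D p Z s f + D p Z t f)) \<and>
   (\<forall>Z\<in>ctangent A p. \<forall>k. smooth_fun A U k \<longrightarrow>
      D p Z (\<lambda>q f. k q * s q f) = (\<lambda>f. Z k * s p f + k p * D p Z s f))"
  using chern[unfolded chern_connection_def connection10_def, THEN conjunct1, THEN conjunct1, THEN spec, THEN spec, THEN spec,
      THEN mp, OF conjI[OF U(1) conjI[OF U(2) s]]] .

lemma D_T10: "Z \<in> ctangent A p \<Longrightarrow> D p Z s \<in> T10 A p"
  using connection_at[THEN conjunct1] by blast

lemma D_lincomb: "Z \<in> ctangent A p \<Longrightarrow> W \<in> ctangent A p \<Longrightarrow>
    D p (\<lambda>f. a * Z f + b * W f) s = (\<lambda>f. a * D p Z s f + b * D p W s f)"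
  by (rule connection_at[THEN conjunct2, THEN conjunct1, THEN bspec, THEN bspec, THEN spec, THEN spec])

lemma D_add: "Z \<in> ctangent A p \<Longrightarrow> section10 A U t \<Longrightarrow>
    D p Z (\<lambda>q f. s q f + t q f) = (\<lambda>f. D p Z s f + D p Z t f)"
  by (rule connection_at[THEN conjunct2, THEN conjunct2, THEN conjunct1, THEN bspec, THEN spec, THEN mp])

lemma D_leibniz: "Z \<in> ctangent A p \<Longrightarrow> smooth_fun A U k \<Longrightarrow>
    D p Z (\<lambda>q f. k q * s q f) = (\<lambda>f. Z k * s p f + k p * D p Z s f)"
  by (rule connection_at[THEN conjunct2, THEN conjunct2, THEN conjunct2, THEN bspec, THEN spec, THEN mp])

lemma D_sum_direction:
  assumes "\<And>i. i \<in> I \<Longrightarrow> X i \<in> ctangent A p"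
  shows "D p (\<lambda>f. \<Sum>i\<in>I. a i * X i f) s = (\<lambda>f. \<Sum>i\<in>I. a i * D p (X i) s f)"
proof -
  have 0: "D p (\<lambda>f. 0) s = (\<lambda>f. 0)"
    using D_lincomb[OF ctangent_zero[OF chart_at] ctangent_zero[OF chart_at], of 0 0] by simp
  show ?thesis
    using assms
  proof (induction I rule: infinite_finite_induct)
    case (insert i I)
    then have "D p (\<lambda>f. a i * X i f + 1 * (\<Sum>i\<in>I. a i * X i f)) s =
        (\<lambda>f. a i * D p (X i) s f + 1 * D p (\<lambda>f. \<Sum>i\<in>I. a i * X i f) s f)"
      by (intro D_lincomb ctangent_sum[OF chart_at]) auto
    then show ?case using insert by simp
  qed (simp_all add: 0)
qed

end

text \<open>Locality comes from the Leibniz rule for the indicator function of \<open>U\<close>.\<close>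

lemma D_cong:
  assumes U: "open U" "p \<in> U" and s: "section10 A U s" and eq: "\<And>q. q \<in> U \<Longrightarrow> s q = t q" and Z: "Z \<in> ctangent A p"
  shows "D p Z s = D p Z t"
proof -
  let ?k = "\<lambda>q. if q \<in> U then 1 else 0 :: complex"
  have t: "section10 A U t" by (rule section10_cong[OF U(1) eq s])
  have k: "smooth_fun A U ?k"
    by (rule smooth_fun_cong[OF U(1) _ smooth_fun_const[OF U(1), of 1]]) auto
  have Zk: "Z ?k = 0"
    using tangent_cong[OF Z U, of ?k "\<lambda>_. 1"] tangent_const[OF Z] by simp
  have "(\<lambda>q f. ?k q * s q f) = (\<lambda>q f. ?k q * t q f)" using eq by (auto simp: fun_eq_iff)
  moreover have "D p Z (\<lambda>q f. ?k q * t q f) = D p Z t"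
    using D_leibniz[OF U t Z k] Zk U(2) by simp
  ultimately show ?thesis
    using D_leibniz[OF U s Z k] Zk U(2) by simp
qed

lemma D_sum:
  assumes U: "open U" "p \<in> U" and s: "\<And>i. i \<in> I \<Longrightarrow> section10 A U (s i)"
    and k: "\<And>i. i \<in> I \<Longrightarrow> smooth_fun A U (k i)" and Z: "Z \<in> ctangent A p"
  shows "D p Z (\<lambda>q f. \<Sum>i\<in>I. k i q * s i q f) = (\<lambda>f. \<Sum>i\<in>I. Z (k i) * s i p f + k i p * D p Z (s i) f)"
proof -
  have z: "section10 A U (\<lambda>q f. 0)"
    using section10_sum[OF U(1), of "{}"] by simp
  have 0: "D p Z (\<lambda>q f. 0) = (\<lambda>f. 0)"
    using D_leibniz[OF U z Z smooth_fun_const[OF U(1), of 0]] by (simp add: tangent_const[OF Z])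
  show ?thesis
    using s k
  proof (induction I rule: infinite_finite_induct)
    case (insert i I)
    have ki: "section10 A U (\<lambda>q f. k i q * s i q f)"
      using section10_sum[OF U(1), of "{i}" s k] insert by simp
    have "section10 A U (\<lambda>q f. \<Sum>i\<in>I. k i q * s i q f)"
      using insert by (intro section10_sum U) auto
    then have "D p Z (\<lambda>q f. k i q * s i q f + (\<Sum>i\<in>I. k i q * s i q f)) =
        (\<lambda>f. D p Z (\<lambda>q f. k i q * s i q f) f + D p Z (\<lambda>q f. \<Sum>i\<in>I. k i q * s i q f) f)"
      by (intro D_add[OF U ki Z])
    moreover have "D p Z (\<lambda>q f. k i q * s i q f) = (\<lambda>f. Z (k i) * s i p f + k i p * D p Z (s i) f)"
      using insert by (intro D_leibniz[OF U _ Z]) auto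
    ultimately show ?case using insert by simp
  qed (simp_all add: 0)
qed

lemma D_section:
  "open U \<Longrightarrow> complex_field A U X \<Longrightarrow> section10 A U s \<Longrightarrow> section10 A U (\<lambda>q. D q (X q) s)"
  using chern[unfolded chern_connection_def connection10_def, THEN conjunct1, THEN conjunct2, THEN spec, THEN spec, THEN spec, of U X s]
  by blast

lemma D_metric:
  "open U \<Longrightarrow> p \<in> U \<Longrightarrow> section10 A U s \<Longrightarrow> section10 A U t \<Longrightarrow> v \<in> rtangent A p \<Longrightarrow>
    v (\<lambda>q. h q (s q) (t q)) = h p (D p v s) (t p) + h p (s p) (D p v t)"
  using chern[unfolded chern_connection_def, THEN conjunct2, THEN conjunct1, THEN spec, THEN spec, THEN spec, THEN spec, of U p s t]
  by blast

lemma D_holo: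
  "open U \<Longrightarrow> p \<in> U \<Longrightarrow> holo_section10 A U s \<Longrightarrow> Z \<in> T01 A p \<Longrightarrow> D p Z s = (\<lambda>f. 0)"
  using chern[unfolded chern_connection_def, THEN conjunct2, THEN conjunct2, THEN spec, THEN spec, THEN spec, of U p s]
  by blast

lemmas hermitian = metric[unfolded hermitian_metric_def]

lemma h_cnj: "Z \<in> T10 A p \<Longrightarrow> W \<in> T10 A p \<Longrightarrow> h p W Z = cnj (h p Z W)"
  using hermitian[THEN conjunct2, THEN conjunct2, THEN conjunct1, THEN spec, of p] by blast

lemma h_add: "Z \<in> T10 A p \<Longrightarrow> Z' \<in> T10 A p \<Longrightarrow> W \<in> T10 A p \<Longrightarrow>
    h p (\<lambda>f. Z f + Z' f) W = h p Z W + h p Z' W"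
  using hermitian[THEN conjunct1, THEN spec, of p] by blast

lemma h_scale: "Z \<in> T10 A p \<Longrightarrow> W \<in> T10 A p \<Longrightarrow> h p (\<lambda>f. a * Z f) W = a * h p Z W"
  using hermitian[THEN conjunct2, THEN conjunct1, THEN spec, THEN spec, of p a] by blast

lemma h_smooth: "open U \<Longrightarrow> section10 A U s \<Longrightarrow> section10 A U t \<Longrightarrow> smooth_fun A U (\<lambda>q. h q (s q) (t q))"
  using hermitian[THEN conjunct2, THEN conjunct2, THEN conjunct2, THEN conjunct2, THEN spec, THEN spec, THEN spec, of U s t] by blast

lemma h_sum_left:
  assumes "\<And>i. i \<in> I \<Longrightarrow> Z i \<in> T10 A p" and W: "W \<in> T10 A p"
  shows "h p (\<lambda>f. \<Sum>i\<in>I. a i * Z i f) W = (\<Sum>i\<in>I. a i * h p (Z i) W)"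
  using assms(1)
proof (induction I rule: infinite_finite_induct)
  case (insert i I)
  have "(\<lambda>f. a i * Z i f) \<in> T10 A p"
    using T10_sum[of "{i}" Z p a] insert by simp
  moreover have "(\<lambda>f. \<Sum>i\<in>I. a i * Z i f) \<in> T10 A p"
    using insert by (intro T10_sum) auto
  ultimately have "h p (\<lambda>f. a i * Z i f + (\<Sum>i\<in>I. a i * Z i f)) W =
      h p (\<lambda>f. a i * Z i f) W + h p (\<lambda>f. \<Sum>i\<in>I. a i * Z i f) W"
    by (rule h_add[OF _ _ W])
  then show ?case using insert h_scale[OF _ W, of "Z i" "a i"] by simp
qed (use h_scale[OF W W, of 0] h_scale[of "\<lambda>f. 0" p W 0] T10_sum[of "{}" _ p] W in simp_all)

lemma h_sum_right:
  assumes "\<And>i. i \<in> I \<Longrightarrow> Z i \<in> T10 A p" and W: "W \<in> T10 A p"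
  shows "h p W (\<lambda>f. \<Sum>i\<in>I. a i * Z i f) = (\<Sum>i\<in>I. cnj (a i) * h p W (Z i))"
proof -
  have "h p W (\<lambda>f. \<Sum>i\<in>I. a i * Z i f) = cnj (h p (\<lambda>f. \<Sum>i\<in>I. a i * Z i f) W)"
    using assms by (intro h_cnj T10_sum)
  also have "\<dots> = (\<Sum>i\<in>I. cnj (a i) * cnj (h p (Z i) W))"
    by (simp add: h_sum_left[OF assms, where a = a])
  also have "\<dots> = (\<Sum>i\<in>I. cnj (a i) * h p W (Z i))"
    using h_cnj[OF assms] by (intro sum.cong) auto
  finally show ?thesis .
qed

end

section \<open>Christoffel symbols of the Chern connection\<close>

locale chern_chart = chern A h D
  for A :: "('m::{t2_space,second_countable_topology}, 'n::finite) chart set" and h D +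
  fixes c assumes c: "c \<in> A"
begin

text \<open>The Christoffel symbol with the direction as first index. Applying the operator to
  \<open>coord c \<kappa>\<close> extracts the coefficient of \<open>dz A c \<kappa>\<close> by
  duality.\<close>

definition Gam :: "'n \<Rightarrow> 'n \<Rightarrow> 'n \<Rightarrow> 'm \<Rightarrow> complex" where
  "Gam \<gamma> \<alpha> \<kappa> q = D q (dz A c \<gamma> q) (dz A c \<alpha>) (coord c \<kappa>)"

text \<open>The matrix of connection one-forms in the holomorphic frame. Only the \<open>dz\<close>
  components of \<open>Z\<close> enter because the frame is parallel in the (0,1)
  directions.\<close>

definition conn_form :: "'n \<Rightarrow> 'n \<Rightarrow> 'm \<Rightarrow> 'm tvec \<Rightarrow> complex" where
  "conn_form \<alpha> \<kappa> q Z = (\<Sum>\<gamma>\<in>UNIV. Z (coord c \<gamma>) * Gam \<gamma> \<alpha> \<kappa> q)"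

text \<open>The metric coefficients as functions on the manifold, in contrast to
  \<open>h_mat\<close> on coordinate space, so that tangent operators can be applied to
  them.\<close>

definition H :: "'n \<Rightarrow> 'n \<Rightarrow> 'm \<Rightarrow> complex" where
  "H \<alpha> \<beta> q = h q (dz A c \<alpha> q) (dz A c \<beta> q)"

lemma open_c: "open (fst c)"
  using open_chart[OF c] .

text \<open>The smoothness clause of \<open>connection10\<close>, applied to the coordinate frame,
  is what allows the curvature to differentiate the symbols.\<close>

lemma smooth_Gam: "smooth_fun A (fst c) (Gam \<gamma> \<alpha> \<kappa>)"
proof -
  have "complex_field A (fst c) (dz A c \<gamma>)"
    using section10_dz[OF c, of \<gamma>] T10_ctangent unfolding complex_field_def section10_def by blast
  from D_section[OF open_c this section10_dz[OF c, of \<alpha>]]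
  show ?thesis
    using open_c smooth_fun_coord[OF c, of \<kappa>]
    unfolding section10_def smooth_field_def Gam_def[abs_def] by blast
qed

lemma smooth_H: "smooth_fun A (fst c) (H \<alpha> \<beta>)"
  unfolding H_def[abs_def] by (rule h_smooth[OF open_c section10_dz[OF c] section10_dz[OF c]])

lemma H_cnj: "q \<in> fst c \<Longrightarrow> H \<beta> \<alpha> q = cnj (H \<alpha> \<beta> q)"
  unfolding H_def by (rule h_cnj) (rule dz_T10[OF c], assumption)+

lemma D_dz:
  assumes q: "q \<in> fst c" and Z: "Z \<in> ctangent A q"
  shows "D q Z (dz A c \<alpha>) = (\<lambda>f. \<Sum>\<kappa>\<in>UNIV. conn_form \<alpha> \<kappa> q Z * dz A c \<kappa> q f)"
proof
  fix f
  note s = section10_dz[OF c, of \<alpha>]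
  let ?Z1 = "\<lambda>f. \<Sum>\<gamma>\<in>UNIV. Z (coord c \<gamma>) * dz A c \<gamma> q f" and ?Z2 = "\<lambda>f. \<Sum>\<gamma>\<in>UNIV. Z (coordb c \<gamma>) * dzb A c \<gamma> q f"
  have "Z = (\<lambda>f. 1 * ?Z1 f + 1 * ?Z2 f)"
    unfolding mult_1 sum.distrib[symmetric] by (rule ext, rule tangent_expand[OF Z c q])
  then have "D q Z (dz A c \<alpha>) = D q (\<lambda>f. 1 * ?Z1 f + 1 * ?Z2 f) (dz A c \<alpha>)" by simp
  also have "\<dots> = (\<lambda>f. 1 * D q ?Z1 (dz A c \<alpha>) f + 1 * D q ?Z2 (dz A c \<alpha>) f)"
    by (intro D_lincomb[OF open_c q s] ctangent_sum[OF c q] dz_in_ctangent[OF c q] dzb_in_ctangent[OF c q])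
  also have "\<dots> = (\<lambda>f. \<Sum>\<gamma>\<in>UNIV. Z (coord c \<gamma>) * D q (dz A c \<gamma> q) (dz A c \<alpha>) f)"
    unfolding D_sum_direction[OF open_c q s dz_in_ctangent[OF c q]] D_sum_direction[OF open_c q s dzb_in_ctangent[OF c q]]
      D_holo[OF open_c q holo_section10_dz[OF c] dzb_T01[OF c q]] by simp
  finally have "D q Z (dz A c \<alpha>) f = (\<Sum>\<gamma>\<in>UNIV. Z (coord c \<gamma>) * D q (dz A c \<gamma> q) (dz A c \<alpha>) f)"
    by (rule fun_cong)
  also have "\<dots> = (\<Sum>\<gamma>\<in>UNIV. Z (coord c \<gamma>) * (\<Sum>\<kappa>\<in>UNIV. Gam \<gamma> \<alpha> \<kappa> q * dz A c \<kappa> q f))"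
    unfolding Gam_def
    by (rule sum.cong[OF refl], rule arg_cong, rule T10_expand[OF c q D_T10[OF open_c q s dz_in_ctangent[OF c q]]])
  also have "\<dots> = (\<Sum>\<kappa>\<in>UNIV. conn_form \<alpha> \<kappa> q Z * dz A c \<kappa> q f)"
    unfolding conn_form_def sum_distrib_left sum_distrib_right by (subst sum.swap) (simp add: mult.assoc)
  finally show "D q Z (dz A c \<alpha>) f = (\<Sum>\<kappa>\<in>UNIV. conn_form \<alpha> \<kappa> q Z * dz A c \<kappa> q f)" .
qed

lemma D_frame_sum:
  assumes W: "open W" "p \<in> W" "W \<subseteq> fst c" and Z: "Z \<in> ctangent A p"
    and \<sigma>: "\<And>\<alpha>. smooth_fun A W (\<sigma> \<alpha>)"
  shows "D p Z (\<lambda>q f. \<Sum>\<alpha>\<in>UNIV. \<sigma> \<alpha> q * dz A c \<alpha> q f) =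
    (\<lambda>f. \<Sum>\<kappa>\<in>UNIV. (Z (\<sigma> \<kappa>) + (\<Sum>\<alpha>\<in>UNIV. \<sigma> \<alpha> p * conn_form \<alpha> \<kappa> p Z)) * dz A c \<kappa> p f)"
proof
  fix f
  have p: "p \<in> fst c" using W by blast
  have "D p Z (\<lambda>q f. \<Sum>\<alpha>\<in>UNIV. \<sigma> \<alpha> q * dz A c \<alpha> q f) f =
      (\<Sum>\<alpha>\<in>UNIV. Z (\<sigma> \<alpha>) * dz A c \<alpha> p f + \<sigma> \<alpha> p * (\<Sum>\<kappa>\<in>UNIV. conn_form \<alpha> \<kappa> p Z * dz A c \<kappa> p f))"
    unfolding D_sum[OF W(1,2) section10_mono[OF section10_dz[OF c] W(3)] \<sigma> Z] D_dz[OF p Z] ..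
  also have "\<dots> = (\<Sum>\<kappa>\<in>UNIV. (Z (\<sigma> \<kappa>) + (\<Sum>\<alpha>\<in>UNIV. \<sigma> \<alpha> p * conn_form \<alpha> \<kappa> p Z)) * dz A c \<kappa> p f)"
    unfolding sum.distrib distrib_right sum_distrib_left sum_distrib_right
    by (subst (2) sum.swap) (simp add: mult.assoc)
  finally show "D p Z (\<lambda>q f. \<Sum>\<alpha>\<in>UNIV. \<sigma> \<alpha> q * dz A c \<alpha> q f) f =
    (\<Sum>\<kappa>\<in>UNIV. (Z (\<sigma> \<kappa>) + (\<Sum>\<alpha>\<in>UNIV. \<sigma> \<alpha> p * conn_form \<alpha> \<kappa> p Z)) * dz A c \<kappa> p f)" .
qed

text \<open>Compatibility is available for the real vectors \<open>dx\<close> and \<open>dy\<close>.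
  With \<open>P\<close> the contribution of the first slot of \<open>h\<close> and \<open>Q\<close>
  that of the second, conjugate-linearity gives P + Q along \<open>dx\<close> and \<i> P - \<i> Q
  along \<open>dy\<close>; the combination \<open>dz\<close> isolates \<open>P\<close>.\<close>

lemma dz_H:
  assumes q: "q \<in> fst c"
  shows "dz A c \<gamma> q (H \<alpha> \<beta>) = (\<Sum>\<kappa>\<in>UNIV. Gam \<gamma> \<alpha> \<kappa> q * H \<kappa> \<beta> q)"
proof -
  note s = section10_dz[OF c]
  note T = dz_T10[OF c q]
  have xy: "dx A c \<gamma> q (coord c \<kappa>) = (if \<gamma> = \<kappa> then 1 else 0)" "dy A c \<gamma> q (coord c \<kappa>) = \<i> * (if \<gamma> = \<kappa> then 1 else 0)" for \<kappa>
    using dchart_coord[OF c q] by (simp_all add: dx_eq_dchart dy_eq_dchart axis_def)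
  have ct: "dx A c \<gamma> q \<in> ctangent A q" "dy A c \<gamma> q \<in> ctangent A q"
    using dchart_in_ctangent[OF c q] by (simp_all add: dx_eq_dchart dy_eq_dchart)
  have r: "dx A c \<gamma> q \<in> rtangent A q" "dy A c \<gamma> q \<in> rtangent A q"
    using ct by (auto intro!: rtangentI[OF _ c q] simp: dx_eq_dchart dy_eq_dchart dchart_coord[OF c q] dchart_coordb[OF c q])
  define P where "P = (\<Sum>\<kappa>\<in>UNIV. Gam \<gamma> \<alpha> \<kappa> q * H \<kappa> \<beta> q)"
  define Q where "Q = (\<Sum>\<kappa>\<in>UNIV. cnj (Gam \<gamma> \<beta> \<kappa> q) * H \<alpha> \<kappa> q)"
  have cf: "conn_form \<alpha> \<kappa> q (dx A c \<gamma> q) = Gam \<gamma> \<alpha> \<kappa> q" "conn_form \<alpha> \<kappa> q (dy A c \<gamma> q) = \<i> * Gam \<gamma> \<alpha> \<kappa> q" for \<alpha> \<kappa>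
    unfolding conn_form_def xy by (simp_all add: mult.assoc sum_distrib_left[symmetric] sum_mult_if_delta)
  have "dx A c \<gamma> q (H \<alpha> \<beta>) = P + Q" "dy A c \<gamma> q (H \<alpha> \<beta>) = \<i> * P - \<i> * Q"
    unfolding H_def[abs_def] D_metric[OF open_c q s s r(1)] D_metric[OF open_c q s s r(2)]
      D_dz[OF q ct(1)] D_dz[OF q ct(2)] cf h_sum_left[OF T T] h_sum_right[OF T T]
    by (simp_all add: P_def Q_def H_def sum_distrib_left sum_negf mult.assoc)
  then have "dz A c \<gamma> q (H \<alpha> \<beta>) = (P + Q - \<i> * (\<i> * P - \<i> * Q)) / 2"
    by (simp add: dz_def)
  also have "\<dots> = P" by (simp add: algebra_simps)
  finally show ?thesis unfolding P_def .
qed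

end

section \<open>Curvature of the induced connection in frame components\<close>

context chern_chart
begin

context
  fixes W p
  assumes W: "open W" "p \<in> W" "W \<subseteq> fst c"
begin

lemma in_chart: "q \<in> W \<Longrightarrow> q \<in> fst c"
  using W by blast

lemma smooth_comp:
  assumes "real_field A W u"
  shows "smooth_fun A W (\<lambda>q. u q (coord c \<alpha>))"
  using assms W(1) smooth_fun_mono[OF smooth_fun_coord[OF c] W(3)]
  unfolding real_field_def smooth_field_def by blast

lemma smooth_directional:
  assumes "real_field A W u" "smooth_fun A W f"
  shows "smooth_fun A W (\<lambda>q. u q f)"
  using assms W(1) unfolding real_field_def smooth_field_def by blast

lemma field_ctangent: "real_field A W u \<Longrightarrow> q \<in> W \<Longrightarrow> u q \<in> ctangent A q"
  unfolding real_field_def using rtangent_ctangent by blast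

lemma smooth_conn_form:
  assumes w: "real_field A W w"
  shows "smooth_fun A W (\<lambda>q. conn_form \<alpha> \<kappa> q (w q))"
  unfolding conn_form_def
  by (rule smooth_fun_sum[OF W(1)], rule smooth_fun_mult[OF W(1) smooth_comp[OF w] smooth_fun_mono[OF smooth_Gam W(3)]])

lemma section10_frame_sum:
  assumes "\<And>\<alpha>. smooth_fun A W (\<sigma> \<alpha>)"
  shows "section10 A W (\<lambda>q f. \<Sum>\<alpha>\<in>UNIV. \<sigma> \<alpha> q * dz A c \<alpha> q f)"
  by (rule section10_sum[OF W(1) section10_mono[OF section10_dz[OF c] W(3)] assms])

text \<open>The fields to be differentiated equal their frame expansions only on \<open>W\<close>,
  so the frame formula is combined with the locality of \<open>D\<close>.\<close>

lemma D_frame_section: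
  assumes q: "q \<in> W" and \<sigma>: "\<And>\<alpha>. smooth_fun A W (\<sigma> \<alpha>)" and Z: "Z \<in> ctangent A q"
    and t: "\<And>r. r \<in> W \<Longrightarrow> t r = (\<lambda>f. \<Sum>\<alpha>\<in>UNIV. \<sigma> \<alpha> r * dz A c \<alpha> r f)"
  shows "D q Z t = (\<lambda>f. \<Sum>\<kappa>\<in>UNIV. (Z (\<sigma> \<kappa>) + (\<Sum>\<alpha>\<in>UNIV. \<sigma> \<alpha> q * conn_form \<alpha> \<kappa> q Z)) * dz A c \<kappa> q f)"
proof -
  have "D q Z t = D q Z (\<lambda>q f. \<Sum>\<alpha>\<in>UNIV. \<sigma> \<alpha> q * dz A c \<alpha> q f)"
    by (rule D_cong[OF W(1) q section10_frame_sum[OF \<sigma>] _ Z, symmetric]) (use t in auto)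
  then show ?thesis using D_frame_sum[OF W(1) q W(3) Z \<sigma>] by simp
qed

text \<open>The coefficient of \<open>dz A c \<kappa>\<close> in the (1,0) part of the covariant
  derivative of \<open>u\<close>: the derivative of the component plus the connection term.\<close>

definition cov :: "('m \<Rightarrow> 'm tvec) \<Rightarrow> 'n \<Rightarrow> 'm \<Rightarrow> 'm tvec \<Rightarrow> complex" where
  "cov u \<kappa> q Z = Z (\<lambda>r. u r (coord c \<kappa>)) + (\<Sum>\<alpha>\<in>UNIV. u q (coord c \<alpha>) * conn_form \<alpha> \<kappa> q Z)"

lemma o_map_induced:
  assumes u: "real_field A W u" and q: "q \<in> W" and Z: "Z \<in> ctangent A q"
  shows "o_map A q (induced A D q Z u) = (\<lambda>f. \<Sum>\<kappa>\<in>UNIV. cov u \<kappa> q Z * dz A c \<kappa> q f)"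
proof -
  have t: "o_map A r (u r) = (\<lambda>f. \<Sum>\<alpha>\<in>UNIV. u r (coord c \<alpha>) * dz A c \<alpha> r f)" if "r \<in> W" for r
    by (rule ext, rule o_map_expand[OF field_ctangent[OF u that] c in_chart[OF that]])
  have eq: "D q Z (\<lambda>r. o_map A r (u r)) = (\<lambda>f. \<Sum>\<kappa>\<in>UNIV. cov u \<kappa> q Z * dz A c \<kappa> q f)"
    unfolding cov_def
    by (rule D_frame_section[OF q smooth_comp[OF u] Z, where t = "\<lambda>r. o_map A r (u r)"]) (rule t)
  have "(\<lambda>f. \<Sum>\<kappa>\<in>UNIV. cov u \<kappa> q Z * dz A c \<kappa> q f) \<in> T10 A q"
    by (intro T10_sum dz_T10[OF c in_chart[OF q]])
  then show ?thesis unfolding induced_def eq by (rule o_map_inv(2))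
qed

lemma smooth_cov:
  assumes u: "real_field A W u" and w: "real_field A W w"
  shows "smooth_fun A W (\<lambda>q. cov u \<kappa> q (w q))"
  unfolding cov_def
  by (rule smooth_fun_add[OF W(1) smooth_directional[OF w smooth_comp[OF u]]
        smooth_fun_sum[OF W(1) smooth_fun_mult[OF W(1) smooth_comp[OF u] smooth_conn_form[OF w]]]])

text \<open>The inner \<open>inv_into\<close> is removed by \<open>o_map_induced\<close> at every
  point of \<open>W\<close> before the outer derivative is taken, so the outer derivative acts on an
  explicit frame sum with coefficients \<open>cov\<close>.\<close>

lemma o_map_induced_induced:
  assumes u: "real_field A W u" and w: "real_field A W w" and v: "real_field A W v"
  shows "o_map A p (induced A D p (v p) (\<lambda>q. induced A D q (w q) u)) =
    (\<lambda>f. \<Sum>\<kappa>\<in>UNIV. (v p (\<lambda>q. cov u \<kappa> q (w q)) + (\<Sum>\<alpha>\<in>UNIV. cov u \<alpha> p (w p) * conn_form \<alpha> \<kappa> p (v p)))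
       * dz A c \<kappa> p f)"
proof -
  have eq: "D p (v p) (\<lambda>r. o_map A r (induced A D r (w r) u)) =
    (\<lambda>f. \<Sum>\<kappa>\<in>UNIV. (v p (\<lambda>q. cov u \<kappa> q (w q)) + (\<Sum>\<alpha>\<in>UNIV. cov u \<alpha> p (w p) * conn_form \<alpha> \<kappa> p (v p)))
       * dz A c \<kappa> p f)"
    by (rule D_frame_section[OF W(2) smooth_cov[OF u w] field_ctangent[OF v W(2)],
          where t = "\<lambda>r. o_map A r (induced A D r (w r) u)"])
      (rule o_map_induced[OF u _ field_ctangent[OF w]])
  have "(\<lambda>f. \<Sum>\<kappa>\<in>UNIV. (v p (\<lambda>q. cov u \<kappa> q (w q)) + (\<Sum>\<alpha>\<in>UNIV. cov u \<alpha> p (w p) * conn_form \<alpha> \<kappa> p (v p)))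
       * dz A c \<kappa> p f) \<in> T10 A p"
    by (intro T10_sum dz_T10[OF c in_chart[OF W(2)]])
  then show ?thesis unfolding induced_def[of A D p "v p"] eq by (rule o_map_inv(2))
qed

text \<open>The summands are grouped by their fate under antisymmetrisation in \<open>v\<close> and
  \<open>w\<close>. The first and fourth cancel against the bracket term, the second and third
  together are symmetric, and the last is the part that survives.\<close>

lemma second_cov:
  assumes u: "real_field A W u" and w: "real_field A W w" and v: "real_field A W v"
  shows "v p (\<lambda>q. cov u \<kappa> q (w q)) + (\<Sum>\<alpha>\<in>UNIV. cov u \<alpha> p (w p) * conn_form \<alpha> \<kappa> p (v p)) =
    v p (\<lambda>q. w q (\<lambda>r. u r (coord c \<kappa>)))
    + (\<Sum>\<alpha>\<in>UNIV. v p (\<lambda>r. u r (coord c \<alpha>)) * conn_form \<alpha> \<kappa> p (w p))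
    + (\<Sum>\<alpha>\<in>UNIV. w p (\<lambda>r. u r (coord c \<alpha>)) * conn_form \<alpha> \<kappa> p (v p))
    + (\<Sum>\<alpha>\<in>UNIV. u p (coord c \<alpha>) * (\<Sum>\<gamma>\<in>UNIV. v p (\<lambda>q. w q (coord c \<gamma>)) * Gam \<gamma> \<alpha> \<kappa> p))
    + (\<Sum>\<alpha>\<in>UNIV. u p (coord c \<alpha>) * ((\<Sum>\<gamma>\<in>UNIV. w p (coord c \<gamma>) * v p (Gam \<gamma> \<alpha> \<kappa>))
        + (\<Sum>\<beta>\<in>UNIV. conn_form \<alpha> \<beta> p (w p) * conn_form \<beta> \<kappa> p (v p))))"
proof -
  note vp = field_ctangent[OF v W(2)]
  note near = smooth_nearI[OF W(1,2)]
  note nu = near[OF smooth_comp[OF u]] and nw = near[OF smooth_comp[OF w]]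
    and nG = near[OF smooth_fun_mono[OF smooth_Gam W(3)]] and nC = near[OF smooth_conn_form[OF w]]
  have C: "v p (\<lambda>q. conn_form \<alpha> \<kappa> q (w q)) =
      (\<Sum>\<gamma>\<in>UNIV. v p (\<lambda>q. w q (coord c \<gamma>)) * Gam \<gamma> \<alpha> \<kappa> p) + (\<Sum>\<gamma>\<in>UNIV. w p (coord c \<gamma>) * v p (Gam \<gamma> \<alpha> \<kappa>))" for \<alpha>
    unfolding conn_form_def
    by (simp only: tangent_sum[OF vp smooth_near_mult[OF nw nG]] tangent_mult[OF vp nw nG] sum.distrib)
  have "v p (\<lambda>q. cov u \<kappa> q (w q)) = v p (\<lambda>q. w q (\<lambda>r. u r (coord c \<kappa>)))
     + (\<Sum>\<alpha>\<in>UNIV. v p (\<lambda>r. u r (coord c \<alpha>)) * conn_form \<alpha> \<kappa> p (w p) + u p (coord c \<alpha>) * v p (\<lambda>q. conn_form \<alpha> \<kappa> q (w q)))"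
    unfolding cov_def
    by (simp only: tangent_add[OF vp near[OF smooth_directional[OF w smooth_comp[OF u]]] smooth_near_sum[OF smooth_near_mult[OF nu nC]]]
        tangent_sum[OF vp smooth_near_mult[OF nu nC]] tangent_mult[OF vp nu nC])
  moreover have "(\<Sum>\<alpha>\<in>UNIV. cov u \<alpha> p (w p) * conn_form \<alpha> \<kappa> p (v p)) =
      (\<Sum>\<alpha>\<in>UNIV. w p (\<lambda>r. u r (coord c \<alpha>)) * conn_form \<alpha> \<kappa> p (v p)) +
      (\<Sum>\<alpha>\<in>UNIV. u p (coord c \<alpha>) * (\<Sum>\<beta>\<in>UNIV. conn_form \<alpha> \<beta> p (w p) * conn_form \<beta> \<kappa> p (v p)))"
    unfolding cov_def distrib_right sum.distrib sum_distrib_left sum_distrib_right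
    by (subst (2) sum.swap) (simp add: mult.assoc)
  ultimately show ?thesis
    unfolding C by (simp add: distrib_left sum.distrib)
qed

text \<open>The factor multiplying the components of \<open>u\<close> is the curvature form
  evaluated on \<open>v\<close>, \<open>w\<close>: the exterior derivative of the connection form
  together with its quadratic term. It no longer contains derivatives of the fields
  themselves.\<close>

lemma curv_components:
  assumes u: "real_field A W u" and v: "real_field A W v" and w: "real_field A W w"
  shows "o_map A p (curv A (induced A D) u v w p) = (\<lambda>f. \<Sum>\<kappa>\<in>UNIV. (\<Sum>\<alpha>\<in>UNIV. u p (coord c \<alpha>) *
     ((\<Sum>\<gamma>\<in>UNIV. w p (coord c \<gamma>) * v p (Gam \<gamma> \<alpha> \<kappa>)) + (\<Sum>\<beta>\<in>UNIV. conn_form \<alpha> \<beta> p (w p) * conn_form \<beta> \<kappa> p (v p))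
     - (\<Sum>\<gamma>\<in>UNIV. v p (coord c \<gamma>) * w p (Gam \<gamma> \<alpha> \<kappa>)) - (\<Sum>\<beta>\<in>UNIV. conn_form \<alpha> \<beta> p (v p) * conn_form \<beta> \<kappa> p (w p))))
     * dz A c \<kappa> p f)"
proof -
  \<comment> \<open>In \<open>cov\<close> of the bracket, the derivative part matches the commutator
    of second derivatives of \<open>u\<close>, and the connection part matches the derivatives of
    the components of \<open>v\<close> and \<open>w\<close>.\<close>
  let ?b = "lie_bracket A v w p"
  have b: "?b \<in> ctangent A p"
    using v w by (intro lie_bracket_ctangent[OF W(1,2) c in_chart[OF W(2)]])
      (auto simp: real_field_def rtangent_ctangent)
  have br: "?b f = v p (\<lambda>q. w q f) - w p (\<lambda>q. v q f)" if "smooth_fun A W f" for f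
    using smooth_nearI[OF W(1,2) that] by (simp add: lie_bracket_def)
  have cb: "conn_form \<alpha> \<kappa> p ?b = (\<Sum>\<gamma>\<in>UNIV. v p (\<lambda>q. w q (coord c \<gamma>)) * Gam \<gamma> \<alpha> \<kappa> p)
      - (\<Sum>\<gamma>\<in>UNIV. w p (\<lambda>q. v q (coord c \<gamma>)) * Gam \<gamma> \<alpha> \<kappa> p)" for \<alpha> \<kappa>
    unfolding conn_form_def br[OF smooth_fun_mono[OF smooth_fun_coord[OF c] W(3)]]
    by (simp add: left_diff_distrib sum_subtractf)
  have cov_b: "cov u \<kappa> p ?b = (v p (\<lambda>q. w q (\<lambda>r. u r (coord c \<kappa>))) - w p (\<lambda>q. v q (\<lambda>r. u r (coord c \<kappa>))))
     + ((\<Sum>\<alpha>\<in>UNIV. u p (coord c \<alpha>) * (\<Sum>\<gamma>\<in>UNIV. v p (\<lambda>q. w q (coord c \<gamma>)) * Gam \<gamma> \<alpha> \<kappa> p))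
     - (\<Sum>\<alpha>\<in>UNIV. u p (coord c \<alpha>) * (\<Sum>\<gamma>\<in>UNIV. w p (\<lambda>q. v q (coord c \<gamma>)) * Gam \<gamma> \<alpha> \<kappa> p)))" for \<kappa>
    unfolding cov_def br[OF smooth_comp[OF u]] cb by (simp only: right_diff_distrib sum_subtractf)
  have key: "v p (\<lambda>q. cov u \<kappa> q (w q)) + (\<Sum>\<alpha>\<in>UNIV. cov u \<alpha> p (w p) * conn_form \<alpha> \<kappa> p (v p))
    - (w p (\<lambda>q. cov u \<kappa> q (v q)) + (\<Sum>\<alpha>\<in>UNIV. cov u \<alpha> p (v p) * conn_form \<alpha> \<kappa> p (w p))) - cov u \<kappa> p ?b =
    (\<Sum>\<alpha>\<in>UNIV. u p (coord c \<alpha>) *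
     ((\<Sum>\<gamma>\<in>UNIV. w p (coord c \<gamma>) * v p (Gam \<gamma> \<alpha> \<kappa>)) + (\<Sum>\<beta>\<in>UNIV. conn_form \<alpha> \<beta> p (w p) * conn_form \<beta> \<kappa> p (v p))
     - (\<Sum>\<gamma>\<in>UNIV. v p (coord c \<gamma>) * w p (Gam \<gamma> \<alpha> \<kappa>)) - (\<Sum>\<beta>\<in>UNIV. conn_form \<alpha> \<beta> p (v p) * conn_form \<beta> \<kappa> p (w p))))"
    (is "_ = ?R") for \<kappa>
  proof -
    have R: "?R = (\<Sum>\<alpha>\<in>UNIV. u p (coord c \<alpha>) * ((\<Sum>\<gamma>\<in>UNIV. w p (coord c \<gamma>) * v p (Gam \<gamma> \<alpha> \<kappa>))
        + (\<Sum>\<beta>\<in>UNIV. conn_form \<alpha> \<beta> p (w p) * conn_form \<beta> \<kappa> p (v p))))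
      - (\<Sum>\<alpha>\<in>UNIV. u p (coord c \<alpha>) * ((\<Sum>\<gamma>\<in>UNIV. v p (coord c \<gamma>) * w p (Gam \<gamma> \<alpha> \<kappa>))
        + (\<Sum>\<beta>\<in>UNIV. conn_form \<alpha> \<beta> p (v p) * conn_form \<beta> \<kappa> p (w p))))"
      unfolding sum_subtractf[symmetric] right_diff_distrib[symmetric] by (simp only: diff_diff_eq)
    show ?thesis
      unfolding second_cov[OF u w v] second_cov[OF u v w] cov_b R by simp
  qed
  show ?thesis
    unfolding curv_def o_map_diff o_map_induced_induced[OF u w v] o_map_induced_induced[OF u v w]
      o_map_induced[OF u W(2) b] key[symmetric]
    by (simp add: left_diff_distrib sum_subtractf)
qed

end

end

section \<open>Orthonormal frames\<close>

text \<open>Pairing with \<open>\<xi> j\<close> reads off the j-th coefficient of a real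
  combination, which gives independence; 2n independent vectors span because 2n is the real
  dimension of \<open>complex^'n\<close>.\<close>

lemma orthonormal_frame_expansion:
  fixes \<xi> :: "'i \<Rightarrow> complex ^ 'n::finite" and B :: "complex ^ 'n \<Rightarrow> complex ^ 'n \<Rightarrow> real"
  assumes card: "card I = 2 * CARD('n)"
    and lin: "\<And>w. linear (\<lambda>v. B v w)"
    and orth: "\<And>i j. i \<in> I \<Longrightarrow> j \<in> I \<Longrightarrow>
      B (\<xi> i) (\<xi> j) = (if i = j then 1 else 0)"
  shows "v = (\<Sum>i\<in>I. B v (\<xi> i) *\<^sub>R \<xi> i)"
proof -
  have fin: "finite I" using card by (intro card_ge_0_finite) simp
  have coeff: "B (\<Sum>i\<in>I. a i *\<^sub>R \<xi> i) (\<xi> j) = a j" if "j \<in> I" for a j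
  proof -
    have "B (\<Sum>i\<in>I. a i *\<^sub>R \<xi> i) (\<xi> j) = (\<Sum>i\<in>I. a i * B (\<xi> i) (\<xi> j))"
      by (simp only: linear_sum[OF lin] linear_scale[OF lin] o_def real_scaleR_def)
    also have "\<dots> = (\<Sum>i\<in>I. if i = j then a i else 0)"
      using orth that by (intro sum.cong) auto
    finally show ?thesis using that fin by simp
  qed
  have inj: "inj_on \<xi> I"
  proof (rule inj_onI)
    fix i j assume ij: "i \<in> I" "j \<in> I" "\<xi> i = \<xi> j"
    then show "i = j" using orth[OF ij(1,2)] orth[OF ij(2,2)] by (auto split: if_splits)
  qed
  have "independent (\<xi> ` I)"
  proof (rule independent_if_scalars_zero)
    fix f y assume f: "(\<Sum>x\<in>\<xi> ` I. f x *\<^sub>R x) = 0" and "y \<in> \<xi> ` I"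
    then obtain j where j: "j \<in> I" "y = \<xi> j" by blast
    have "(\<Sum>i\<in>I. f (\<xi> i) *\<^sub>R \<xi> i) = 0" using f unfolding sum.reindex[OF inj] o_def .
    then have "f (\<xi> j) = B 0 (\<xi> j)" using coeff[OF j(1), of "\<lambda>i. f (\<xi> i)"] by simp
    then show "f y = 0" using j linear_0[OF lin] by simp
  qed (simp add: fin)
  moreover have "card (\<xi> ` I) = DIM(complex ^ 'n)"
    by (simp add: card_image[OF inj] card)
  ultimately have "span (\<xi> ` I) = UNIV"
    using card_ge_dim_independent[of "\<xi> ` I" UNIV] by (auto simp: dim_UNIV)
  then have "v \<in> span (\<xi> ` I)" by simp
  then obtain u where "v = (\<Sum>x\<in>\<xi> ` I. u x *\<^sub>R x)"
    using fin by (auto simp: span_finite)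
  then have v: "v = (\<Sum>i\<in>I. u (\<xi> i) *\<^sub>R \<xi> i)" unfolding sum.reindex[OF inj] o_def .
  then have "B v (\<xi> i) = u (\<xi> i)" if "i \<in> I" for i
    using coeff[OF that, of "\<lambda>i. u (\<xi> i)"] by simp
  then show ?thesis using v by (metis (no_types, lifting) sum.cong)
qed

lemma matrix_inv_right: "invertible M \<Longrightarrow> M ** matrix_inv M = mat 1"
  and matrix_inv_left: "invertible M \<Longrightarrow> matrix_inv M ** M = mat 1"
  for M :: "complex ^ 'n::finite ^ 'n"
  unfolding invertible_def matrix_inv_def by (metis (mono_tags, lifting) someI_ex)+

text \<open>The expansions of \<open>\<zeta>\<close> and of \<open>\<i>\<zeta>\<close> in the frame are added and subtracted.\<close>

lemma unitary_frame_sums: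
  fixes \<xi> :: "'i \<Rightarrow> complex ^ 'n::finite" and M :: "complex ^ 'n ^ 'n"
  assumes card: "card I = 2 * CARD('n)"
    and orth: "\<And>i j. i \<in> I \<Longrightarrow> j \<in> I \<Longrightarrow>
      Re (\<Sum>\<alpha>\<in>UNIV. \<Sum>\<beta>\<in>UNIV. \<xi> i $ \<alpha> * cnj (\<xi> j $ \<beta>) * M $ \<alpha> $ \<beta>) = (if i = j then 1 else 0)"
  shows "invertible M"
    and "(\<Sum>i\<in>I. \<xi> i $ \<gamma> * cnj (\<xi> i $ \<beta>)) = 2 * matrix_inv M $ \<beta> $ \<gamma>"
    and "(\<Sum>i\<in>I. \<xi> i $ \<gamma> * \<xi> i $ \<beta>) = 0"
proof -
  define S where "S v w = (\<Sum>\<alpha>\<in>UNIV. \<Sum>\<beta>\<in>UNIV. v $ \<alpha> * cnj (w $ \<beta>) * M $ \<alpha> $ \<beta>)" for v w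
  have lin: "linear (\<lambda>v. Re (S v w))" for w
    by (rule linearI) (simp_all add: S_def distrib_right sum.distrib sum_distrib_left algebra_simps)
  have "v $ \<gamma> = (\<Sum>i\<in>I. of_real (Re (S v (\<xi> i))) * \<xi> i $ \<gamma>)" for v \<gamma>
    using arg_cong[OF orthonormal_frame_expansion[OF card lin orth[folded S_def], of v], of "\<lambda>x. x $ \<gamma>"]
    by (simp add: scaleR_conv_of_real[where 'a = complex])
  note expand = this
  have S_i: "S (\<i> *s v) w = \<i> * S v w" for v w
    by (simp add: S_def sum_distrib_left mult.assoc)
  have S_axis: "S (axis \<alpha> 1) w = (\<Sum>\<beta>\<in>UNIV. M $ \<alpha> $ \<beta> * cnj (w $ \<beta>))" for \<alpha> w
  proof -
    have "S (axis \<alpha> 1) w = (\<Sum>\<alpha>'\<in>UNIV. (if \<alpha>' = \<alpha> then 1 else 0) * (\<Sum>\<beta>\<in>UNIV. M $ \<alpha>' $ \<beta> * cnj (w $ \<beta>)))"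
      by (simp add: S_def axis_def sum_distrib_left mult_ac)
    then show ?thesis by (simp only: sum_mult_if_delta)
  qed
  \<comment> \<open>Dividing the expansion of \<i> times \<open>v\<close> by \<i> gives a second
    expansion of \<open>v\<close>, with \<i> Im S in place of Re S. Adding the two produces S and
    the factor 2; subtracting produces the conjugate of S and 0.\<close>
  have two: "2 * v $ \<gamma> = (\<Sum>i\<in>I. S v (\<xi> i) * \<xi> i $ \<gamma>)" "0 = (\<Sum>i\<in>I. cnj (S v (\<xi> i)) * \<xi> i $ \<gamma>)" for v \<gamma>
  proof -
    have "\<i> * v $ \<gamma> = (\<Sum>i\<in>I. of_real (Re (\<i> * S v (\<xi> i))) * \<xi> i $ \<gamma>)"
      using expand[of "\<i> *s v" \<gamma>] by (simp only: S_i vector_smult_component)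
    then have "- \<i> * (\<i> * v $ \<gamma>) = (\<Sum>i\<in>I. - \<i> * (of_real (Re (\<i> * S v (\<xi> i))) * \<xi> i $ \<gamma>))"
      by (simp only: sum_distrib_left)
    then have i: "v $ \<gamma> = (\<Sum>i\<in>I. \<i> * of_real (Im (S v (\<xi> i))) * \<xi> i $ \<gamma>)"
      by (simp add: mult.assoc)
    have "2 * v $ \<gamma> = v $ \<gamma> + v $ \<gamma>" by simp
    also have "\<dots> = (\<Sum>i\<in>I. of_real (Re (S v (\<xi> i))) * \<xi> i $ \<gamma>) + (\<Sum>i\<in>I. \<i> * of_real (Im (S v (\<xi> i))) * \<xi> i $ \<gamma>)"
      using expand[of v \<gamma>] i by simp
    also have "\<dots> = (\<Sum>i\<in>I. S v (\<xi> i) * \<xi> i $ \<gamma>)"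
      unfolding sum.distrib[symmetric] distrib_right[symmetric] by (simp add: complex_eq[symmetric])
    finally show "2 * v $ \<gamma> = (\<Sum>i\<in>I. S v (\<xi> i) * \<xi> i $ \<gamma>)" .
    have "0 = v $ \<gamma> - v $ \<gamma>" by simp
    also have "\<dots> = (\<Sum>i\<in>I. of_real (Re (S v (\<xi> i))) * \<xi> i $ \<gamma>) - (\<Sum>i\<in>I. \<i> * of_real (Im (S v (\<xi> i))) * \<xi> i $ \<gamma>)"
      using expand[of v \<gamma>] i by simp
    also have "\<dots> = (\<Sum>i\<in>I. cnj (S v (\<xi> i)) * \<xi> i $ \<gamma>)"
      unfolding sum_subtractf[symmetric] left_diff_distrib[symmetric]
      by (intro sum.cong arg_cong2[of _ _ _ _ times]) (auto simp: complex_eq_iff)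
    finally show "0 = (\<Sum>i\<in>I. cnj (S v (\<xi> i)) * \<xi> i $ \<gamma>)" .
  qed
  \<comment> \<open>The candidate inverse of \<open>M\<close>; the division by 2 absorbs the doubled
    expansion \<open>two(1)\<close>, which at coordinate vectors says that \<open>X\<close> is a
    right inverse.\<close>
  define X where "X = (\<chi> \<beta> \<gamma>. (\<Sum>i\<in>I. \<xi> i $ \<gamma> * cnj (\<xi> i $ \<beta>)) / 2)"
  have "(M ** X) $ \<alpha> $ \<gamma> = mat 1 $ \<alpha> $ \<gamma>" for \<alpha> \<gamma>
  proof -
    have "2 * (M ** X) $ \<alpha> $ \<gamma> = (\<Sum>\<beta>\<in>UNIV. \<Sum>i\<in>I. M $ \<alpha> $ \<beta> * cnj (\<xi> i $ \<beta>) * \<xi> i $ \<gamma>)"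
    proof -
      have "2 * (M ** X) $ \<alpha> $ \<gamma> = (\<Sum>\<beta>\<in>UNIV. M $ \<alpha> $ \<beta> * (2 * X $ \<beta> $ \<gamma>))"
        by (simp add: matrix_matrix_mult_def sum_distrib_left mult.left_commute)
      moreover have "2 * X $ \<beta> $ \<gamma> = (\<Sum>i\<in>I. \<xi> i $ \<gamma> * cnj (\<xi> i $ \<beta>))" for \<beta>
        by (simp add: X_def)
      ultimately show ?thesis by (simp only: sum_distrib_left mult_ac)
    qed
    also have "\<dots> = (\<Sum>i\<in>I. S (axis \<alpha> 1) (\<xi> i) * \<xi> i $ \<gamma>)"
      by (subst sum.swap) (simp only: S_axis sum_distrib_right)
    also have "\<dots> = 2 * axis \<alpha> 1 $ \<gamma>" by (rule two(1)[symmetric])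
    finally show ?thesis by (simp add: mat_def axis_def)
  qed
  then have MX: "M ** X = mat 1" by (simp add: vec_eq_iff)
  then show inv: "invertible M" using invertible_right_inverse by blast
  have "matrix_inv M = X"
    using MX matrix_inv_left[OF inv] by (metis matrix_mul_assoc matrix_mul_lid matrix_mul_rid)
  then show "(\<Sum>i\<in>I. \<xi> i $ \<gamma> * cnj (\<xi> i $ \<beta>)) = 2 * matrix_inv M $ \<beta> $ \<gamma>"
    by (simp add: X_def)
  \<comment> \<open>Conjugated because \<open>M\<close> pairs with conjugated components:
    \<open>two(2)\<close> at coordinate vectors then states that \<open>M\<close> annihilates
    \<open>y\<close>.\<close>
  define y where "y = (\<chi> \<beta>. cnj (\<Sum>i\<in>I. \<xi> i $ \<gamma> * \<xi> i $ \<beta>))"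
  have "(M *v y) $ \<alpha> = 0 $ \<alpha>" for \<alpha>
  proof -
    have "(M *v y) $ \<alpha> = (\<Sum>\<beta>\<in>UNIV. \<Sum>i\<in>I. M $ \<alpha> $ \<beta> * cnj (\<xi> i $ \<beta>) * cnj (\<xi> i $ \<gamma>))"
      by (simp add: matrix_vector_mult_def y_def sum_distrib_left mult_ac)
    also have "\<dots> = (\<Sum>i\<in>I. S (axis \<alpha> 1) (\<xi> i) * cnj (\<xi> i $ \<gamma>))"
      by (subst sum.swap) (simp only: S_axis sum_distrib_right)
    also have "\<dots> = cnj (\<Sum>i\<in>I. cnj (S (axis \<alpha> 1) (\<xi> i)) * \<xi> i $ \<gamma>)"
      by simp
    also have "\<dots> = 0" unfolding two(2)[symmetric] by simp
    finally show ?thesis by simp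
  qed
  then have "M *v y = 0" by (simp add: vec_eq_iff)
  then have "y = 0"
    using matrix_inv_left[OF inv] by (metis matrix_vector_mul_assoc matrix_vector_mul_lid matrix_vector_mult_0_right)
  then have "y $ \<beta> = 0" by simp
  then show "(\<Sum>i\<in>I. \<xi> i $ \<gamma> * \<xi> i $ \<beta>) = 0" by (simp add: y_def del: cnj_sum)
qed

text \<open>The sum over \<open>j\<close> kills every term that contains two unconjugated factors \<open>x j\<close>; only one
  of the two terms of type (1,1) survives.\<close>

lemma frame_contraction:
  fixes x :: "nat \<Rightarrow> 'n::finite \<Rightarrow> complex" and N K :: "'n \<Rightarrow> 'n \<Rightarrow> complex" and I :: "nat set"
    and G :: "'n \<Rightarrow> 'n \<Rightarrow> 'n \<Rightarrow> complex" and Gd Gb :: "'n \<Rightarrow> 'n \<Rightarrow> 'n \<Rightarrow> 'n \<Rightarrow> complex"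
  assumes xx: "\<And>\<alpha> \<beta>. (\<Sum>j\<in>I. x j \<alpha> * x j \<beta>) = 0"
    and xcx: "\<And>\<alpha> \<beta>. (\<Sum>j\<in>I. x j \<alpha> * cnj (x j \<beta>)) = 2 * N \<beta> \<alpha>"
  defines "E \<equiv> \<lambda>i \<gamma> \<alpha> \<kappa>. \<Sum>\<delta>\<in>UNIV. x i \<delta> * Gd \<delta> \<gamma> \<alpha> \<kappa> + cnj (x i \<delta>) * Gb \<delta> \<gamma> \<alpha> \<kappa>"
    and "\<theta> \<equiv> \<lambda>i \<alpha> \<kappa>. \<Sum>\<gamma>\<in>UNIV. x i \<gamma> * G \<gamma> \<alpha> \<kappa>"
  shows "(\<Sum>i\<in>I. \<Sum>j\<in>I. \<Sum>\<kappa>\<in>UNIV. \<Sum>\<beta>\<in>UNIV.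
      (\<Sum>\<alpha>\<in>UNIV. x j \<alpha> * ((\<Sum>\<gamma>\<in>UNIV. x j \<gamma> * E i \<gamma> \<alpha> \<kappa>) + (\<Sum>\<beta>\<in>UNIV. \<theta> j \<alpha> \<beta> * \<theta> i \<beta> \<kappa>)
        - (\<Sum>\<gamma>\<in>UNIV. x i \<gamma> * E j \<gamma> \<alpha> \<kappa>) - (\<Sum>\<beta>\<in>UNIV. \<theta> i \<alpha> \<beta> * \<theta> j \<beta> \<kappa>))) * cnj (x i \<beta>) * K \<kappa> \<beta>)
    = 4 * (\<Sum>\<alpha>\<in>UNIV. \<Sum>\<beta>\<in>UNIV. \<Sum>\<gamma>\<in>UNIV. \<Sum>\<delta>\<in>UNIV.
        N \<delta> \<alpha> * N \<beta> \<gamma> * (- (\<Sum>\<kappa>\<in>UNIV. Gb \<delta> \<gamma> \<alpha> \<kappa> * K \<kappa> \<beta>)))"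
proof -
  \<comment> \<open>\<open>F\<close> may depend on anything but \<open>j\<close>, so this one
    identity disposes of every term with two unconjugated factors.\<close>
  have z: "(\<Sum>j\<in>I. \<Sum>\<alpha>\<in>UNIV. x j \<alpha> * (\<Sum>\<gamma>\<in>UNIV. x j \<gamma> * F \<gamma> \<alpha>)) = 0" for F
  proof -
    have "(\<Sum>j\<in>I. \<Sum>\<alpha>\<in>UNIV. x j \<alpha> * (\<Sum>\<gamma>\<in>UNIV. x j \<gamma> * F \<gamma> \<alpha>)) =
        (\<Sum>\<alpha>\<in>UNIV. \<Sum>\<gamma>\<in>UNIV. (\<Sum>j\<in>I. x j \<alpha> * x j \<gamma>) * F \<gamma> \<alpha>)"
      unfolding sum_distrib_left sum_distrib_right mult.assoc
      by (subst sum.swap, rule sum.cong[OF refl], rule sum.swap)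
    then show ?thesis by (simp add: xx)
  qed
  have n: "(\<Sum>j\<in>I. \<Sum>\<alpha>\<in>UNIV. x j \<alpha> * (\<Sum>\<delta>\<in>UNIV. cnj (x j \<delta>) * F \<delta> \<alpha>)) =
      (\<Sum>\<alpha>\<in>UNIV. \<Sum>\<delta>\<in>UNIV. 2 * N \<delta> \<alpha> * F \<delta> \<alpha>)" for F
    unfolding xcx[symmetric] sum_distrib_left sum_distrib_right mult.assoc
    by (subst sum.swap, rule sum.cong[OF refl], rule sum.swap)
  have sum_j: "(\<Sum>j\<in>I. \<Sum>\<alpha>\<in>UNIV. x j \<alpha> * ((\<Sum>\<gamma>\<in>UNIV. x j \<gamma> * E i \<gamma> \<alpha> \<kappa>) + (\<Sum>\<beta>\<in>UNIV. \<theta> j \<alpha> \<beta> * \<theta> i \<beta> \<kappa>)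
        - (\<Sum>\<gamma>\<in>UNIV. x i \<gamma> * E j \<gamma> \<alpha> \<kappa>) - (\<Sum>\<beta>\<in>UNIV. \<theta> i \<alpha> \<beta> * \<theta> j \<beta> \<kappa>))) =
      - (\<Sum>\<alpha>\<in>UNIV. \<Sum>\<delta>\<in>UNIV. 2 * N \<delta> \<alpha> * (\<Sum>\<gamma>\<in>UNIV. x i \<gamma> * Gb \<delta> \<gamma> \<alpha> \<kappa>))" for i \<kappa>
  proof -
    \<comment> \<open>Facts \<open>2\<close>, \<open>3\<close> and \<open>4\<close> isolate the
      second factor indexed by \<open>j\<close> in their terms; the first term shows it already.
      Then \<open>z\<close> removes everything except the \<open>Gb\<close> half of
      \<open>3\<close>, which \<open>n\<close> contracts.\<close>
    have th: "\<theta> j \<alpha> \<beta> = (\<Sum>\<gamma>\<in>UNIV. x j \<gamma> * G \<gamma> \<alpha> \<beta>)" for j \<alpha> \<beta>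
      unfolding \<theta>_def ..
    have 2: "(\<Sum>\<beta>\<in>UNIV. \<theta> j \<alpha> \<beta> * \<theta> i \<beta> \<kappa>) = (\<Sum>\<gamma>\<in>UNIV. x j \<gamma> * (\<Sum>\<beta>\<in>UNIV. G \<gamma> \<alpha> \<beta> * \<theta> i \<beta> \<kappa>))" for j \<alpha>
      unfolding th[of j] sum_distrib_left sum_distrib_right mult.assoc
      by (rule sum.swap)
    have 4: "(\<Sum>\<beta>\<in>UNIV. \<theta> i \<alpha> \<beta> * \<theta> j \<beta> \<kappa>) = (\<Sum>\<gamma>\<in>UNIV. x j \<gamma> * (\<Sum>\<beta>\<in>UNIV. \<theta> i \<alpha> \<beta> * G \<gamma> \<beta> \<kappa>))" for j \<alpha>
      unfolding th[of j] sum_distrib_left mult.left_commute[of "x j _"]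
      by (rule sum.swap)
    have 3: "(\<Sum>\<gamma>\<in>UNIV. x i \<gamma> * E j \<gamma> \<alpha> \<kappa>) = (\<Sum>\<delta>\<in>UNIV. x j \<delta> * (\<Sum>\<gamma>\<in>UNIV. x i \<gamma> * Gd \<delta> \<gamma> \<alpha> \<kappa>))
        + (\<Sum>\<delta>\<in>UNIV. cnj (x j \<delta>) * (\<Sum>\<gamma>\<in>UNIV. x i \<gamma> * Gb \<delta> \<gamma> \<alpha> \<kappa>))" for j \<alpha>
      unfolding E_def sum_distrib_left sum.distrib[symmetric]
      by (subst sum.swap) (simp add: algebra_simps)
    show ?thesis
      unfolding 2 4 3 distrib_left right_diff_distrib sum.distrib sum_subtractf z n by simp
  qed
  \<comment> \<open>The factors after \<open>T\<close> are free of \<open>j\<close>, so the inner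
    frame sum can be carried out on the curvature components alone, before the pairing with the
    vector indexed by \<open>i\<close>.\<close>
  have "(\<Sum>i\<in>I. \<Sum>j\<in>I. \<Sum>\<kappa>\<in>UNIV. \<Sum>\<beta>\<in>UNIV. T i j \<kappa> * cnj (x i \<beta>) * K \<kappa> \<beta>) =
      (\<Sum>i\<in>I. \<Sum>\<kappa>\<in>UNIV. \<Sum>\<beta>\<in>UNIV. (\<Sum>j\<in>I. T i j \<kappa>) * cnj (x i \<beta>) * K \<kappa> \<beta>)" for T
    unfolding sum_distrib_right
    by (rule sum.cong[OF refl], subst sum.swap, rule sum.cong[OF refl], rule sum.swap)
  note pull = this
  have push: "(\<Sum>i\<in>I. \<Sum>\<kappa>\<in>UNIV. \<Sum>\<beta>\<in>UNIV. - (\<Sum>\<alpha>\<in>UNIV. \<Sum>\<delta>\<in>UNIV. 2 * N \<delta> \<alpha> * (\<Sum>\<gamma>\<in>UNIV. x i \<gamma> * Gb \<delta> \<gamma> \<alpha> \<kappa>)) * cnj (x i \<beta>) * K \<kappa> \<beta>)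
     = (\<Sum>\<kappa>\<in>UNIV. \<Sum>\<beta>\<in>UNIV. \<Sum>\<alpha>\<in>UNIV. \<Sum>\<delta>\<in>UNIV. \<Sum>\<gamma>\<in>UNIV. - 2 * N \<delta> \<alpha> * (\<Sum>i\<in>I. x i \<gamma> * cnj (x i \<beta>)) * Gb \<delta> \<gamma> \<alpha> \<kappa> * K \<kappa> \<beta>)"
  proof -
    have "(\<Sum>i\<in>I. \<Sum>\<kappa>\<in>UNIV. \<Sum>\<beta>\<in>UNIV. - (\<Sum>\<alpha>\<in>UNIV. \<Sum>\<delta>\<in>UNIV. 2 * N \<delta> \<alpha> * (\<Sum>\<gamma>\<in>UNIV. x i \<gamma> * Gb \<delta> \<gamma> \<alpha> \<kappa>)) * cnj (x i \<beta>) * K \<kappa> \<beta>)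
      = (\<Sum>i\<in>I. \<Sum>\<kappa>\<in>UNIV. \<Sum>\<beta>\<in>UNIV. \<Sum>\<alpha>\<in>UNIV. \<Sum>\<delta>\<in>UNIV. \<Sum>\<gamma>\<in>UNIV. - 2 * N \<delta> \<alpha> * (x i \<gamma> * cnj (x i \<beta>)) * Gb \<delta> \<gamma> \<alpha> \<kappa> * K \<kappa> \<beta>)"
      by (simp add: sum_distrib_left sum_distrib_right sum_negf mult_ac)
    also have "\<dots> = (\<Sum>\<kappa>\<in>UNIV. \<Sum>\<beta>\<in>UNIV. \<Sum>\<alpha>\<in>UNIV. \<Sum>\<delta>\<in>UNIV. \<Sum>\<gamma>\<in>UNIV. \<Sum>i\<in>I. - 2 * N \<delta> \<alpha> * (x i \<gamma> * cnj (x i \<beta>)) * Gb \<delta> \<gamma> \<alpha> \<kappa> * K \<kappa> \<beta>)"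
      by (subst sum.swap, rule sum.cong[OF refl], subst sum.swap, rule sum.cong[OF refl], subst sum.swap,
          rule sum.cong[OF refl], subst sum.swap, rule sum.cong[OF refl], rule sum.swap)
    finally show ?thesis unfolding sum_distrib_left sum_distrib_right .
  qed
  have "(\<Sum>\<kappa>\<in>UNIV. \<Sum>\<beta>\<in>UNIV. \<Sum>\<alpha>\<in>UNIV. \<Sum>\<delta>\<in>UNIV. \<Sum>\<gamma>\<in>UNIV. - 2 * N \<delta> \<alpha> * (2 * N \<beta> \<gamma>) * Gb \<delta> \<gamma> \<alpha> \<kappa> * K \<kappa> \<beta>) =
     (\<Sum>\<beta>\<in>UNIV. \<Sum>\<alpha>\<in>UNIV. \<Sum>\<delta>\<in>UNIV. \<Sum>\<gamma>\<in>UNIV. \<Sum>\<kappa>\<in>UNIV. - 2 * N \<delta> \<alpha> * (2 * N \<beta> \<gamma>) * Gb \<delta> \<gamma> \<alpha> \<kappa> * K \<kappa> \<beta>)"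
    by (subst sum.swap, rule sum.cong[OF refl], subst sum.swap, rule sum.cong[OF refl], subst sum.swap,
        rule sum.cong[OF refl], rule sum.swap)
  also have "\<dots> = (\<Sum>\<alpha>\<in>UNIV. \<Sum>\<beta>\<in>UNIV. \<Sum>\<gamma>\<in>UNIV. \<Sum>\<delta>\<in>UNIV. \<Sum>\<kappa>\<in>UNIV. - 2 * N \<delta> \<alpha> * (2 * N \<beta> \<gamma>) * Gb \<delta> \<gamma> \<alpha> \<kappa> * K \<kappa> \<beta>)"
    by (subst sum.swap, rule sum.cong[OF refl], rule sum.cong[OF refl], rule sum.swap)
  also have "\<dots> = 4 * (\<Sum>\<alpha>\<in>UNIV. \<Sum>\<beta>\<in>UNIV. \<Sum>\<gamma>\<in>UNIV. \<Sum>\<delta>\<in>UNIV.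
        N \<delta> \<alpha> * N \<beta> \<gamma> * (- (\<Sum>\<kappa>\<in>UNIV. Gb \<delta> \<gamma> \<alpha> \<kappa> * K \<kappa> \<beta>)))"
    by (simp add: sum_distrib_left sum_negf mult_ac)
  finally show ?thesis unfolding pull sum_j push xcx .
qed

section \<open>The scalar curvatures\<close>

context chern_chart
begin

section \<open>The Chern curvature through Christoffel symbols\<close>

lemma wirt_chart:
  assumes "p \<in> fst c" "smooth_near A p f"
  shows "wirt \<gamma> (\<lambda>x. f (chart_inv c x)) (snd c p) = dz A c \<gamma> p f"
    and "wirt_bar \<gamma> (\<lambda>x. f (chart_inv c x)) (snd c p) = dzb A c \<gamma> p f"
  using assms by (simp_all add: wirt_def wirt_bar_def dz_def dzb_def dx_eq_dchart dy_eq_dchart dchart_def)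

lemma h_mat_H: "h_mat A h c x $ \<alpha> $ \<beta> = H \<alpha> \<beta> (chart_inv c x)"
  by (simp add: h_mat_def H_def Let_def)

lemma near_c: "p \<in> fst c \<Longrightarrow> smooth_fun A (fst c) f \<Longrightarrow> smooth_near A p f"
  using smooth_nearI[OF open_c] .

lemma smooth_dz_H: "smooth_fun A (fst c) (\<lambda>q. dz A c \<gamma> q (H \<alpha> \<beta>))"
  and smooth_dzb_H: "smooth_fun A (fst c) (\<lambda>q. dzb A c \<gamma> q (H \<alpha> \<beta>))"
  by (rule smooth_fun_dz[OF c open_c order.refl smooth_H] smooth_fun_dzb[OF c open_c order.refl smooth_H])+

text \<open>The inner Wirtinger derivative equals the pulled-back \<open>dzb\<close> only on the
  chart image; openness of that image allows the replacement under the outer derivative.\<close>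

lemma wirt_wirt_bar_h_mat:
  assumes p: "p \<in> fst c"
  shows "wirt \<gamma> (wirt_bar \<delta> (\<lambda>y. h_mat A h c y $ \<alpha> $ \<beta>)) (snd c p) = dz A c \<gamma> p (\<lambda>q. dzb A c \<delta> q (H \<alpha> \<beta>))"
proof -
  let ?f = "\<lambda>q. dzb A c \<delta> q (H \<alpha> \<beta>)"
  note near = near_c[OF p smooth_dzb_H, of \<delta> \<alpha> \<beta>]
  have S: "open (snd c ` fst c)" "snd c p \<in> snd c ` fst c"
    using open_image[OF c open_UNIV] p by auto
  have "wirt_bar \<delta> (\<lambda>y. h_mat A h c y $ \<alpha> $ \<beta>) (snd c q) = ?f (chart_inv c (snd c q))" if "q \<in> fst c" for q
    unfolding h_mat_H wirt_chart(2)[OF that near_c[OF that smooth_H]] using that c by simp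
  then have "frechet_derivative (\<lambda>x. ?f (chart_inv c x)) (at (snd c p)) =
      frechet_derivative (wirt_bar \<delta> (\<lambda>y. h_mat A h c y $ \<alpha> $ \<beta>)) (at (snd c p))"
    by (intro frechet_derivative_transform_within_open[OF smooth_near_differentiable[OF near c p] S]) auto
  then have "wirt \<gamma> (wirt_bar \<delta> (\<lambda>y. h_mat A h c y $ \<alpha> $ \<beta>)) (snd c p) = wirt \<gamma> (\<lambda>x. ?f (chart_inv c x)) (snd c p)"
    unfolding wirt_def by simp
  then show ?thesis unfolding wirt_chart(1)[OF p near] .
qed

lemma chern_R_eq:
  assumes p: "p \<in> fst c"
  shows "chern_R A h c \<alpha> \<beta> \<gamma> \<delta> (snd c p) = - dz A c \<gamma> p (\<lambda>q. dzb A c \<delta> q (H \<alpha> \<beta>))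
     + (\<Sum>l\<in>UNIV. \<Sum>k\<in>UNIV. dz A c \<gamma> p (H \<alpha> l) * matrix_inv (h_mat A h c (snd c p)) $ l $ k * dzb A c \<delta> p (H k \<beta>))"
  unfolding chern_R_def wirt_wirt_bar_h_mat[OF p] unfolding h_mat_H[abs_def] wirt_chart[OF p near_c[OF p smooth_H]] ..

text \<open>After exchanging the derivatives, \<open>dzb\<close> is applied to \<open>dz_H\<close>.
  The product rule gives the asserted sum and a term with the symbols undifferentiated; the latter
  is the quadratic term of \<open>chern_R\<close>, since multiplying \<open>dz_H\<close> by the
  inverse metric recovers \<open>Gam\<close>.\<close>

lemma chern_R_Gam:
  assumes p: "p \<in> fst c" and inv: "invertible (h_mat A h c (snd c p))"
  shows "chern_R A h c \<alpha> \<beta> \<gamma> \<delta> (snd c p) = - (\<Sum>\<kappa>\<in>UNIV. dzb A c \<delta> p (Gam \<gamma> \<alpha> \<kappa>) * H \<kappa> \<beta> p)"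
proof -
  let ?M = "h_mat A h c (snd c p)"
  have M: "?M $ \<kappa> $ l = H \<kappa> l p" for \<kappa> l using p c by (simp add: h_mat_H)
  have Gam: "(\<Sum>l\<in>UNIV. dz A c \<gamma> p (H \<alpha> l) * matrix_inv ?M $ l $ k) = Gam \<gamma> \<alpha> k p" for k
  proof -
    have "(\<Sum>l\<in>UNIV. dz A c \<gamma> p (H \<alpha> l) * matrix_inv ?M $ l $ k) =
        (\<Sum>l\<in>UNIV. \<Sum>\<kappa>\<in>UNIV. Gam \<gamma> \<alpha> \<kappa> p * (?M $ \<kappa> $ l * matrix_inv ?M $ l $ k))"
      unfolding dz_H[OF p] M by (simp only: sum_distrib_right mult.assoc)
    also have "\<dots> = (\<Sum>\<kappa>\<in>UNIV. Gam \<gamma> \<alpha> \<kappa> p * (?M ** matrix_inv ?M) $ \<kappa> $ k)"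
      by (subst sum.swap) (simp add: matrix_matrix_mult_def sum_distrib_left)
    also have "\<dots> = Gam \<gamma> \<alpha> k p"
      unfolding matrix_inv_right[OF inv] mat_def by (simp add: sum_mult_if_delta)
    finally show ?thesis .
  qed
  have cp: "dzb A c \<delta> p \<in> ctangent A p" by (rule dzb_in_ctangent[OF c p])
  note nG = near_c[OF p smooth_Gam] and nH = near_c[OF p smooth_H]
  have "dz A c \<gamma> p (\<lambda>q. dzb A c \<delta> q (H \<alpha> \<beta>)) = dzb A c \<delta> p (\<lambda>q. dz A c \<gamma> q (H \<alpha> \<beta>))"
    by (rule dz_dzb_commute[OF c open_c order.refl p smooth_H])
  also have "\<dots> = dzb A c \<delta> p (\<lambda>q. \<Sum>\<kappa>\<in>UNIV. Gam \<gamma> \<alpha> \<kappa> q * H \<kappa> \<beta> q)"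
    by (rule tangent_cong[OF cp open_c p dz_H])
  also have "\<dots> = (\<Sum>\<kappa>\<in>UNIV. dzb A c \<delta> p (Gam \<gamma> \<alpha> \<kappa>) * H \<kappa> \<beta> p) + (\<Sum>\<kappa>\<in>UNIV. Gam \<gamma> \<alpha> \<kappa> p * dzb A c \<delta> p (H \<kappa> \<beta>))"
    by (simp only: tangent_sum[OF cp smooth_near_mult[OF nG nH]] tangent_mult[OF cp nG nH] sum.distrib)
  finally have "dz A c \<gamma> p (\<lambda>q. dzb A c \<delta> q (H \<alpha> \<beta>)) = \<dots>" .
  moreover have "(\<Sum>l\<in>UNIV. \<Sum>k\<in>UNIV. dz A c \<gamma> p (H \<alpha> l) * matrix_inv ?M $ l $ k * dzb A c \<delta> p (H k \<beta>)) =
      (\<Sum>k\<in>UNIV. Gam \<gamma> \<alpha> k p * dzb A c \<delta> p (H k \<beta>))"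
    unfolding Gam[symmetric] sum_distrib_right by (rule sum.swap)
  ultimately show ?thesis unfolding chern_R_eq[OF p] by simp
qed

text \<open>Conjugation exchanges \<open>dz\<close> with \<open>dzb\<close> and transposes
  \<open>H\<close>; in the second-order term the order of derivatives has to be restored as well.
  The hypothesis on the inverse matrix is met later through the frame sums.\<close>

lemma chern_R_cnj:
  assumes p: "p \<in> fst c"
    and inv: "\<And>l k. cnj (matrix_inv (h_mat A h c (snd c p)) $ l $ k) = matrix_inv (h_mat A h c (snd c p)) $ k $ l"
  shows "cnj (chern_R A h c \<alpha> \<beta> \<gamma> \<delta> (snd c p)) = chern_R A h c \<beta> \<alpha> \<delta> \<gamma> (snd c p)"
proof -
  have H: "(\<lambda>q. cnj (H \<alpha> \<beta> q)) q = H \<beta> \<alpha> q" if "q \<in> fst c" for \<alpha> \<beta> q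
    using H_cnj[OF that, of \<beta> \<alpha>] by simp
  have dz: "cnj (dz A c \<gamma> q (H \<alpha> \<beta>)) = dzb A c \<gamma> q (H \<beta> \<alpha>)"
    and dzb: "cnj (dzb A c \<gamma> q (H \<alpha> \<beta>)) = dz A c \<gamma> q (H \<beta> \<alpha>)" if q: "q \<in> fst c" for \<gamma> q \<alpha> \<beta>
    unfolding dz_cnj[OF c q, symmetric] dzb_cnj[OF c q, symmetric]
    by (rule tangent_cong[OF dzb_in_ctangent[OF c q] open_c q H], assumption)
      (rule tangent_cong[OF dz_in_ctangent[OF c q] open_c q H])
  have "cnj (dz A c \<gamma> p (\<lambda>q. dzb A c \<delta> q (H \<alpha> \<beta>))) = dzb A c \<gamma> p (\<lambda>q. cnj (dzb A c \<delta> q (H \<alpha> \<beta>)))"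
    by (rule dzb_cnj[OF c p, symmetric])
  also have "\<dots> = dzb A c \<gamma> p (\<lambda>q. dz A c \<delta> q (H \<beta> \<alpha>))"
    by (rule tangent_cong[OF dzb_in_ctangent[OF c p] open_c p dzb])
  also have "\<dots> = dz A c \<delta> p (\<lambda>q. dzb A c \<gamma> q (H \<beta> \<alpha>))"
    by (rule dz_dzb_commute[OF c open_c order.refl p smooth_H, symmetric])
  finally have 1: "cnj (dz A c \<gamma> p (\<lambda>q. dzb A c \<delta> q (H \<alpha> \<beta>))) = dz A c \<delta> p (\<lambda>q. dzb A c \<gamma> q (H \<beta> \<alpha>))" .
  show ?thesis
    unfolding chern_R_eq[OF p] complex_cnj_add complex_cnj_minus cnj_sum complex_cnj_mult 1 dz[OF p] dzb[OF p] inv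
    by (subst sum.swap) (simp only: mult_ac)
qed

text \<open>Formulated through the \<open>o_map\<close> images because the curvature vector is known
  only in that form.\<close>

lemma riem_components:
  assumes q: "q \<in> fst c" and X: "o_map A q X = (\<lambda>f. \<Sum>\<alpha>\<in>UNIV. a \<alpha> * dz A c \<alpha> q f)"
    and Y: "o_map A q Y = (\<lambda>f. \<Sum>\<alpha>\<in>UNIV. b \<alpha> * dz A c \<alpha> q f)"
  shows "riem A h q X Y = Re (\<Sum>\<alpha>\<in>UNIV. \<Sum>\<beta>\<in>UNIV. a \<alpha> * cnj (b \<beta>) * H \<alpha> \<beta> q)"
proof -
  note T = dz_T10[OF c q]
  have "(\<lambda>f. \<Sum>\<alpha>\<in>UNIV. b \<alpha> * dz A c \<alpha> q f) \<in> T10 A q" by (intro T10_sum T)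
  then show ?thesis
    unfolding riem_def X Y
    by (simp add: h_sum_left[OF T] h_sum_right[OF T T] H_def sum_distrib_left mult.assoc)
qed

lemma scalar_curv_eq_second_chern_scalar:
  assumes U: "open U" "p \<in> U" and e: "orthonormal_frame A h U e" and p: "p \<in> fst c"
  shows "complex_of_real (scalar_curv A h (induced A D) e p) = 4 * second_chern_scalar A h c p"
proof -
  \<comment> \<open>The frame lives on \<open>U\<close> and the coordinates on the domain of
    \<open>c\<close>; all fields are restricted to the overlap.\<close>
  define W where "W = U \<inter> fst c"
  have W: "open W" "p \<in> W" "W \<subseteq> fst c" using U p open_c by (auto simp: W_def)
  let ?I = "{1..2 * CARD('n)}"
  let ?M = "h_mat A h c (snd c p)"
  define N where "N \<beta> \<alpha> = matrix_inv ?M $ \<beta> $ \<alpha>" for \<beta> \<alpha>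
  define R where "R \<alpha> \<beta> \<gamma> \<delta> = chern_R A h c \<alpha> \<beta> \<gamma> \<delta> (snd c p)" for \<alpha> \<beta> \<gamma> \<delta>
  have M: "?M $ \<alpha> $ \<beta> = H \<alpha> \<beta> p" for \<alpha> \<beta> using p c by (simp add: h_mat_H)
  have rf: "real_field A W (e i)" if "i \<in> ?I" for i
    using e that smooth_field_mono[of U "e i" W] unfolding orthonormal_frame_def real_field_def W_def by blast
  have ct: "e i p \<in> ctangent A p" if "i \<in> ?I" for i
    using field_ctangent[OF W rf[OF that] W(2)] .
  define x where "x i \<alpha> = e i p (coord c \<alpha>)" for i \<alpha>
  have o: "o_map A p (e i p) = (\<lambda>f. \<Sum>\<alpha>\<in>UNIV. x i \<alpha> * dz A c \<alpha> p f)" if "i \<in> ?I" for i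
    unfolding x_def using o_map_expand[OF ct[OF that] c p] by (rule ext)
  have orth: "Re (\<Sum>\<alpha>\<in>UNIV. \<Sum>\<beta>\<in>UNIV. (\<chi> \<alpha>. x i \<alpha>) $ \<alpha> * cnj ((\<chi> \<alpha>. x j \<alpha>) $ \<beta>) * ?M $ \<alpha> $ \<beta>) = (if i = j then 1 else 0)"
    if "i \<in> ?I" "j \<in> ?I" for i j
    using e that U riem_components[OF p o o] unfolding orthonormal_frame_def M by simp
  have card: "card ?I = 2 * CARD('n)" by simp
  note frame = unitary_frame_sums[where \<xi> = "\<lambda>i. \<chi> \<alpha>. x i \<alpha>" and M = ?M, OF card orth]
  have inv: "invertible ?M" by (rule frame(1))
  have xcx: "(\<Sum>i\<in>?I. x i \<gamma> * cnj (x i \<beta>)) = 2 * N \<beta> \<gamma>" for \<beta> \<gamma>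
    using frame(2)[of \<gamma> \<beta>] by (simp add: N_def)
  have xx: "(\<Sum>i\<in>?I. x i \<gamma> * x i \<beta>) = 0" for \<beta> \<gamma>
    using frame(3)[of \<gamma> \<beta>] by simp
  \<comment> \<open>Hermitian symmetry of the inverse is visible in the frame sum: conjugation
    exchanges its two factors.\<close>
  have N_cnj: "cnj (N \<beta> \<gamma>) = N \<gamma> \<beta>" for \<beta> \<gamma>
  proof -
    have "2 * cnj (N \<beta> \<gamma>) = cnj (\<Sum>i\<in>?I. x i \<gamma> * cnj (x i \<beta>))" unfolding xcx by simp
    also have "\<dots> = (\<Sum>i\<in>?I. x i \<beta> * cnj (x i \<gamma>))" by (simp add: mult.commute)
    finally show ?thesis unfolding xcx by simp
  qed
  have R_cnj: "cnj (R \<alpha> \<beta> \<gamma> \<delta>) = R \<beta> \<alpha> \<delta> \<gamma>" for \<alpha> \<beta> \<gamma> \<delta>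
    unfolding R_def by (rule chern_R_cnj[OF p]) (use N_cnj in \<open>simp add: N_def\<close>)
  have s2: "second_chern_scalar A h c p = (\<Sum>\<alpha>\<in>UNIV. \<Sum>\<beta>\<in>UNIV. \<Sum>\<gamma>\<in>UNIV. \<Sum>\<delta>\<in>UNIV. N \<beta> \<alpha> * N \<delta> \<gamma> * R \<gamma> \<beta> \<alpha> \<delta>)"
    unfolding second_chern_scalar_def chern_R3_def N_def R_def sum_distrib_left mult.assoc ..
  have real: "cnj (second_chern_scalar A h c p) = second_chern_scalar A h c p"
  proof -
    \<comment> \<open>Conjugation reverses the roles of the four indices; reversing the order of the
      four sums restores the original expression.\<close>
    have "cnj (second_chern_scalar A h c p) = (\<Sum>\<alpha>\<in>UNIV. \<Sum>\<beta>\<in>UNIV. \<Sum>\<gamma>\<in>UNIV. \<Sum>\<delta>\<in>UNIV. N \<gamma> \<delta> * N \<alpha> \<beta> * R \<beta> \<gamma> \<delta> \<alpha>)"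
      unfolding s2 cnj_sum complex_cnj_mult N_cnj R_cnj by (simp only: mult_ac)
    also have "\<dots> = (\<Sum>\<delta>\<in>UNIV. \<Sum>\<gamma>\<in>UNIV. \<Sum>\<beta>\<in>UNIV. \<Sum>\<alpha>\<in>UNIV. N \<gamma> \<delta> * N \<alpha> \<beta> * R \<beta> \<gamma> \<delta> \<alpha>)"
    proof -
      have "(\<Sum>\<alpha>\<in>UNIV. \<Sum>\<beta>\<in>UNIV. \<Sum>\<gamma>\<in>UNIV. \<Sum>\<delta>\<in>UNIV. F \<alpha> \<beta> \<gamma> \<delta>) = (\<Sum>\<delta>\<in>UNIV. \<Sum>\<gamma>\<in>UNIV. \<Sum>\<beta>\<in>UNIV. \<Sum>\<alpha>\<in>UNIV. F \<alpha> \<beta> \<gamma> \<delta>)"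
        for F :: "'n \<Rightarrow> 'n \<Rightarrow> 'n \<Rightarrow> 'n \<Rightarrow> complex"
        unfolding sum.cartesian_product
        by (rule sum.reindex_bij_witness[where i = "\<lambda>(\<delta>, \<gamma>, \<beta>, \<alpha>). (\<alpha>, \<beta>, \<gamma>, \<delta>)" and j = "\<lambda>(\<alpha>, \<beta>, \<gamma>, \<delta>). (\<delta>, \<gamma>, \<beta>, \<alpha>)"]) auto
      then show ?thesis .
    qed
    finally show ?thesis unfolding s2 .
  qed
  define E where "E = (\<lambda>i \<gamma> \<alpha> \<kappa>. \<Sum>\<delta>\<in>UNIV. x i \<delta> * dz A c \<delta> p (Gam \<gamma> \<alpha> \<kappa>) + cnj (x i \<delta>) * dzb A c \<delta> p (Gam \<gamma> \<alpha> \<kappa>))"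
  define \<theta> where "\<theta> = (\<lambda>i \<alpha> \<kappa>. \<Sum>\<gamma>\<in>UNIV. x i \<gamma> * Gam \<gamma> \<alpha> \<kappa> p)"
  have E: "e i p (Gam \<gamma> \<alpha> \<kappa>) = E i \<gamma> \<alpha> \<kappa>" if "i \<in> ?I" for i \<gamma> \<alpha> \<kappa>
  proof -
    have r: "e i p \<in> rtangent A p" using rf[OF that] W(2) by (simp add: real_field_def)
    show ?thesis
      unfolding tangent_expand[OF ct[OF that] c p, of "Gam \<gamma> \<alpha> \<kappa>"] rtangent_coordb[OF r] E_def x_def ..
  qed
  have \<theta>: "conn_form \<alpha> \<kappa> p (e i p) = \<theta> i \<alpha> \<kappa>" for i \<alpha> \<kappa>
    by (simp add: conn_form_def \<theta>_def x_def)
  \<comment> \<open>In \<open>scalar_curv\<close> the differentiated field and the second direction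
    are both \<open>e j\<close>, while \<open>e i\<close> is the first direction and the vector
    paired against. Hence the double occurrence of \<open>x j\<close>.\<close>
  have "riem A h p (curv A (induced A D) (e j) (e i) (e j) p) (e i p) = Re (\<Sum>\<kappa>\<in>UNIV. \<Sum>\<beta>\<in>UNIV.
      (\<Sum>\<alpha>\<in>UNIV. x j \<alpha> * ((\<Sum>\<gamma>\<in>UNIV. x j \<gamma> * E i \<gamma> \<alpha> \<kappa>) + (\<Sum>\<beta>\<in>UNIV. \<theta> j \<alpha> \<beta> * \<theta> i \<beta> \<kappa>)
        - (\<Sum>\<gamma>\<in>UNIV. x i \<gamma> * E j \<gamma> \<alpha> \<kappa>) - (\<Sum>\<beta>\<in>UNIV. \<theta> i \<alpha> \<beta> * \<theta> j \<beta> \<kappa>))) * cnj (x i \<beta>) * H \<kappa> \<beta> p)"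
    if ij: "i \<in> ?I" "j \<in> ?I" for i j
    by (rule riem_components[OF p _ o[OF ij(1)]],
      unfold curv_components[OF W rf[OF ij(2)] rf[OF ij(1)] rf[OF ij(2)]] E[OF ij(1)] E[OF ij(2)] \<theta> x_def[symmetric], rule refl)
  then have "scalar_curv A h (induced A D) e p = Re (\<Sum>i\<in>?I. \<Sum>j\<in>?I. \<Sum>\<kappa>\<in>UNIV. \<Sum>\<beta>\<in>UNIV.
      (\<Sum>\<alpha>\<in>UNIV. x j \<alpha> * ((\<Sum>\<gamma>\<in>UNIV. x j \<gamma> * E i \<gamma> \<alpha> \<kappa>) + (\<Sum>\<beta>\<in>UNIV. \<theta> j \<alpha> \<beta> * \<theta> i \<beta> \<kappa>)
        - (\<Sum>\<gamma>\<in>UNIV. x i \<gamma> * E j \<gamma> \<alpha> \<kappa>) - (\<Sum>\<beta>\<in>UNIV. \<theta> i \<alpha> \<beta> * \<theta> j \<beta> \<kappa>))) * cnj (x i \<beta>) * H \<kappa> \<beta> p)"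
    unfolding scalar_curv_def Re_sum[of _ ?I] by (intro sum.cong refl) 
  also have "\<dots> = Re (4 * (\<Sum>\<alpha>\<in>UNIV. \<Sum>\<beta>\<in>UNIV. \<Sum>\<gamma>\<in>UNIV. \<Sum>\<delta>\<in>UNIV. N \<delta> \<alpha> * N \<beta> \<gamma> * R \<alpha> \<beta> \<gamma> \<delta>))"
    unfolding E_def \<theta>_def R_def chern_R_Gam[OF p inv] by (subst frame_contraction[OF xx xcx]) (rule refl)
  \<comment> \<open>Exchanging the names \<alpha> and \<gamma> matches the index pattern of
    \<open>chern_R3\<close>, where the first and third slots of the curvature are swapped relative
    to the frame computation.\<close>
  also have "(\<Sum>\<alpha>\<in>UNIV. \<Sum>\<beta>\<in>UNIV. \<Sum>\<gamma>\<in>UNIV. \<Sum>\<delta>\<in>UNIV. N \<delta> \<alpha> * N \<beta> \<gamma> * R \<alpha> \<beta> \<gamma> \<delta>) = second_chern_scalar A h c p"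
  proof -
    have "(\<Sum>\<alpha>\<in>UNIV. \<Sum>\<beta>\<in>UNIV. \<Sum>\<gamma>\<in>UNIV. \<Sum>\<delta>\<in>UNIV. F \<alpha> \<beta> \<gamma> \<delta>) = (\<Sum>\<gamma>\<in>UNIV. \<Sum>\<beta>\<in>UNIV. \<Sum>\<alpha>\<in>UNIV. \<Sum>\<delta>\<in>UNIV. F \<alpha> \<beta> \<gamma> \<delta>)"
      for F :: "'n \<Rightarrow> 'n \<Rightarrow> 'n \<Rightarrow> 'n \<Rightarrow> complex"
      unfolding sum.cartesian_product
      by (rule sum.reindex_bij_witness[where i = "\<lambda>(\<gamma>, \<beta>, \<alpha>, \<delta>). (\<alpha>, \<beta>, \<gamma>, \<delta>)" and j = "\<lambda>(\<alpha>, \<beta>, \<gamma>, \<delta>). (\<gamma>, \<beta>, \<alpha>, \<delta>)"]) auto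
    then show ?thesis unfolding s2 by (simp only: mult.commute[of "N _ _" "N _ _"])
  qed
  finally have "scalar_curv A h (induced A D) e p = Re (4 * second_chern_scalar A h c p)" .
  \<comment> \<open>The frame computation determines only a real part; reality of the scalar turns
    this into the equation of complex numbers.\<close>
  moreover have "Im (second_chern_scalar A h c p) = 0"
    using arg_cong[OF real, of Im] by simp
  ultimately show ?thesis by (simp add: complex_eq_iff)
qed

end

theorem proposition2p8:
  fixes A :: "('m::{t2_space,second_countable_topology}, 'n::finite) chart set"
    and h :: "'m \<Rightarrow> 'm tvec \<Rightarrow> 'm tvec \<Rightarrow> complex"
    and D :: "'m conn"
    and U :: "'m set"
    and e :: "nat \<Rightarrow> 'm \<Rightarrow> 'm tvec"
    and c :: "('m, 'n) chart"
    and p :: 'm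
  assumes "complex_manifold A"
    and "hermitian_metric A h"
    and "chern_connection A h D"
    and "open U" and "p \<in> U" and "orthonormal_frame A h U e"
    and "c \<in> A" and "p \<in> fst c"
  shows "complex_of_real (scalar_curv A h (induced A D) e p) = 4 * second_chern_scalar A h c p"
proof -
  interpret chern_chart A h D c
    by unfold_locales (fact assms)+
  show ?thesis by (rule scalar_curv_eq_second_chern_scalar[OF assms(4-6,8)])
qed

end
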